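(* Let $k>1/2$ and let $(X_t)_{t\ge1}$ be the solution of $$\mathrm{d}X_t=k|X_t|\,\mathrm{d}t+e^{-t/2}\,\mathrm{d}B_t .$$ Then $X_t\to\infty$ almost surely as $t\to\infty$.
   Context: $(B_t)$ is a standard one-dimensional Brownian motion. *)

theory Defs
  imports "HOL-Probability.Probability"
begin

text \<open>Time is the type of reals, but only the \<open>\<sigma>\<close>-algebras \<open>F t\<close> with \<open>t \<ge> 0\<close> are ever used
  (a filtration on the half-line can be extended by \<open>F t = F 0\<close> for \<open>t < 0\<close>). The filtration need
  not be complete or right-continuous.\<close>

definition filtered_prob_space :: "'a measure \<Rightarrow> (real \<Rightarrow> 'a measure) \<Rightarrow> bool" where
  "filtered_prob_space M F \<longleftrightarrow>
     prob_space M \<and> filtration (space M) F \<and> (\<forall>t. subalgebra M (F t))"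

definition adapted_from :: "real \<Rightarrow> (real \<Rightarrow> 'a measure) \<Rightarrow> (real \<Rightarrow> 'a \<Rightarrow> real) \<Rightarrow> bool" where
  "adapted_from t0 F X \<longleftrightarrow> (\<forall>t\<ge>t0. X t \<in> borel_measurable (F t))"

text \<open>Standard one-dimensional Brownian motion relative to the filtration \<open>F\<close>. Note that
  \<open>normal_density\<close> takes the standard deviation as its second argument.\<close>

definition standard_brownian_motion ::
  "'a measure \<Rightarrow> (real \<Rightarrow> 'a measure) \<Rightarrow> (real \<Rightarrow> 'a \<Rightarrow> real) \<Rightarrow> bool" where
  "standard_brownian_motion M F B \<longleftrightarrow>
     adapted_from 0 F B \<and>
     (AE \<omega> in M. B 0 \<omega> = 0) \<and>
     (AE \<omega> in M. continuous_on {0..} (\<lambda>t. B t \<omega>)) \<and>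
     (\<forall>s t. 0 \<le> s \<and> s < t \<longrightarrow>
        distributed M lborel (\<lambda>\<omega>. B t \<omega> - B s \<omega>) (normal_density 0 (sqrt (t - s))) \<and>
        prob_space.indep_set M (sets (F s))
          (sets (vimage_algebra (space M) (\<lambda>\<omega>. B t \<omega> - B s \<omega>) borel)))"

text \<open>A simple process on \<open>[a, T]\<close> is given by a partition \<open>a = \<tau> 0 < \<dots> < \<tau> n = T\<close> and bounded
  random variables \<open>\<xi> i\<close>, where \<open>\<xi> i\<close> is known at the left end point \<open>\<tau> i\<close>.\<close>

definition simple_process ::
  "'a measure \<Rightarrow> (real \<Rightarrow> 'a measure) \<Rightarrow> real \<Rightarrow> real \<Rightarrow>
   nat \<Rightarrow> (nat \<Rightarrow> real) \<Rightarrow> (nat \<Rightarrow> 'a \<Rightarrow> real) \<Rightarrow> bool" where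
  "simple_process M F a T n \<tau> \<xi> \<longleftrightarrow>
     \<tau> 0 = a \<and> \<tau> n = T \<and> (\<forall>i<n. \<tau> i < \<tau> (Suc i)) \<and>
     (\<forall>i<n. \<xi> i \<in> borel_measurable (F (\<tau> i))) \<and>
     (\<exists>C. \<forall>i<n. \<forall>\<omega>\<in>space M. \<bar>\<xi> i \<omega>\<bar> \<le> C)"

definition simple_process_val ::
  "nat \<Rightarrow> (nat \<Rightarrow> real) \<Rightarrow> (nat \<Rightarrow> 'a \<Rightarrow> real) \<Rightarrow> real \<Rightarrow> 'a \<Rightarrow> real" where
  "simple_process_val n \<tau> \<xi> s \<omega> = (\<Sum>i<n. \<xi> i \<omega> * indicator {\<tau> i<..\<tau> (Suc i)} s)"

definition simple_integral_wrt ::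
  "(real \<Rightarrow> 'a \<Rightarrow> real) \<Rightarrow> nat \<Rightarrow> (nat \<Rightarrow> real) \<Rightarrow> (nat \<Rightarrow> 'a \<Rightarrow> real) \<Rightarrow> 'a \<Rightarrow> real" where
  "simple_integral_wrt B n \<tau> \<xi> \<omega> = (\<Sum>i<n. \<xi> i \<omega> * (B (\<tau> (Suc i)) \<omega> - B (\<tau> i) \<omega>))"

text \<open>The random variable \<open>J\<close> is (a version of) the Ito integral of \<open>H\<close> over \<open>[a, T]\<close>: the integrand
  is jointly measurable, adapted and square integrable, and \<open>J\<close> is the \<open>L\<^sup>2\<close>-limit of the
  integrals of simple processes that converge to \<open>H\<close> in \<open>L\<^sup>2\<close>.\<close>

definition is_ito_integral ::
  "'a measure \<Rightarrow> (real \<Rightarrow> 'a measure) \<Rightarrow> (real \<Rightarrow> 'a \<Rightarrow> real) \<Rightarrow> real \<Rightarrow> real \<Rightarrow>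
   (real \<Rightarrow> 'a \<Rightarrow> real) \<Rightarrow> ('a \<Rightarrow> real) \<Rightarrow> bool" where
  "is_ito_integral M F B a T H J \<longleftrightarrow>
     (\<lambda>(\<omega>, s). H s \<omega>) \<in> borel_measurable (M \<Otimes>\<^sub>M restrict_space lborel {a..T}) \<and>
     (\<forall>s\<in>{a..T}. H s \<in> borel_measurable (F s)) \<and>
     (\<integral>\<^sup>+\<omega>. (\<integral>\<^sup>+s\<in>{a..T}. ennreal ((H s \<omega>)\<^sup>2) \<partial>lborel) \<partial>M) < \<infinity> \<and>
     J \<in> borel_measurable M \<and>
     (\<exists>n \<tau> \<xi>.
        (\<forall>m. simple_process M F a T (n m) (\<tau> m) (\<xi> m)) \<and>
        ((\<lambda>m. \<integral>\<^sup>+\<omega>. (\<integral>\<^sup>+s\<in>{a..T}.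
             ennreal ((H s \<omega> - simple_process_val (n m) (\<tau> m) (\<xi> m) s \<omega>)\<^sup>2) \<partial>lborel) \<partial>M)
           \<longlonglongrightarrow> 0) \<and>
        ((\<lambda>m. \<integral>\<^sup>+\<omega>. ennreal ((J \<omega> - simple_integral_wrt B (n m) (\<tau> m) (\<xi> m) \<omega>)\<^sup>2) \<partial>M)
           \<longlonglongrightarrow> 0))"

text \<open>Solutions, for \<open>t \<ge> t0\<close>, of \<open>dX = b(t, X) dt + \<sigma>(t) dB\<close>, understood as the integral equation
  \<open>X t = X t0 + \<integral> b(s, X s) ds + \<integral> \<sigma>(s) dB\<close>. The initial value \<open>X t0\<close> is an arbitrary
  \<open>F t0\<close>-measurable random variable. Requiring the equation simultaneously for all \<open>t\<close> outside a
  single null set makes \<open>Y\<close> the (almost surely) continuous version of the Ito integral.\<close>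

definition sde_solution ::
  "'a measure \<Rightarrow> (real \<Rightarrow> 'a measure) \<Rightarrow> (real \<Rightarrow> 'a \<Rightarrow> real) \<Rightarrow>
   (real \<Rightarrow> real \<Rightarrow> real) \<Rightarrow> (real \<Rightarrow> real) \<Rightarrow> real \<Rightarrow> (real \<Rightarrow> 'a \<Rightarrow> real) \<Rightarrow> bool" where
  "sde_solution M F B b \<sigma> t0 X \<longleftrightarrow>
     adapted_from t0 F X \<and>
     (AE \<omega> in M. continuous_on {t0..} (\<lambda>t. X t \<omega>)) \<and>
     (AE \<omega> in M. \<forall>t\<ge>t0. set_integrable lborel {t0..t} (\<lambda>s. b s (X s \<omega>))) \<and>
     (\<exists>Y. (\<forall>t\<ge>t0. is_ito_integral M F B t0 t (\<lambda>s \<omega>. \<sigma> s) (Y t)) \<and>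
          (AE \<omega> in M. \<forall>t\<ge>t0.
             X t \<omega> = X t0 \<omega> + (LINT s:{t0..t}|lborel. b s (X s \<omega>)) + Y t \<omega>))"

end

theory Submission
  imports Defs "HOL-Real_Asymp.Real_Asymp"
begin

text \<open>The drift \<open>k \<bar>X\<bar>\<close> is nonnegative and the noise \<open>\<integral> exp (- s / 2) dB\<close> converges almost
  surely, so every path of \<open>X\<close> converges to a limit in \<open>(-\<infinity>, \<infinity>]\<close>. A finite limit other than \<open>0\<close>
  would make the accumulated drift infinite. What has to be excluded is \<open>X \<longlonglongrightarrow> 0\<close>, the
  convergence to the point where the drift vanishes (\<open>driven_path_alternative\<close>).

  Write \<open>a = k + 1/2\<close> and \<open>b = k - 1/2\<close>, and compare \<open>X\<close> with the two linear equations that come from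
  \<open>\<bar>x\<bar> \<ge> - x\<close> and \<open>\<bar>x\<bar> \<ge> x\<close>. By the first one, \<open>exp (t / 2) X t\<close> is at least the noise accumulated between
  a time \<open>m\<close> and \<open>t\<close>, discounted at rate \<open>b\<close>, up to an error of order \<open>exp (- b t)\<close>. By the second one,
  if \<open>X\<close> tends to \<open>0\<close> then \<open>exp (t / 2) X t\<close> is at most minus the noise that arrives after \<open>t\<close>, discounted at
  rate \<open>a\<close>; otherwise that noise would push the path into exponential growth. Adding both
  bounds eliminates \<open>X\<close>: a two-sided exponential average of the Brownian increments around
  time \<open>t\<close>, the escape functional \<open>G m t\<close>, is bounded above by a multiple of \<open>exp (- b t)\<close>
  (\<open>escape_kernel_le\<close>). This is where \<open>k > 1/2\<close> enters: below \<open>0\<close> the drift contracts at rate \<open>k\<close>,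
  faster than the noise decays, so that on the scale of the noise the initial value is
  forgotten at rate \<open>b > 0\<close>.

  On the other hand \<open>G m t\<close> involves only increments after time \<open>m\<close>. On any event of \<open>F m\<close> it has
  mean zero, its second moment is bounded uniformly in \<open>m\<close> and \<open>t\<close>, and its covariance
  with \<open>B (t + 1) - B t\<close> is bounded below by a multiple of the probability of the event. Hence
  its positive part has a substantial mean on that event (\<open>escape_functional_lower_bound\<close>). The
  event \<open>{X \<longlonglongrightarrow> 0}\<close> is not in any \<open>F m\<close>, but since the only alternative is \<open>X \<longlonglongrightarrow> \<infinity>\<close>, it is the
  almost sure limit of the events \<open>{\<bar>X m\<bar> < 1}\<close>, which are. As the positive part of \<open>G m t\<close> tends to
  \<open>0\<close> on \<open>{X \<longlonglongrightarrow> 0}\<close>, this event is null (\<open>prob_confinement_eq_0\<close>).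

  The comparison is made path by path. The Ito integral of the smooth function \<open>exp (- s / 2)\<close> is therefore
  replaced by its integrated-by-parts form, which is defined for every continuous path
  (\<open>ito_integral_eq_wiener_integral\<close>). The improper time integrals converge because Brownian
  paths grow at most linearly, which follows from Kolmogorov's maximal inequality.\<close>

section \<open>Moments of Brownian increments\<close>

lemma integrable_mult_of_squares:
  fixes f g :: "'a \<Rightarrow> real"
  assumes "f \<in> borel_measurable M" "g \<in> borel_measurable M"
    and "integrable M (\<lambda>\<omega>. (f \<omega>)\<^sup>2)" "integrable M (\<lambda>\<omega>. (g \<omega>)\<^sup>2)"
  shows "integrable M (\<lambda>\<omega>. f \<omega> * g \<omega> :: real)"
proof (rule Bochner_Integration.integrable_bound)
  show "integrable M (\<lambda>\<omega>. (f \<omega>)\<^sup>2 + (g \<omega>)\<^sup>2)" using assms by simp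
  show "AE \<omega> in M. norm (f \<omega> * g \<omega>) \<le> norm ((f \<omega>)\<^sup>2 + (g \<omega>)\<^sup>2)"
  proof (rule AE_I2)
    fix \<omega>
    have "0 \<le> (\<bar>f \<omega>\<bar> - \<bar>g \<omega>\<bar>)\<^sup>2" by simp
    then have "2 * (\<bar>f \<omega>\<bar> * \<bar>g \<omega>\<bar>) \<le> (f \<omega>)\<^sup>2 + (g \<omega>)\<^sup>2"
      by (simp add: power2_diff)
    moreover have "0 \<le> \<bar>f \<omega>\<bar> * \<bar>g \<omega>\<bar>" by simp
    ultimately show "norm (f \<omega> * g \<omega>) \<le> norm ((f \<omega>)\<^sup>2 + (g \<omega>)\<^sup>2)"
      unfolding real_norm_def abs_mult by linarith
  qed
qed (use assms in measurable)

lemma bounded_times_integrable: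
  assumes \<eta>: "\<eta> \<in> borel_measurable M" "\<And>\<omega>. \<omega> \<in> space M \<Longrightarrow> \<bar>\<eta> \<omega>\<bar> \<le> C"
    and f: "integrable M f"
  shows "integrable M (\<lambda>\<omega>. \<eta> \<omega> * f \<omega> :: real)"
proof (rule Bochner_Integration.integrable_bound)
  show "integrable M (\<lambda>\<omega>. C * \<bar>f \<omega>\<bar>)" using f by simp
  show "AE \<omega> in M. norm (\<eta> \<omega> * f \<omega>) \<le> norm (C * \<bar>f \<omega>\<bar>)"
  proof (rule AE_I2)
    fix \<omega> assume "\<omega> \<in> space M"
    then have "\<bar>\<eta> \<omega>\<bar> \<le> \<bar>C\<bar>" using \<eta>(2) by fastforce
    then show "norm (\<eta> \<omega> * f \<omega>) \<le> norm (C * \<bar>f \<omega>\<bar>)"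
      by (simp add: abs_mult mult_right_mono)
  qed
qed (use assms in measurable)

locale brownian_motion = prob_space M for M :: "'a measure" +
  fixes F :: "real \<Rightarrow> 'a measure" and B :: "real \<Rightarrow> 'a \<Rightarrow> real"
  assumes filtered: "filtered_prob_space M F"
    and brownian: "standard_brownian_motion M F B"
begin

lemma subalgebra_F: "subalgebra M (F t)"
  using filtered by (auto simp: filtered_prob_space_def)

lemma measurable_F_mono:
  assumes "s \<le> t" "f \<in> borel_measurable (F s)"
  shows "f \<in> borel_measurable (F t)"
proof -
  have fl: "filtration (space M) F"
    using filtered by (auto simp: filtered_prob_space_def)
  have "subalgebra (F t) (F s)"
    unfolding subalgebra_def
    using filtration.space_F[OF fl] filtration.sets_F_mono[OF fl assms(1)] by simp
  then show ?thesis using measurable_from_subalg assms(2) by blast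
qed

lemma measurable_F_M: "f \<in> borel_measurable (F s) \<Longrightarrow> f \<in> borel_measurable M"
  using measurable_from_subalg[OF subalgebra_F] .

lemma B_measurable_F: "0 \<le> t \<Longrightarrow> t \<le> u \<Longrightarrow> B t \<in> borel_measurable (F u)"
  using brownian measurable_F_mono[of t u "B t"]
  by (auto simp: standard_brownian_motion_def adapted_from_def)

lemma B_measurable [measurable]: "0 \<le> t \<Longrightarrow> B t \<in> borel_measurable M"
  using B_measurable_F[of t t] measurable_F_M by blast

lemma increment_distributed:
  assumes "0 \<le> s" "s < t"
  shows "distributed M lborel (\<lambda>\<omega>. B t \<omega> - B s \<omega>) (normal_density 0 (sqrt (t - s)))"
  using brownian assms by (auto simp: standard_brownian_motion_def)

text \<open>The definition of Brownian motion states the independence of an increment from the past for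
  \<open>\<sigma>\<close>-algebras; the product rule for expectations needs it for random variables.\<close>

lemma increment_indep:
  assumes "0 \<le> s" "s < t" and \<eta>: "\<eta> \<in> borel_measurable (F s)"
  shows "indep_var borel \<eta> borel (\<lambda>\<omega>. B t \<omega> - B s \<omega>)"
proof -
  let ?D = "\<lambda>\<omega>. B t \<omega> - B s \<omega>"
  have [measurable]: "\<eta> \<in> borel_measurable M" "?D \<in> borel_measurable M"
    using measurable_F_M[OF \<eta>] assms by auto
  have ind: "indep_set (sets (F s)) (sets (vimage_algebra (space M) ?D borel))"
    using brownian assms by (auto simp: standard_brownian_motion_def)
  have sp: "space (F s) = space M"
    using subalgebra_F by (simp add: subalgebra_def)
  have stable: "Int_stable {f -` A \<inter> space M |A. A \<in> sets borel}" for f :: "'a \<Rightarrow> real"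
  proof (rule Int_stableI, safe)
    fix A A' :: "real set" assume "A \<in> sets borel" "A' \<in> sets borel"
    then show "\<exists>C. f -` A \<inter> space M \<inter> (f -` A' \<inter> space M) = f -` C \<inter> space M \<and> C \<in> sets borel"
      by (intro exI[of _ "A \<inter> A'"]) auto
  qed
  have "indep_set {\<eta> -` A \<inter> space M |A. A \<in> sets borel} {?D -` A \<inter> space M |A. A \<in> sets borel}"
    unfolding indep_set_def
  proof (rule indep_sets_mono_sets[OF ind[unfolded indep_set_def]])
    fix b :: bool
    show "(case b of True \<Rightarrow> {\<eta> -` A \<inter> space M |A. A \<in> sets borel}
        | False \<Rightarrow> {?D -` A \<inter> space M |A. A \<in> sets borel})
      \<subseteq> (case b of True \<Rightarrow> sets (F s) | False \<Rightarrow> sets (vimage_algebra (space M) ?D borel))"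
      using measurable_sets[OF \<eta>] sp
      by (auto split: bool.split simp: sets_vimage_algebra2)
  qed
  then have "indep_set (sigma_sets (space M) {\<eta> -` A \<inter> space M |A. A \<in> sets borel})
     (sigma_sets (space M) {?D -` A \<inter> space M |A. A \<in> sets borel})"
    by (intro indep_set_sigma_sets stable)
  then show ?thesis
    unfolding indep_var_eq by simp
qed

lemma increment_moments:
  assumes st: "0 \<le> s" "s \<le> t"
  shows "integrable M (\<lambda>\<omega>. (B t \<omega> - B s \<omega>) ^ n)"
    and "expectation (\<lambda>\<omega>. B t \<omega> - B s \<omega>) = 0"
    and "expectation (\<lambda>\<omega>. (B t \<omega> - B s \<omega>)\<^sup>2) = t - s"
    and "expectation (\<lambda>\<omega>. (B t \<omega> - B s \<omega>) ^ 4) = 3 * (t - s)\<^sup>2"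
proof -
  have "integrable M (\<lambda>\<omega>. (B t \<omega> - B s \<omega>) ^ n) \<and>
    expectation (\<lambda>\<omega>. B t \<omega> - B s \<omega>) = 0 \<and>
    expectation (\<lambda>\<omega>. (B t \<omega> - B s \<omega>)\<^sup>2) = t - s \<and>
    expectation (\<lambda>\<omega>. (B t \<omega> - B s \<omega>) ^ 4) = 3 * (t - s)\<^sup>2"
  proof (cases "s = t")
    case True
    then show ?thesis by (cases n) auto
  next
    case False
    then have lt: "s < t" and pos: "0 < sqrt (t - s)" using st by auto
    note D = increment_distributed[OF st(1) lt]
    have I: "expectation (\<lambda>\<omega>. (B t \<omega> - B s \<omega>) ^ j)
        = (\<integral>x. normal_density 0 (sqrt (t - s)) x * x ^ j \<partial>lborel)" for j
      using distributed_integral[OF D, of "\<lambda>x. x ^ j"] by simp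
    have "integrable M (\<lambda>\<omega>. (B t \<omega> - B s \<omega>) ^ n)"
      using distributed_integrable[OF D, of "\<lambda>x. x ^ n"] integrable_normal_moment[OF pos, of 0 n] by simp
    moreover have "expectation (\<lambda>\<omega>. B t \<omega> - B s \<omega>) = 0"
      using I[of 1] integral_normal_moment_odd[OF pos, of 0 0] by simp
    moreover have "expectation (\<lambda>\<omega>. (B t \<omega> - B s \<omega>)\<^sup>2) = t - s"
      using I[of 2] integral_normal_moment_even[OF pos, of 0 1] lt by (simp add: fact_numeral)
    moreover have "expectation (\<lambda>\<omega>. (B t \<omega> - B s \<omega>) ^ 4) = 3 * (t - s)\<^sup>2"
      using I[of 4] integral_normal_moment_even[OF pos, of 0 2] lt
      by (simp add: fact_numeral power2_eq_square)
    ultimately show ?thesis by blast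
  qed
  then show "integrable M (\<lambda>\<omega>. (B t \<omega> - B s \<omega>) ^ n)"
    and "expectation (\<lambda>\<omega>. B t \<omega> - B s \<omega>) = 0"
    and "expectation (\<lambda>\<omega>. (B t \<omega> - B s \<omega>)\<^sup>2) = t - s"
    and "expectation (\<lambda>\<omega>. (B t \<omega> - B s \<omega>) ^ 4) = 3 * (t - s)\<^sup>2" by auto
qed

lemma expectation_past_times_increment_power:
  assumes st: "0 \<le> s" "s \<le> t" and \<eta>: "\<eta> \<in> borel_measurable (F s)" "integrable M \<eta>" and n: "n \<noteq> 0"
  shows "integrable M (\<lambda>\<omega>. \<eta> \<omega> * (B t \<omega> - B s \<omega>) ^ n)"
    and "expectation (\<lambda>\<omega>. \<eta> \<omega> * (B t \<omega> - B s \<omega>) ^ n)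
      = expectation \<eta> * expectation (\<lambda>\<omega>. (B t \<omega> - B s \<omega>) ^ n)"
proof -
  let ?D = "\<lambda>\<omega>. (B t \<omega> - B s \<omega>) ^ n"
  have "integrable M (\<lambda>\<omega>. \<eta> \<omega> * ?D \<omega>) \<and>
      expectation (\<lambda>\<omega>. \<eta> \<omega> * ?D \<omega>) = expectation \<eta> * expectation ?D"
  proof (cases "s = t")
    case True
    then show ?thesis using n by (simp add: power_0_left)
  next
    case False
    then have "s < t" using st by simp
    from indep_var_compose[OF increment_indep[OF st(1) this \<eta>(1)], of "\<lambda>x. x" borel "\<lambda>x. x ^ n" borel]
    have "indep_var borel \<eta> borel ?D" by (simp add: comp_def)
    from indep_var_integrable[OF this \<eta>(2)] indep_var_lebesgue_integral[OF this \<eta>(2)]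
    show ?thesis using increment_moments(1)[OF st, of n] by simp
  qed
  then show "integrable M (\<lambda>\<omega>. \<eta> \<omega> * ?D \<omega>)"
    and "expectation (\<lambda>\<omega>. \<eta> \<omega> * ?D \<omega>) = expectation \<eta> * expectation ?D" by auto
qed

lemma expectation_past_times_increment:
  assumes "0 \<le> s" "s \<le> t" "\<eta> \<in> borel_measurable (F s)" "integrable M \<eta>"
  shows "integrable M (\<lambda>\<omega>. \<eta> \<omega> * (B t \<omega> - B s \<omega>))"
    and "expectation (\<lambda>\<omega>. \<eta> \<omega> * (B t \<omega> - B s \<omega>)) = 0"
  using expectation_past_times_increment_power[OF assms, of 1] increment_moments(2)[OF assms(1,2)]
  by auto

lemma expectation_past_times_increment_square:
  assumes "0 \<le> s" "s \<le> t" "\<eta> \<in> borel_measurable (F s)" "integrable M \<eta>"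
  shows "integrable M (\<lambda>\<omega>. \<eta> \<omega> * (B t \<omega> - B s \<omega>)\<^sup>2)"
    and "expectation (\<lambda>\<omega>. \<eta> \<omega> * (B t \<omega> - B s \<omega>)\<^sup>2) = expectation \<eta> * (t - s)"
  using expectation_past_times_increment_power[OF assms, of 2] increment_moments(3)[OF assms(1,2)]
  by auto

lemma B_moments:
  assumes "0 \<le> t"
  shows "integrable M (B t)" "integrable M (\<lambda>\<omega>. (B t \<omega>)\<^sup>2)" "expectation (\<lambda>\<omega>. (B t \<omega>)\<^sup>2) = t"
proof -
  have [measurable]: "B t \<in> borel_measurable M" "B 0 \<in> borel_measurable M" using assms by auto
  have "AE \<omega> in M. B 0 \<omega> = 0"
    using brownian by (auto simp: standard_brownian_motion_def)
  then have *: "AE \<omega> in M. B t \<omega> - B 0 \<omega> = B t \<omega>" "AE \<omega> in M. (B t \<omega> - B 0 \<omega>)\<^sup>2 = (B t \<omega>)\<^sup>2"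
    by auto
  show "integrable M (B t)" "integrable M (\<lambda>\<omega>. (B t \<omega>)\<^sup>2)"
    using integrable_cong_AE_imp[OF increment_moments(1)[of 0 t 1, simplified], of "B t"]
      integrable_cong_AE_imp[OF increment_moments(1)[of 0 t 2], of "\<lambda>\<omega>. (B t \<omega>)\<^sup>2"] * assms by auto
  show "expectation (\<lambda>\<omega>. (B t \<omega>)\<^sup>2) = t"
    using integral_cong_AE[OF _ _ *(2)] increment_moments(3)[of 0 t] assms by simp
qed

lemma bounded_past_times_increment:
  assumes p: "0 \<le> p" "p \<le> q"
    and \<eta>: "\<eta> \<in> borel_measurable (F p)" "\<And>\<omega>. \<omega> \<in> space M \<Longrightarrow> \<bar>\<eta> \<omega>\<bar> \<le> C"
  shows "integrable M (\<lambda>\<omega>. \<eta> \<omega> * (B q \<omega> - B p \<omega>))"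
    and "expectation (\<lambda>\<omega>. \<eta> \<omega> * (B q \<omega> - B p \<omega>)) = 0"
proof -
  have "integrable M \<eta>"
    using integrable_const_bound[of \<eta> C] \<eta>(2) measurable_F_M[OF \<eta>(1)] by auto
  from expectation_past_times_increment[OF p \<eta>(1) this]
  show "integrable M (\<lambda>\<omega>. \<eta> \<omega> * (B q \<omega> - B p \<omega>))"
    and "expectation (\<lambda>\<omega>. \<eta> \<omega> * (B q \<omega> - B p \<omega>)) = 0" .
qed

text \<open>Splitting the increment at \<open>r\<close>: the part of \<open>(p, q]\<close> after \<open>r\<close> is independent of everything
  else, the part before \<open>r\<close> occurs squared, and the difference of the minima is the length of
  the latter. The weight \<open>\<eta>\<close> expresses conditioning on the past.\<close>

lemma bounded_past_covariance:
  assumes p: "0 \<le> p" "p \<le> q" and r: "0 \<le> r"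
    and \<eta>: "\<eta> \<in> borel_measurable (F p)" "\<And>\<omega>. \<omega> \<in> space M \<Longrightarrow> \<bar>\<eta> \<omega>\<bar> \<le> C"
  shows "expectation (\<lambda>\<omega>. \<eta> \<omega> * (B q \<omega> - B p \<omega>) * B r \<omega>) = expectation \<eta> * (min q r - min p r)"
proof -
  note mM = measurable_F_M[OF \<eta>(1)]
  have I\<eta>: "integrable M \<eta>"
    using integrable_const_bound[of \<eta> C] \<eta>(2) mM by auto
  have I: "integrable M (\<lambda>\<omega>. \<eta> \<omega> * B u \<omega>)" if "0 \<le> u" for u
    by (rule bounded_times_integrable[OF mM \<eta>(2) B_moments(1)[OF that]])
  have past: "integrable M (\<lambda>\<omega>. \<eta> \<omega> * B u \<omega> * (B y \<omega> - B x \<omega>))"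
      "expectation (\<lambda>\<omega>. \<eta> \<omega> * B u \<omega> * (B y \<omega> - B x \<omega>)) = 0"
    if "0 \<le> u" "u \<le> x" "p \<le> x" "x \<le> y" for u x y
    using expectation_past_times_increment[of x y "\<lambda>\<omega>. \<eta> \<omega> * B u \<omega>"] I[of u] that p
      measurable_F_mono[OF _ \<eta>(1), of x] B_measurable_F[of u x] by auto
  have sq: "integrable M (\<lambda>\<omega>. \<eta> \<omega> * (B y \<omega> - B x \<omega>)\<^sup>2)"
      "expectation (\<lambda>\<omega>. \<eta> \<omega> * (B y \<omega> - B x \<omega>)\<^sup>2) = expectation \<eta> * (y - x)"
    if "p \<le> x" "x \<le> y" for x y
    using expectation_past_times_increment_square[of x y \<eta>] I\<eta> that p
      measurable_F_mono[OF _ \<eta>(1), of x] by auto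
  have full: "integrable M (\<lambda>\<omega>. \<eta> \<omega> * (B y \<omega> - B x \<omega>) * B y \<omega>)
      \<and> expectation (\<lambda>\<omega>. \<eta> \<omega> * (B y \<omega> - B x \<omega>) * B y \<omega>) = expectation \<eta> * (y - x)"
    if "p \<le> x" "x \<le> y" for x y
  proof -
    have *: "(\<lambda>\<omega>. \<eta> \<omega> * (B y \<omega> - B x \<omega>) * B y \<omega>) =
      (\<lambda>\<omega>. \<eta> \<omega> * (B y \<omega> - B x \<omega>)\<^sup>2 + \<eta> \<omega> * B x \<omega> * (B y \<omega> - B x \<omega>))"
      by (auto simp: power2_eq_square algebra_simps)
    show ?thesis unfolding * using past[of x x y] sq[of x y] that p by simp
  qed
  consider "r \<le> p" | "p \<le> r" "r \<le> q" | "q \<le> r" by linarith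
  then show ?thesis
  proof cases
    case 1
    then show ?thesis using past(2)[of r p q] r p by (simp add: mult_ac)
  next
    case 2
    have *: "(\<lambda>\<omega>. \<eta> \<omega> * (B q \<omega> - B p \<omega>) * B r \<omega>) =
      (\<lambda>\<omega>. \<eta> \<omega> * (B r \<omega> - B p \<omega>) * B r \<omega> + \<eta> \<omega> * B r \<omega> * (B q \<omega> - B r \<omega>))"
      by (auto simp: algebra_simps)
    show ?thesis unfolding * using past[of r r q] full[of p r] 2 r by simp
  next
    case 3
    have *: "(\<lambda>\<omega>. \<eta> \<omega> * (B q \<omega> - B p \<omega>) * B r \<omega>) =
      (\<lambda>\<omega>. \<eta> \<omega> * (B q \<omega> - B p \<omega>) * B q \<omega>
        + (\<eta> \<omega> * B q \<omega> * (B r \<omega> - B q \<omega>) - \<eta> \<omega> * B p \<omega> * (B r \<omega> - B q \<omega>)))"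
      by (auto simp: algebra_simps)
    show ?thesis unfolding * using past[of q q r] past[of p q r] full[of p q] 3 p by simp
  qed
qed

end

section \<open>Linear growth of Brownian paths\<close>

context brownian_motion
begin

text \<open>Kolmogorov's inequality. On the event \<open>D i\<close> that \<open>t i\<close> is the first time with a large value,
  the later increment is orthogonal to \<open>B (t i)\<close>, so it can only increase the second moment:
  \<open>a\<^sup>2 P (D i) \<le> E (B (t i)\<^sup>2; D i) \<le> E (B (t n)\<^sup>2; D i)\<close>. The events \<open>D i\<close> are disjoint.\<close>

lemma maximal_inequality_finite:
  assumes t: "\<And>i. i < n \<Longrightarrow> t i \<le> t (Suc i)" and t0: "0 \<le> t 0" and a: "0 < a"
  shows "{\<omega>\<in>space M. \<exists>i\<le>n. a \<le> \<bar>B (t i) \<omega>\<bar>} \<in> events"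
    and "prob {\<omega>\<in>space M. \<exists>i\<le>n. a \<le> \<bar>B (t i) \<omega>\<bar>} \<le> t n / a\<^sup>2"
proof -
  have mono: "t i \<le> t j" if "i \<le> j" "j \<le> n" for i j
    using that
  proof (induction j rule: dec_induct)
    case (step m)
    then show ?case using t[of m] by simp
  qed simp
  have nonneg: "0 \<le> t i" if "i \<le> n" for i
    using mono[of 0 i] t0 that by simp
  define D where "D i = {\<omega>\<in>space M. a \<le> \<bar>B (t i) \<omega>\<bar> \<and> (\<forall>j<i. \<bar>B (t j) \<omega>\<bar> < a)}" for i
  have spF: "space (F s) = space M" for s
    using subalgebra_F by (simp add: subalgebra_def)
  have DF: "D i \<in> sets (F (t i))" if "i \<le> n" for i
  proof -
    have BF: "B (t j) \<in> borel_measurable (F (t i))" if "j \<le> i" for j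
      using B_measurable_F mono[of j i] nonneg[of j] that \<open>i \<le> n\<close> by auto
    have lt: "{\<omega>\<in>space (F (t i)). \<bar>B (t j) \<omega>\<bar> < a} \<in> sets (F (t i))"
      and ge: "{\<omega>\<in>space (F (t i)). a \<le> \<bar>B (t j) \<omega>\<bar>} \<in> sets (F (t i))" if "j \<le> i" for j
      using BF[OF that] by (simp_all add: borel_measurable_less borel_measurable_le)
    have "{\<omega>\<in>space (F (t i)). a \<le> \<bar>B (t i) \<omega>\<bar> \<and> (\<forall>j\<in>{..<i}. \<bar>B (t j) \<omega>\<bar> < a)} \<in> sets (F (t i))"
      by (intro sets.sets_Collect_conj sets.sets_Collect_finite_All ge lt) auto
    then show ?thesis by (simp add: D_def spF Ball_def)
  qed
  have DM [measurable]: "D i \<in> events" if "i \<le> n" for i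
    using DF[OF that] subalgebra_F[of "t i"] by (auto simp: subalgebra_def)
  have U: "{\<omega>\<in>space M. \<exists>i\<le>n. a \<le> \<bar>B (t i) \<omega>\<bar>} = (\<Union>i\<in>{..n}. D i)" (is "?U = _")
  proof (intro equalityI subsetI)
    fix \<omega> assume "\<omega> \<in> ?U"
    then obtain i where i: "\<omega> \<in> space M" "i \<le> n" "a \<le> \<bar>B (t i) \<omega>\<bar>" by auto
    define l where "l = (LEAST i. a \<le> \<bar>B (t i) \<omega>\<bar>)"
    have "a \<le> \<bar>B (t l) \<omega>\<bar>" unfolding l_def using i(3) by (rule LeastI)
    moreover have "\<forall>j<l. \<bar>B (t j) \<omega>\<bar> < a"
      unfolding l_def using not_less_Least not_le by blast
    moreover have "l \<le> n" using Least_le[of "\<lambda>i. a \<le> \<bar>B (t i) \<omega>\<bar>" i] i by (simp add: l_def)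
    ultimately show "\<omega> \<in> (\<Union>i\<in>{..n}. D i)" using i(1) by (auto simp: D_def)
  qed (auto simp: D_def)
  show "?U \<in> events" unfolding U by auto
  have "D i \<inter> D j = {}" if "i < j" for i j
    using that by (fastforce simp: D_def)
  then have disj: "disjoint_family_on D {..n}"
    unfolding disjoint_family_on_def by (metis Int_commute nat_neq_iff)
  have n0: "0 \<le> t n" using nonneg by simp
  have In: "integrable M (\<lambda>\<omega>. indicator (D i) \<omega> * (B (t n) \<omega>)\<^sup>2)" if "i \<le> n" for i
    by (rule bounded_times_integrable[where C=1])
      (use that B_moments(2)[OF n0] in \<open>auto simp: indicator_def\<close>)
  have step: "a\<^sup>2 * prob (D i) \<le> expectation (\<lambda>\<omega>. indicator (D i) \<omega> * (B (t n) \<omega>)\<^sup>2)" if i: "i \<le> n" for i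
  proof -
    let ?d = "indicator (D i) :: 'a \<Rightarrow> real"
    let ?X = "\<lambda>\<omega>. ?d \<omega> * B (t i) \<omega>"
    have ti: "0 \<le> t i" "t i \<le> t n" using nonneg mono i by auto
    have dF: "?d \<in> borel_measurable (F (t i))" using DF[OF i] by simp
    have I1: "integrable M ?X"
      by (rule bounded_times_integrable[where C=1])
        (use i B_moments(1)[OF ti(1)] in \<open>auto simp: indicator_def\<close>)
    have I2: "integrable M (\<lambda>\<omega>. ?d \<omega> * (B (t i) \<omega>)\<^sup>2)"
      by (rule bounded_times_integrable[where C=1])
        (use i B_moments(2)[OF ti(1)] in \<open>auto simp: indicator_def\<close>)
    have I3: "integrable M (\<lambda>\<omega>. ?d \<omega> * (B (t n) \<omega> - B (t i) \<omega>)\<^sup>2)"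
      by (rule bounded_times_integrable[where C=1])
        (use i increment_moments(1)[OF ti] in \<open>auto simp: indicator_def\<close>)
    have XF: "?X \<in> borel_measurable (F (t i))"
      using dF B_measurable_F[OF ti(1), of "t i"] by simp
    note cross = expectation_past_times_increment[OF ti XF I1]
    have "a\<^sup>2 * prob (D i) = expectation (\<lambda>\<omega>. ?d \<omega> * a\<^sup>2)"
      using i by simp
    also have "\<dots> \<le> expectation (\<lambda>\<omega>. ?d \<omega> * (B (t i) \<omega>)\<^sup>2)"
    proof (rule integral_mono[OF _ I2])
      show "integrable M (\<lambda>\<omega>. ?d \<omega> * a\<^sup>2)"
        using i by (auto intro!: integrable_mult_left integrable_real_indicator simp: emeasure_eq_measure)
      show "?d \<omega> * a\<^sup>2 \<le> ?d \<omega> * (B (t i) \<omega>)\<^sup>2" for \<omega>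
        using a abs_le_square_iff[of a "B (t i) \<omega>"] by (auto simp: indicator_def D_def)
    qed
    also have "\<dots> \<le> expectation (\<lambda>\<omega>. ?d \<omega> * (B (t i) \<omega>)\<^sup>2)
        + 2 * expectation (\<lambda>\<omega>. ?X \<omega> * (B (t n) \<omega> - B (t i) \<omega>))
        + expectation (\<lambda>\<omega>. ?d \<omega> * (B (t n) \<omega> - B (t i) \<omega>)\<^sup>2)"
      unfolding cross(2) by (simp add: integral_nonneg_AE)
    also have "\<dots> = expectation (\<lambda>\<omega>. ?d \<omega> * (B (t i) \<omega>)\<^sup>2
        + 2 * (?X \<omega> * (B (t n) \<omega> - B (t i) \<omega>)) + ?d \<omega> * (B (t n) \<omega> - B (t i) \<omega>)\<^sup>2)"
      using I2 I3 cross(1) by simp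
    also have "\<dots> = expectation (\<lambda>\<omega>. ?d \<omega> * (B (t n) \<omega>)\<^sup>2)"
      by (intro Bochner_Integration.integral_cong) (auto simp: power2_eq_square algebra_simps)
    finally show ?thesis .
  qed
  have "a\<^sup>2 * prob ?U = (\<Sum>i\<le>n. a\<^sup>2 * prob (D i))"
    unfolding U using finite_measure_finite_Union[OF _ _ disj] DM
    by (simp add: image_subset_iff sum_distrib_left)
  also have "\<dots> \<le> (\<Sum>i\<le>n. expectation (\<lambda>\<omega>. indicator (D i) \<omega> * (B (t n) \<omega>)\<^sup>2))"
    using step by (intro sum_mono) auto
  also have "\<dots> = expectation (\<lambda>\<omega>. \<Sum>i\<le>n. indicator (D i) \<omega> * (B (t n) \<omega>)\<^sup>2)"
    using In by (intro Bochner_Integration.integral_sum[symmetric]) auto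
  also have "\<dots> \<le> expectation (\<lambda>\<omega>. (B (t n) \<omega>)\<^sup>2)"
  proof (rule integral_mono)
    show "integrable M (\<lambda>\<omega>. \<Sum>i\<le>n. indicator (D i) \<omega> * (B (t n) \<omega>)\<^sup>2)"
      using In by (intro Bochner_Integration.integrable_sum) auto
    show "(\<Sum>i\<le>n. indicator (D i) \<omega> * (B (t n) \<omega>)\<^sup>2) \<le> (B (t n) \<omega>)\<^sup>2" for \<omega>
      by (simp only: sum_distrib_right[symmetric] indicator_UN_disjoint[OF finite_atMost disj, symmetric])
        (auto simp: indicator_def)
  qed (rule B_moments(2)[OF n0])
  also have "\<dots> = t n" using B_moments(3)[OF n0] .
  finally show "prob ?U \<le> t n / a\<^sup>2" using a by (simp add: field_simps)
qed

end

text \<open>Dyadic approximation from the left carries statements from countably many times to all times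
  of a continuous path.\<close>

lemma dyadic_floor_tendsto: "(\<lambda>j. of_int \<lfloor>u * 2 ^ j\<rfloor> / 2 ^ j) \<longlonglongrightarrow> (u::real)"
proof (rule tendsto_sandwich)
  show "\<forall>\<^sub>F j in sequentially. u - (1 / 2) ^ j \<le> of_int \<lfloor>u * 2 ^ j\<rfloor> / 2 ^ j"
  proof (rule always_eventually, rule allI)
    fix j :: nat
    have "u * 2 ^ j - 1 \<le> of_int \<lfloor>u * 2 ^ j\<rfloor>" by linarith
    then have "(u * 2 ^ j - 1) / 2 ^ j \<le> of_int \<lfloor>u * 2 ^ j\<rfloor> / 2 ^ j"
      by (simp add: divide_right_mono)
    then show "u - (1 / 2) ^ j \<le> of_int \<lfloor>u * 2 ^ j\<rfloor> / 2 ^ j"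
      by (simp add: diff_divide_distrib power_one_over)
  qed
  show "\<forall>\<^sub>F j in sequentially. of_int \<lfloor>u * 2 ^ j\<rfloor> / 2 ^ j \<le> u"
    by (auto simp: field_simps)
  show "(\<lambda>j. u - (1 / 2) ^ j) \<longlonglongrightarrow> u"
    using tendsto_diff[OF tendsto_const LIMSEQ_realpow_zero[of "1/2 :: real"], of u] by simp
qed simp

context brownian_motion
begin

text \<open>The event of an exceedance need not be measurable because paths are only almost surely
  continuous, hence the measurable cover \<open>U\<close>.\<close>

lemma maximal_inequality:
  fixes T :: nat
  assumes a: "0 < a"
  shows "\<exists>U\<in>events. prob U \<le> T / a\<^sup>2 \<and>
    (\<forall>\<omega>. \<forall>t::real. \<omega> \<in> space M \<longrightarrow> continuous_on {0..} (\<lambda>t. B t \<omega>) \<longrightarrow> 0 \<le> t \<longrightarrow> t \<le> T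
      \<longrightarrow> a < \<bar>B t \<omega>\<bar> \<longrightarrow> \<omega> \<in> U)"
proof -
  define U where "U j = {\<omega>\<in>space M. \<exists>i\<le>T * 2 ^ j. a \<le> \<bar>B (real i / 2 ^ j) \<omega>\<bar>}" for j
  have meas: "U j \<in> events" and bound: "prob (U j) \<le> T / a\<^sup>2" for j
    using maximal_inequality_finite[of "T * 2 ^ j" "\<lambda>i. real i / 2 ^ j" a] a
    by (auto simp: U_def divide_right_mono)
  have inc: "incseq U"
  proof (rule incseq_SucI, rule subsetI)
    fix j \<omega> assume "\<omega> \<in> U j"
    then obtain i where "\<omega> \<in> space M" "i \<le> T * 2 ^ j" "a \<le> \<bar>B (real i / 2 ^ j) \<omega>\<bar>"
      by (auto simp: U_def)
    then show "\<omega> \<in> U (Suc j)"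
      by (auto simp: U_def intro!: exI[of _ "2 * i"])
  qed
  have UM: "(\<Union>j. U j) \<in> events" using meas by auto
  have "(\<lambda>j. prob (U j)) \<longlonglongrightarrow> prob (\<Union>j. U j)"
    using meas inc by (intro finite_Lim_measure_incseq) auto
  then have UP: "prob (\<Union>j. U j) \<le> T / a\<^sup>2"
    by (rule LIMSEQ_le_const2) (use bound in blast)
  have "\<omega> \<in> (\<Union>j. U j)"
    if \<omega>: "\<omega> \<in> space M" and cont: "continuous_on {0..} (\<lambda>t. B t \<omega>)" and t: "0 \<le> t" "t \<le> T"
      and big: "a < \<bar>B t \<omega>\<bar>" for \<omega> and t :: real
  proof -
    let ?s = "\<lambda>j. of_int \<lfloor>t * 2 ^ j\<rfloor> / 2 ^ j :: real"
    have s0: "0 \<le> ?s j" for j using t by simp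
    have "(\<lambda>j. \<bar>B (?s j) \<omega>\<bar>) \<longlonglongrightarrow> \<bar>B t \<omega>\<bar>"
      by (intro tendsto_rabs continuous_on_tendsto_compose[OF cont dyadic_floor_tendsto])
        (use t s0 in auto)
    then have "\<forall>\<^sub>F j in sequentially. a < \<bar>B (?s j) \<omega>\<bar>"
      using big by (rule order_tendstoD)
    then obtain j where j: "a < \<bar>B (?s j) \<omega>\<bar>"
      by (auto simp: eventually_sequentially)
    define i where "i = nat \<lfloor>t * 2 ^ j\<rfloor>"
    have i: "real i = of_int \<lfloor>t * 2 ^ j\<rfloor>" using t by (simp add: i_def)
    have "real i \<le> t * 2 ^ j" unfolding i by simp
    also have "\<dots> \<le> real (T * 2 ^ j)" using t by (simp add: mult_right_mono)
    finally have "i \<le> T * 2 ^ j" by linarith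
    then show ?thesis using j \<omega> i unfolding U_def
      by (intro UN_I[of j]) (auto intro!: exI[of _ i])
  qed
  then show ?thesis
    by (intro bexI[OF _ UM] conjI UP allI impI)
qed

text \<open>Borel-Cantelli for the events that a path exceeds \<open>2 ^ N\<close> during \<open>[0, 2 ^ N]\<close>, whose
  probabilities are at most \<open>2 ^ N / (2 ^ N)\<^sup>2\<close>.\<close>

lemma linear_growth:
  "AE \<omega> in M. \<exists>C. \<forall>t\<ge>0. \<bar>B t \<omega>\<bar> \<le> C * (1 + t)"
proof -
  define Q where "Q N \<omega> t \<longleftrightarrow> \<omega> \<in> space M \<and> continuous_on {0..} (\<lambda>t. B t \<omega>) \<and>
      0 \<le> t \<and> t \<le> 2 ^ N \<and> 2 ^ N < \<bar>B t \<omega>\<bar>" for N :: nat and \<omega> and t :: real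
  have "\<exists>U. U \<in> events \<and> prob U \<le> 1 / 2 ^ N \<and> (\<forall>\<omega> t. Q N \<omega> t \<longrightarrow> \<omega> \<in> U)" for N
  proof -
    have "(2::real) ^ N / (2 ^ N)\<^sup>2 = 1 / 2 ^ N"
      by (simp add: power2_eq_square)
    then show ?thesis
      using maximal_inequality[of "2 ^ N" "2 ^ N"] by (auto simp: Q_def)
  qed
  then obtain U where U: "\<And>N. U N \<in> events" "\<And>N. prob (U N) \<le> 1 / 2 ^ N"
    "\<And>N \<omega> t. Q N \<omega> t \<Longrightarrow> \<omega> \<in> U N"
    by metis
  have "summable (\<lambda>N. prob (U N))"
    by (rule summable_comparison_test'[OF summable_geometric[of "1/2::real"], of 0])
      (use U(2) in \<open>auto simp: power_one_over\<close>)
  then have "AE \<omega> in M. \<forall>\<^sub>F N in sequentially. \<omega> \<in> space M - U N"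
    using U(1) by (intro borel_cantelli_AE1) (auto simp: emeasure_eq_measure)
  moreover have "AE \<omega> in M. continuous_on {0..} (\<lambda>t. B t \<omega>)"
    using brownian by (auto simp: standard_brownian_motion_def)
  ultimately show ?thesis
  proof (eventually_elim)
    fix \<omega> assume ev: "\<forall>\<^sub>F N in sequentially. \<omega> \<in> space M - U N"
      and cont: "continuous_on {0..} (\<lambda>t. B t \<omega>)"
    then obtain N0 where N0: "\<And>N. N \<ge> N0 \<Longrightarrow> \<omega> \<in> space M - U N"
      by (auto simp: eventually_sequentially)
    have sup: "\<bar>B t \<omega>\<bar> \<le> 2 ^ N" if "N0 \<le> N" "0 \<le> t" "t \<le> 2 ^ N" for N t
      using U(3)[of N \<omega> t] cont N0[OF that(1)] that by (force simp: Q_def)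
    have "\<bar>B t \<omega>\<bar> \<le> 2 ^ Suc N0 * (1 + t)" if t: "0 \<le> t" for t
    proof (cases "t \<le> 2 ^ N0")
      case True
      have "\<bar>B t \<omega>\<bar> \<le> 2 ^ N0 * 1" using sup[of N0 t] True t by simp
      also have "\<dots> \<le> 2 ^ Suc N0 * (1 + t)" using t by (intro mult_mono) auto
      finally show ?thesis .
    next
      case False
      obtain N where "t \<le> 2 ^ N"
        using real_arch_pow[of 2 t] by (auto intro: less_imp_le)
      define L where "L = (LEAST N. t \<le> 2 ^ N)"
      have L: "t \<le> 2 ^ L" unfolding L_def using \<open>t \<le> 2 ^ N\<close> by (rule LeastI)
      have "N0 < L"
        using False L power_increasing[of L N0 "2::real"] by (meson le_less_trans not_le order_trans one_le_numeral)
      then obtain L' where L': "L = Suc L'" by (cases L) auto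
      have "\<not> t \<le> 2 ^ L'" using not_less_Least[of L' "\<lambda>N. t \<le> 2 ^ N"] L' by (simp add: L_def[symmetric])
      then have "\<bar>B t \<omega>\<bar> \<le> 2 * t" using sup[of L t] L \<open>N0 < L\<close> t L' by simp
      also have "\<dots> \<le> 2 ^ Suc N0 * (1 + t)" using t by (intro mult_mono) auto
      finally show ?thesis .
    qed
    then show "\<exists>C. \<forall>t\<ge>0. \<bar>B t \<omega>\<bar> \<le> C * (1 + t)" by blast
  qed
qed

definition regular_paths :: "'a set" where
  "regular_paths = (SOME G. G \<in> events \<and> (AE \<omega> in M. \<omega> \<in> G) \<and>
     (\<forall>\<omega>\<in>G. continuous_on {0..} (\<lambda>t. B t \<omega>) \<and> (\<exists>C. \<forall>t\<ge>0. \<bar>B t \<omega>\<bar> \<le> C * (1 + t))))"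

text \<open>Setting the exceptional paths to zero and freezing time before \<open>0\<close> makes every path continuous
  on the whole line and of linear growth, so that \<open>W\<close> is jointly measurable and can be integrated
  over time without exceptional sets. The price is that \<open>W u\<close> is measurable for \<open>M\<close> only; expectations
  against the filtration are computed for \<open>B\<close>, which agrees with \<open>W\<close> almost surely.\<close>

definition W :: "real \<Rightarrow> 'a \<Rightarrow> real" where
  "W u \<omega> = (if \<omega> \<in> regular_paths then B (max 0 u) \<omega> else 0)"

lemma regular_paths:
  shows regular_paths_event [measurable]: "regular_paths \<in> events"
    and regular_paths_AE: "AE \<omega> in M. \<omega> \<in> regular_paths"
    and regular_paths_continuous: "\<omega> \<in> regular_paths \<Longrightarrow> continuous_on {0..} (\<lambda>t. B t \<omega>)"
    and regular_paths_growth: "\<omega> \<in> regular_paths \<Longrightarrow> \<exists>C. \<forall>t\<ge>0. \<bar>B t \<omega>\<bar> \<le> C * (1 + t)"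
proof -
  let ?P = "\<lambda>\<omega>. continuous_on {0..} (\<lambda>t. B t \<omega>) \<and> (\<exists>C. \<forall>t\<ge>0. \<bar>B t \<omega>\<bar> \<le> C * (1 + t))"
  have "AE \<omega> in M. continuous_on {0..} (\<lambda>t. B t \<omega>)"
    using brownian by (auto simp: standard_brownian_motion_def)
  with linear_growth have "AE \<omega> in M. ?P \<omega>" by eventually_elim simp
  then obtain N where N: "{\<omega>\<in>space M. \<not> ?P \<omega>} \<subseteq> N" "N \<in> null_sets M"
    unfolding eventually_ae_filter by blast
  have "\<exists>G. G \<in> events \<and> (AE \<omega> in M. \<omega> \<in> G) \<and> (\<forall>\<omega>\<in>G. ?P \<omega>)"
  proof (rule exI[of _ "space M - N"], intro conjI)
    show "AE \<omega> in M. \<omega> \<in> space M - N"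
      using AE_not_in[OF N(2)] AE_space by eventually_elim simp
    show "\<forall>\<omega>\<in>space M - N. ?P \<omega>" using N(1) by blast
  qed (use N(2) in auto)
  from someI_ex[OF this, folded regular_paths_def]
  have *: "regular_paths \<in> events \<and> (AE \<omega> in M. \<omega> \<in> regular_paths) \<and> (\<forall>\<omega>\<in>regular_paths. ?P \<omega>)" .
  show "regular_paths \<in> events" "AE \<omega> in M. \<omega> \<in> regular_paths" using * by auto
  show "continuous_on {0..} (\<lambda>t. B t \<omega>)" if "\<omega> \<in> regular_paths" using * that by blast
  show "\<exists>C. \<forall>t\<ge>0. \<bar>B t \<omega>\<bar> \<le> C * (1 + t)" if "\<omega> \<in> regular_paths" using * that by blast
qed

lemma W_AE_eq: "AE \<omega> in M. \<forall>u\<ge>0. W u \<omega> = B u \<omega>"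
  using regular_paths_AE by eventually_elim (simp add: W_def)

lemma W_AE_eq_at: "0 \<le> u \<Longrightarrow> AE \<omega> in M. W u \<omega> = B u \<omega>"
  using W_AE_eq by eventually_elim simp

lemma W_continuous: "continuous_on A (\<lambda>u. W u \<omega>)"
proof (cases "\<omega> \<in> regular_paths")
  case True
  have "continuous_on A (\<lambda>u. B (max 0 u) \<omega>)"
    by (rule continuous_on_compose2[OF regular_paths_continuous[OF True]]) (auto intro!: continuous_intros)
  then show ?thesis using True by (simp add: W_def)
qed (simp add: W_def)

lemma W_growth: obtains C where "0 \<le> C" "\<And>u. \<bar>W u \<omega>\<bar> \<le> C * (1 + \<bar>u\<bar>)"
proof (cases "\<omega> \<in> regular_paths")
  case True
  then obtain C where C: "\<And>t. 0 \<le> t \<Longrightarrow> \<bar>B t \<omega>\<bar> \<le> C * (1 + t)" using regular_paths_growth by blast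
  from C[of 0] have "0 \<le> C" by simp
  moreover have "\<bar>W u \<omega>\<bar> \<le> C * (1 + \<bar>u\<bar>)" for u
  proof -
    have "\<bar>W u \<omega>\<bar> \<le> C * (1 + max 0 u)" using C[of "max 0 u"] True by (simp add: W_def)
    also have "\<dots> \<le> C * (1 + \<bar>u\<bar>)" using \<open>0 \<le> C\<close> by (intro mult_left_mono) auto
    finally show ?thesis .
  qed
  ultimately show ?thesis using that by blast
next
  case False
  then show ?thesis using that[of 0] by (simp add: W_def)
qed

lemma W_measurable [measurable]: "W u \<in> borel_measurable M"
proof -
  have [measurable]: "B (max 0 u) \<in> borel_measurable M" by simp
  show ?thesis unfolding W_def[abs_def] by measurable
qed

lemma W_jointly_measurable [measurable]:
  "(\<lambda>(\<omega>, u). W u \<omega>) \<in> borel_measurable (M \<Otimes>\<^sub>M lborel)"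
proof -
  have "(\<lambda>x. W (snd x) (fst x)) \<in> borel_measurable (M \<Otimes>\<^sub>M lborel)"
  proof (rule borel_measurable_LIMSEQ_metric)
    fix j :: nat
    show "(\<lambda>x. W (of_int \<lfloor>snd x * (2::real) ^ j\<rfloor> / 2 ^ j) (fst x)) \<in> borel_measurable (M \<Otimes>\<^sub>M lborel)"
      by (rule measurable_compose_countable[where f="\<lambda>i x. W (of_int i / 2 ^ j) (fst x)"
            and g="\<lambda>x. \<lfloor>snd x * (2::real) ^ j\<rfloor>"]) measurable
  next
    fix x :: "'a \<times> real"
    show "(\<lambda>j. W (of_int \<lfloor>snd x * 2 ^ j\<rfloor> / 2 ^ j) (fst x)) \<longlonglongrightarrow> W (snd x) (fst x)"
      using W_continuous[of UNIV "fst x"]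
      by (rule continuous_on_tendsto_compose[OF _ dyadic_floor_tendsto]) auto
  qed
  then show ?thesis by (simp add: case_prod_beta')
qed

end

section \<open>Integrals of a Brownian path against a deterministic kernel\<close>

text \<open>The discriminant of the nonnegative quadratic \<open>l \<mapsto> \<integral> \<bar>h\<bar> (\<bar>f\<bar> - l)\<^sup>2\<close>.\<close>

lemma cauchy_schwarz_weighted:
  fixes h f :: "'b \<Rightarrow> real"
  assumes h: "integrable N h" and hf: "integrable N (\<lambda>u. h u * f u)"
    and hf2: "integrable N (\<lambda>u. h u * (f u)\<^sup>2)"
  shows "(LINT u|N. h u * f u)\<^sup>2 \<le> (LINT u|N. \<bar>h u\<bar>) * (LINT u|N. \<bar>h u\<bar> * (f u)\<^sup>2)"
proof -
  have a: "integrable N (\<lambda>u. \<bar>h u\<bar>)" using h by simp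
  have b: "integrable N (\<lambda>u. \<bar>h u\<bar> * \<bar>f u\<bar>)" using integrable_abs[OF hf] by (simp add: abs_mult)
  have c: "integrable N (\<lambda>u. \<bar>h u\<bar> * (f u)\<^sup>2)" using integrable_abs[OF hf2] by (simp add: abs_mult)
  define H I J where "H = (LINT u|N. \<bar>h u\<bar>)" and "I = (LINT u|N. \<bar>h u\<bar> * \<bar>f u\<bar>)"
    and "J = (LINT u|N. \<bar>h u\<bar> * (f u)\<^sup>2)"
  have quad: "0 \<le> J - 2 * l * I + l\<^sup>2 * H" for l
  proof -
    have "0 \<le> (LINT u|N. \<bar>h u\<bar> * (\<bar>f u\<bar> - l)\<^sup>2)" by (simp add: integral_nonneg_AE)
    also have "\<dots> = (LINT u|N. \<bar>h u\<bar> * (f u)\<^sup>2 - 2 * l * (\<bar>h u\<bar> * \<bar>f u\<bar>) + l\<^sup>2 * \<bar>h u\<bar>)"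
      by (intro Bochner_Integration.integral_cong) (auto simp: power2_diff algebra_simps)
    also have "\<dots> = J - 2 * l * I + l\<^sup>2 * H"
      using a b c by (simp add: H_def I_def J_def)
    finally show ?thesis .
  qed
  have H0: "0 \<le> H" and I0: "0 \<le> I" unfolding H_def I_def by (simp_all add: integral_nonneg_AE)
  have le: "\<bar>LINT u|N. h u * f u\<bar> \<le> I"
    using integral_abs_bound[of N "\<lambda>u. h u * f u"] by (simp add: I_def abs_mult)
  have "I\<^sup>2 \<le> H * J"
  proof (cases "H = 0")
    case True
    have "I = 0"
    proof (rule ccontr)
      assume "I \<noteq> 0"
      (* for H = 0 the quadratic is affine in l, and this l makes it equal to -1 *)
      with quad[of "(J + 1) / (2 * I)"] True show False by simp
    qed
    then show ?thesis using True by simp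
  next
    case False
    with H0 have "0 < H" by simp
    (* the minimum of the quadratic is attained at the weighted mean of f *)
    with quad[of "I / H"] show ?thesis
      by (simp add: power2_eq_square field_simps)
  qed
  then show ?thesis
    using power_mono[OF le, of 2] by (simp add: H_def J_def)
qed

context brownian_motion
begin

lemma W_jointly_measurable_swap [measurable]:
  "(\<lambda>(u, \<omega>). W u \<omega>) \<in> borel_measurable (lborel \<Otimes>\<^sub>M M)"
  using measurable_compose[OF measurable_pair_swap' W_jointly_measurable]
  by (simp add: case_prod_beta')

lemma Fubini_time:
  fixes f :: "real \<Rightarrow> 'a \<Rightarrow> real"
  assumes f: "(\<lambda>(u, \<omega>). f u \<omega>) \<in> borel_measurable (lborel \<Otimes>\<^sub>M M)"
    and fi: "\<And>u. integrable M (f u)"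
    and bound: "\<And>u. expectation (\<lambda>\<omega>. \<bar>f u \<omega>\<bar>) \<le> g u" and g: "integrable lborel g"
  shows "integrable M (\<lambda>\<omega>. LINT u|lborel. f u \<omega>)"
    and "expectation (\<lambda>\<omega>. LINT u|lborel. f u \<omega>) = (LINT u|lborel. expectation (f u))"
proof -
  interpret P: pair_sigma_finite lborel M ..
  have "integrable (lborel \<Otimes>\<^sub>M M) (case_prod f)"
  proof (rule P.Fubini_integrable)
    show "integrable lborel (\<lambda>x. LINT y|M. norm (case_prod f (x, y)))"
    proof (rule Bochner_Integration.integrable_bound[OF g])
      show "(\<lambda>x. LINT y|M. norm (case_prod f (x, y))) \<in> borel_measurable lborel"
        using f by (intro borel_measurable_lebesgue_integral) (simp add: case_prod_beta')
      show "AE x in lborel. norm (LINT y|M. norm (case_prod f (x, y))) \<le> norm (g x)"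
      proof (rule AE_I2)
        fix x
        have "0 \<le> expectation (\<lambda>\<omega>. \<bar>f x \<omega>\<bar>)" by (simp add: integral_nonneg_AE)
        then show "norm (LINT y|M. norm (case_prod f (x, y))) \<le> norm (g x)"
          using bound[of x] by simp
      qed
    qed
  qed (use f fi in \<open>auto simp: case_prod_beta'\<close>)
  from P.integrable_snd[OF this] P.Fubini_integral[OF this]
  show "integrable M (\<lambda>\<omega>. LINT u|lborel. f u \<omega>)"
    and "expectation (\<lambda>\<omega>. LINT u|lborel. f u \<omega>) = (LINT u|lborel. expectation (f u))"
    by simp_all
qed

lemma W_increment_moments:
  assumes r: "0 \<le> r"
  shows "integrable M (\<lambda>\<omega>. (W u \<omega> - W r \<omega>)\<^sup>2)"
    and "expectation (\<lambda>\<omega>. (W u \<omega> - W r \<omega>)\<^sup>2) \<le> \<bar>u - r\<bar>"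
proof -
  let ?u = "max 0 u"
  have [measurable]: "B ?u \<in> borel_measurable M" "B r \<in> borel_measurable M" using r by auto
  have ae: "AE \<omega> in M. (W u \<omega> - W r \<omega>)\<^sup>2 = (B ?u \<omega> - B r \<omega>)\<^sup>2"
    using regular_paths_AE by eventually_elim (use r in \<open>simp add: W_def\<close>)
  have "integrable M (\<lambda>\<omega>. (B ?u \<omega> - B r \<omega>)\<^sup>2) \<and>
      expectation (\<lambda>\<omega>. (B ?u \<omega> - B r \<omega>)\<^sup>2) = \<bar>?u - r\<bar>"
  proof (cases "r \<le> ?u")
    case True
    then show ?thesis using increment_moments(1)[OF r True, of 2] increment_moments(3)[OF r True] by simp
  next
    case False
    then have *: "?u \<le> r" "0 \<le> ?u" by auto
    show ?thesis using increment_moments(1)[OF *(2,1), of 2] increment_moments(3)[OF *(2,1)] False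
      by (simp add: power2_commute)
  qed
  then show "integrable M (\<lambda>\<omega>. (W u \<omega> - W r \<omega>)\<^sup>2)"
    and "expectation (\<lambda>\<omega>. (W u \<omega> - W r \<omega>)\<^sup>2) \<le> \<bar>u - r\<bar>"
    using integrable_cong_AE[OF _ _ ae] integral_cong_AE[OF _ _ ae] r by auto
qed

lemma W_moments:
  shows "integrable M (\<lambda>\<omega>. (W u \<omega>)\<^sup>2)" and "expectation (\<lambda>\<omega>. (W u \<omega>)\<^sup>2) \<le> \<bar>u\<bar>"
proof -
  have "AE \<omega> in M. B 0 \<omega> = 0"
    using brownian by (auto simp: standard_brownian_motion_def)
  with W_AE_eq_at[of 0] have ae: "AE \<omega> in M. (W u \<omega>)\<^sup>2 = (W u \<omega> - W 0 \<omega>)\<^sup>2"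
    by (auto elim: eventually_elim2)
  show "integrable M (\<lambda>\<omega>. (W u \<omega>)\<^sup>2)" "expectation (\<lambda>\<omega>. (W u \<omega>)\<^sup>2) \<le> \<bar>u\<bar>"
    using integrable_cong_AE[OF _ _ ae] integral_cong_AE[OF _ _ ae] W_increment_moments[of 0 u] by auto
qed

end

text \<open>The quadratic weight makes a kernel integrable not only against paths of linear growth
  but also against their squares.\<close>

definition kernel :: "(real \<Rightarrow> real) \<Rightarrow> bool" where
  "kernel h \<longleftrightarrow> integrable lborel (\<lambda>u. h u * (1 + \<bar>u\<bar>)\<^sup>2)"

lemma kernel_dominated:
  assumes h: "kernel h" and f: "f \<in> borel_measurable borel" and C: "\<And>u. \<bar>f u\<bar> \<le> C * (1 + \<bar>u\<bar>)\<^sup>2"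
  shows "integrable lborel (\<lambda>u. h u * f u :: real)"
proof (rule Bochner_Integration.integrable_bound)
  have hi: "integrable lborel (\<lambda>u. h u * (1 + \<bar>u\<bar>)\<^sup>2)" using h by (simp add: kernel_def)
  then show "integrable lborel (\<lambda>u. C * (h u * (1 + \<bar>u\<bar>)\<^sup>2))" by simp
  have "(\<lambda>u. (h u * (1 + \<bar>u\<bar>)\<^sup>2) * inverse ((1 + \<bar>u\<bar>)\<^sup>2)) \<in> borel_measurable lborel"
    using borel_measurable_integrable[OF hi] by measurable
  moreover have "(h u * (1 + \<bar>u\<bar>)\<^sup>2) * inverse ((1 + \<bar>u\<bar>)\<^sup>2) = h u" for u
    by (simp add: field_simps add_nonneg_eq_0_iff)
  ultimately have "h \<in> borel_measurable lborel" by simp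
  then show "(\<lambda>u. h u * f u) \<in> borel_measurable lborel" using f by measurable
  show "AE u in lborel. norm (h u * f u) \<le> norm (C * (h u * (1 + \<bar>u\<bar>)\<^sup>2))"
  proof (rule AE_I2)
    fix u
    have "\<bar>f 0\<bar> \<le> C" using C[of 0] by simp
    then have C0: "0 \<le> C" by linarith
    have "\<bar>h u\<bar> * \<bar>f u\<bar> \<le> \<bar>h u\<bar> * (C * (1 + \<bar>u\<bar>)\<^sup>2)" using C[of u] by (rule mult_left_mono) simp
    also have "\<dots> = \<bar>C * (h u * (1 + \<bar>u\<bar>)\<^sup>2)\<bar>"
      using C0 by (simp add: abs_mult)
    finally show "norm (h u * f u) \<le> norm (C * (h u * (1 + \<bar>u\<bar>)\<^sup>2))" by (simp add: abs_mult)
  qed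
qed

lemma one_le_square_weight: "1 \<le> (1 + \<bar>u\<bar>)\<^sup>2" "\<bar>u\<bar> \<le> (1 + \<bar>u\<bar>)\<^sup>2" for u :: real
  by (simp_all add: power2_eq_square algebra_simps)

lemma kernel_integrable: "kernel h \<Longrightarrow> integrable lborel h"
  using kernel_dominated[of h "\<lambda>_. 1" 1] one_le_square_weight by simp

lemma kernel_measurable: "kernel h \<Longrightarrow> h \<in> borel_measurable borel"
  using borel_measurable_integrable[OF kernel_integrable] by simp

lemma kernel_abs: "kernel h \<Longrightarrow> kernel (\<lambda>u. \<bar>h u\<bar>)"
  using integrable_abs[of lborel "\<lambda>u. h u * (1 + \<bar>u\<bar>)\<^sup>2"] by (simp add: kernel_def abs_mult)

context brownian_motion
begin

lemma kernel_W:
  assumes h: "kernel h"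
  shows "integrable lborel (\<lambda>u. h u * W u \<omega>)"
    and "integrable lborel (\<lambda>u. h u * (W u \<omega> - c))"
    and "integrable lborel (\<lambda>u. h u * (W u \<omega> - c)\<^sup>2)"
    and "(\<lambda>\<omega>. LINT u|lborel. h u * W u \<omega>) \<in> borel_measurable M"
proof -
  obtain C where C: "0 \<le> C" "\<And>u. \<bar>W u \<omega>\<bar> \<le> C * (1 + \<bar>u\<bar>)" using W_growth by blast
  have [measurable]: "(\<lambda>u. W u \<omega>) \<in> borel_measurable borel"
    using W_continuous by (intro borel_measurable_continuous_onI)
  have [measurable]: "h \<in> borel_measurable borel" using kernel_measurable[OF h] .
  have lin: "\<bar>W u \<omega> - c\<bar> \<le> (C + \<bar>c\<bar>) * (1 + \<bar>u\<bar>)" for u c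
  proof -
    have "\<bar>W u \<omega> - c\<bar> \<le> C * (1 + \<bar>u\<bar>) + \<bar>c\<bar> * 1" using C(2)[of u] by simp
    also have "\<dots> \<le> C * (1 + \<bar>u\<bar>) + \<bar>c\<bar> * (1 + \<bar>u\<bar>)"
      using C(1) by (intro add_mono mult_left_mono) auto
    finally show ?thesis by (simp add: algebra_simps)
  qed
  have sq: "(1 + \<bar>u\<bar>) \<le> (1 + \<bar>u\<bar>)\<^sup>2" for u :: real by (simp add: power2_eq_square algebra_simps)
  have b: "\<bar>W u \<omega> - c\<bar> \<le> (C + \<bar>c\<bar>) * (1 + \<bar>u\<bar>)\<^sup>2" for u c
    using order_trans[OF lin mult_left_mono[OF sq]] C(1) by simp
  show i: "integrable lborel (\<lambda>u. h u * (W u \<omega> - c))" for c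
    by (rule kernel_dominated[OF h _ b]) measurable
  from i[of 0] show "integrable lborel (\<lambda>u. h u * W u \<omega>)" by simp
  show "integrable lborel (\<lambda>u. h u * (W u \<omega> - c)\<^sup>2)"
  proof (rule kernel_dominated[OF h])
    show "\<bar>(W u \<omega> - c)\<^sup>2\<bar> \<le> (C + \<bar>c\<bar>)\<^sup>2 * (1 + \<bar>u\<bar>)\<^sup>2" for u
      using power_mono[OF lin[of u c], of 2] by (simp add: power_mult_distrib)
  qed measurable
  show "(\<lambda>\<omega>. LINT u|lborel. h u * W u \<omega>) \<in> borel_measurable M"
    by measurable
qed

text \<open>Cauchy-Schwarz under the time integral; the reference time \<open>r\<close> can be placed where the kernel
  is concentrated, which keeps the bound small.\<close>

lemma kernel_W_second_moment:
  assumes h: "kernel h" and r: "0 \<le> r"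
  shows "integrable M (\<lambda>\<omega>. (LINT u|lborel. h u * (W u \<omega> - W r \<omega>))\<^sup>2)"
    and "expectation (\<lambda>\<omega>. (LINT u|lborel. h u * (W u \<omega> - W r \<omega>))\<^sup>2)
      \<le> (LINT u|lborel. \<bar>h u\<bar>) * (LINT u|lborel. \<bar>h u\<bar> * \<bar>u - r\<bar>)"
proof -
  have [measurable]: "h \<in> borel_measurable borel" using kernel_measurable[OF h] .
  let ?f = "\<lambda>u \<omega>. \<bar>h u\<bar> * (W u \<omega> - W r \<omega>)\<^sup>2"
  let ?H = "LINT u|lborel. \<bar>h u\<bar>"
  have gi: "integrable lborel (\<lambda>u. \<bar>h u\<bar> * \<bar>u - r\<bar>)"
  proof (rule kernel_dominated[OF kernel_abs[OF h], of _ "1 + \<bar>r\<bar>"])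
    fix u :: real
    have "\<bar>u - r\<bar> \<le> (1 + \<bar>u\<bar>)\<^sup>2 + \<bar>r\<bar> * 1" using one_le_square_weight(2)[of u] by linarith
    also have "\<dots> \<le> (1 + \<bar>u\<bar>)\<^sup>2 + \<bar>r\<bar> * (1 + \<bar>u\<bar>)\<^sup>2"
      using one_le_square_weight(1)[of u] by (intro add_left_mono mult_left_mono) auto
    finally show "\<bar>\<bar>u - r\<bar>\<bar> \<le> (1 + \<bar>r\<bar>) * (1 + \<bar>u\<bar>)\<^sup>2" by (simp add: algebra_simps)
  qed measurable
  have fi: "integrable M (?f u)" for u using W_increment_moments(1)[OF r] by simp
  have "expectation (\<lambda>\<omega>. \<bar>?f u \<omega>\<bar>) \<le> \<bar>h u\<bar> * \<bar>u - r\<bar>" for u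
    using W_increment_moments(2)[OF r, of u] by (simp add: abs_mult mult_left_mono)
  note F = Fubini_time[of ?f, OF _ fi this gi]
  have I: "integrable M (\<lambda>\<omega>. ?H * (LINT u|lborel. ?f u \<omega>))"
    and E: "expectation (\<lambda>\<omega>. LINT u|lborel. ?f u \<omega>) = (LINT u|lborel. expectation (?f u))"
    using F by (auto intro!: integrable_mult_right)
  have cs: "(LINT u|lborel. h u * (W u \<omega> - W r \<omega>))\<^sup>2 \<le> ?H * (LINT u|lborel. ?f u \<omega>)" for \<omega>
    by (rule cauchy_schwarz_weighted[OF kernel_integrable[OF h] kernel_W(2,3)[OF h]])
  show int: "integrable M (\<lambda>\<omega>. (LINT u|lborel. h u * (W u \<omega> - W r \<omega>))\<^sup>2)"
  proof (rule Bochner_Integration.integrable_bound[OF I])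
    show "AE \<omega> in M. norm ((LINT u|lborel. h u * (W u \<omega> - W r \<omega>))\<^sup>2) \<le> norm (?H * (LINT u|lborel. ?f u \<omega>))"
      using order_trans[OF cs abs_ge_self] by simp
  qed measurable
  have "expectation (\<lambda>\<omega>. (LINT u|lborel. h u * (W u \<omega> - W r \<omega>))\<^sup>2)
      \<le> expectation (\<lambda>\<omega>. ?H * (LINT u|lborel. ?f u \<omega>))"
    by (rule integral_mono[OF int I cs])
  also have "\<dots> = ?H * (LINT u|lborel. expectation (?f u))" using E by simp
  also have "\<dots> \<le> ?H * (LINT u|lborel. \<bar>h u\<bar> * \<bar>u - r\<bar>)"
  proof (intro mult_left_mono integral_mono)
    show "integrable lborel (\<lambda>u. expectation (?f u))"
    proof (rule Bochner_Integration.integrable_bound[OF gi])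
      show "AE u in lborel. norm (expectation (?f u)) \<le> norm (\<bar>h u\<bar> * \<bar>u - r\<bar>)"
        using W_increment_moments(2)[OF r] by (simp add: abs_mult mult_left_mono integral_nonneg_AE)
    qed measurable
    show "expectation (?f u) \<le> \<bar>h u\<bar> * \<bar>u - r\<bar>" for u
      using W_increment_moments(2)[OF r, of u] by (simp add: mult_left_mono)
  qed (use gi in \<open>simp_all add: integral_nonneg_AE\<close>)
  finally show "expectation (\<lambda>\<omega>. (LINT u|lborel. h u * (W u \<omega> - W r \<omega>))\<^sup>2)
      \<le> ?H * (LINT u|lborel. \<bar>h u\<bar> * \<bar>u - r\<bar>)" .
qed

lemma expectation_kernel_W:
  assumes h: "kernel h" and Q [measurable]: "Q \<in> borel_measurable M"
    and Q2: "integrable M (\<lambda>\<omega>. (Q \<omega>)\<^sup>2)"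
  shows "integrable M (\<lambda>\<omega>. Q \<omega> * (LINT u|lborel. h u * W u \<omega>))"
    and "expectation (\<lambda>\<omega>. Q \<omega> * (LINT u|lborel. h u * W u \<omega>))
      = (LINT u|lborel. h u * expectation (\<lambda>\<omega>. Q \<omega> * W u \<omega>))"
proof -
  have [measurable]: "h \<in> borel_measurable borel" using kernel_measurable[OF h] .
  let ?f = "\<lambda>u \<omega>. h u * (Q \<omega> * W u \<omega>)"
  let ?q = "expectation (\<lambda>\<omega>. (Q \<omega>)\<^sup>2)"
  have q0: "0 \<le> ?q" by (simp add: integral_nonneg_AE)
  have i: "integrable M (\<lambda>\<omega>. Q \<omega> * W u \<omega>)" for u
    by (rule integrable_mult_of_squares[OF Q W_measurable Q2 W_moments(1)])
  have g: "integrable lborel (\<lambda>u. \<bar>h u\<bar> * (?q + \<bar>u\<bar>))"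
  proof (rule kernel_dominated[OF kernel_abs[OF h], of _ "?q + 1"])
    fix u :: real
    have "?q * 1 + \<bar>u\<bar> \<le> ?q * (1 + \<bar>u\<bar>)\<^sup>2 + (1 + \<bar>u\<bar>)\<^sup>2"
      using one_le_square_weight[of u] q0 by (intro add_mono mult_left_mono) auto
    then show "\<bar>?q + \<bar>u\<bar>\<bar> \<le> (?q + 1) * (1 + \<bar>u\<bar>)\<^sup>2" using q0 by (simp add: algebra_simps)
  qed measurable
  have b: "expectation (\<lambda>\<omega>. \<bar>?f u \<omega>\<bar>) \<le> \<bar>h u\<bar> * (?q + \<bar>u\<bar>)" for u
  proof -
    have "expectation (\<lambda>\<omega>. \<bar>Q \<omega> * W u \<omega>\<bar>) \<le> expectation (\<lambda>\<omega>. (Q \<omega>)\<^sup>2 + (W u \<omega>)\<^sup>2)"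
    proof (rule integral_mono)
      show "\<bar>Q \<omega> * W u \<omega>\<bar> \<le> (Q \<omega>)\<^sup>2 + (W u \<omega>)\<^sup>2" for \<omega>
      proof -
        have "0 \<le> (\<bar>Q \<omega>\<bar> - \<bar>W u \<omega>\<bar>)\<^sup>2" by simp
        then have "2 * (\<bar>Q \<omega>\<bar> * \<bar>W u \<omega>\<bar>) \<le> (Q \<omega>)\<^sup>2 + (W u \<omega>)\<^sup>2"
          by (simp add: power2_diff)
        moreover have "0 \<le> \<bar>Q \<omega>\<bar> * \<bar>W u \<omega>\<bar>" by simp
        ultimately show ?thesis unfolding abs_mult by linarith
      qed
    qed (use i Q2 W_moments in auto)
    also have "\<dots> \<le> ?q + \<bar>u\<bar>" using Q2 W_moments by simp
    finally show ?thesis by (simp add: abs_mult mult_left_mono)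
  qed
  have fi: "integrable M (?f u)" for u using i by simp
  note F = Fubini_time[of ?f, OF _ fi b g]
  have eq: "(LINT u|lborel. ?f u \<omega>) = Q \<omega> * (LINT u|lborel. h u * W u \<omega>)" for \<omega>
    by (simp add: mult.left_commute)
  show "integrable M (\<lambda>\<omega>. Q \<omega> * (LINT u|lborel. h u * W u \<omega>))"
    using F(1) unfolding eq by measurable
  show "expectation (\<lambda>\<omega>. Q \<omega> * (LINT u|lborel. h u * W u \<omega>))
      = (LINT u|lborel. h u * expectation (\<lambda>\<omega>. Q \<omega> * W u \<omega>))"
    using F(2) unfolding eq by simp
qed

lemma bounded_past_increment_square_integrable:
  assumes p: "0 \<le> p" "p \<le> q"
    and \<eta>: "\<eta> \<in> borel_measurable (F p)" "\<And>\<omega>. \<omega> \<in> space M \<Longrightarrow> \<bar>\<eta> \<omega>\<bar> \<le> C"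
  shows "integrable M (\<lambda>\<omega>. (\<eta> \<omega> * (B q \<omega> - B p \<omega>))\<^sup>2)"
  unfolding power_mult_distrib
proof (rule bounded_times_integrable)
  show "\<bar>(\<eta> \<omega>)\<^sup>2\<bar> \<le> C\<^sup>2" if "\<omega> \<in> space M" for \<omega>
    using power_mono[OF \<eta>(2)[OF that], of 2] by simp
  show "integrable M (\<lambda>\<omega>. (B q \<omega> - B p \<omega>)\<^sup>2)" using increment_moments(1)[OF p] .
qed (use measurable_F_M[OF \<eta>(1)] in measurable)

lemma bounded_past_covariance_W:
  assumes p: "0 \<le> p" "p \<le> q" and u: "0 \<le> u"
    and \<eta>: "\<eta> \<in> borel_measurable (F p)" "\<And>\<omega>. \<omega> \<in> space M \<Longrightarrow> \<bar>\<eta> \<omega>\<bar> \<le> C"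
  shows "integrable M (\<lambda>\<omega>. \<eta> \<omega> * (B q \<omega> - B p \<omega>) * W u \<omega>)"
    and "expectation (\<lambda>\<omega>. \<eta> \<omega> * (B q \<omega> - B p \<omega>) * W u \<omega>) = expectation \<eta> * (min q u - min p u)"
proof -
  have [measurable]: "\<eta> \<in> borel_measurable M" "B p \<in> borel_measurable M" "B q \<in> borel_measurable M"
      "B u \<in> borel_measurable M"
    using measurable_F_M[OF \<eta>(1)] p u by auto
  show "integrable M (\<lambda>\<omega>. \<eta> \<omega> * (B q \<omega> - B p \<omega>) * W u \<omega>)"
    by (rule integrable_mult_of_squares[OF _ W_measurable
          bounded_past_increment_square_integrable[OF p \<eta>] W_moments(1)]) measurable
  have "AE \<omega> in M. \<eta> \<omega> * (B q \<omega> - B p \<omega>) * W u \<omega> = \<eta> \<omega> * (B q \<omega> - B p \<omega>) * B u \<omega>"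
    using W_AE_eq_at[OF u] by eventually_elim simp
  then have "expectation (\<lambda>\<omega>. \<eta> \<omega> * (B q \<omega> - B p \<omega>) * W u \<omega>)
      = expectation (\<lambda>\<omega>. \<eta> \<omega> * (B q \<omega> - B p \<omega>) * B u \<omega>)"
    by (intro integral_cong_AE) measurable
  then show "expectation (\<lambda>\<omega>. \<eta> \<omega> * (B q \<omega> - B p \<omega>) * W u \<omega>) = expectation \<eta> * (min q u - min p u)"
    using bounded_past_covariance[OF p u \<eta>] by simp
qed

lemma bounded_past_kernel_covariance:
  assumes h: "kernel h" "\<And>u. u < 0 \<Longrightarrow> h u = 0" and p: "0 \<le> p" "p \<le> q"
    and \<eta>: "\<eta> \<in> borel_measurable (F p)" "\<And>\<omega>. \<omega> \<in> space M \<Longrightarrow> \<bar>\<eta> \<omega>\<bar> \<le> C"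
  shows "integrable M (\<lambda>\<omega>. \<eta> \<omega> * (B q \<omega> - B p \<omega>) * (LINT u|lborel. h u * W u \<omega>))"
    and "expectation (\<lambda>\<omega>. \<eta> \<omega> * (B q \<omega> - B p \<omega>) * (LINT u|lborel. h u * W u \<omega>))
      = expectation \<eta> * (LINT u|lborel. h u * (min q u - min p u))"
proof -
  have [measurable]: "\<eta> \<in> borel_measurable M" "B p \<in> borel_measurable M" "B q \<in> borel_measurable M"
    using measurable_F_M[OF \<eta>(1)] p by auto
  let ?Q = "\<lambda>\<omega>. \<eta> \<omega> * (B q \<omega> - B p \<omega>)"
  have Q: "?Q \<in> borel_measurable M" by measurable
  note E = expectation_kernel_W[OF h(1) Q bounded_past_increment_square_integrable[OF p \<eta>]]
  show "integrable M (\<lambda>\<omega>. ?Q \<omega> * (LINT u|lborel. h u * W u \<omega>))" by (rule E(1))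
  have eq: "h u * expectation (\<lambda>\<omega>. ?Q \<omega> * W u \<omega>) = expectation \<eta> * (h u * (min q u - min p u))" for u
    using h(2)[of u] bounded_past_covariance_W(2)[OF p _ \<eta>, of u] by (cases "u < 0") auto
  show "expectation (\<lambda>\<omega>. ?Q \<omega> * (LINT u|lborel. h u * W u \<omega>))
      = expectation \<eta> * (LINT u|lborel. h u * (min q u - min p u))"
    by (simp only: E(2) eq integral_mult_right_zero)
qed

text \<open>A kernel that vanishes before \<open>p\<close> sees only increments after \<open>p\<close>, which are centred given \<open>F p\<close>.\<close>

lemma bounded_past_kernel_mean:
  assumes h: "kernel h" "\<And>u. u < p \<Longrightarrow> h u = 0" and p: "0 \<le> p"
    and \<eta>: "\<eta> \<in> borel_measurable (F p)" "\<And>\<omega>. \<omega> \<in> space M \<Longrightarrow> \<bar>\<eta> \<omega>\<bar> \<le> C"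
  shows "expectation (\<lambda>\<omega>. \<eta> \<omega> * (LINT u|lborel. h u * (W u \<omega> - W p \<omega>))) = 0"
proof -
  have [measurable]: "\<eta> \<in> borel_measurable M" "B p \<in> borel_measurable M"
    using measurable_F_M[OF \<eta>(1)] p by auto
  have \<eta>2: "integrable M (\<lambda>\<omega>. (\<eta> \<omega>)\<^sup>2)"
  proof (rule integrable_const_bound[where B="C\<^sup>2"])
    show "AE \<omega> in M. norm ((\<eta> \<omega>)\<^sup>2) \<le> C\<^sup>2"
      using AE_space by eventually_elim (use power_mono[OF \<eta>(2), of _ 2] in simp)
  qed measurable
  have i: "integrable M (\<lambda>\<omega>. \<eta> \<omega> * W u \<omega>)" for u
    by (rule integrable_mult_of_squares[OF _ W_measurable \<eta>2 W_moments(1)]) measurable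
  have H: "integrable lborel h" using kernel_integrable[OF h(1)] .
  have zero: "h u * expectation (\<lambda>\<omega>. \<eta> \<omega> * W u \<omega>) = h u * expectation (\<lambda>\<omega>. \<eta> \<omega> * W p \<omega>)" for u
  proof (cases "u < p")
    case False
    then have u: "p \<le> u" "0 \<le> u" using p by auto
    then have [measurable]: "B u \<in> borel_measurable M" by simp
    have "AE \<omega> in M. \<eta> \<omega> * W u \<omega> - \<eta> \<omega> * W p \<omega> = \<eta> \<omega> * (B u \<omega> - B p \<omega>)"
      using W_AE_eq_at[OF u(2)] W_AE_eq_at[OF p] by eventually_elim (simp add: algebra_simps)
    then have "expectation (\<lambda>\<omega>. \<eta> \<omega> * W u \<omega> - \<eta> \<omega> * W p \<omega>) = expectation (\<lambda>\<omega>. \<eta> \<omega> * (B u \<omega> - B p \<omega>))"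
      by (intro integral_cong_AE) measurable
    also have "\<dots> = 0" using bounded_past_times_increment(2)[OF p u(1) \<eta>] .
    finally show ?thesis using i by simp
  qed (simp add: h(2))
  note E = expectation_kernel_W[OF h(1) _ \<eta>2]
  have "expectation (\<lambda>\<omega>. \<eta> \<omega> * (LINT u|lborel. h u * (W u \<omega> - W p \<omega>)))
      = expectation (\<lambda>\<omega>. \<eta> \<omega> * (LINT u|lborel. h u * W u \<omega>) - (LINT u|lborel. h u) * (\<eta> \<omega> * W p \<omega>))"
  proof (intro Bochner_Integration.integral_cong refl)
    fix \<omega>
    have "(LINT u|lborel. h u * (W u \<omega> - W p \<omega>)) = (LINT u|lborel. h u * W u \<omega>) - (LINT u|lborel. h u) * W p \<omega>"
      using kernel_W(1)[OF h(1)] H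
      by (simp only: right_diff_distrib Bochner_Integration.integral_diff integrable_mult_left integral_mult_left_zero)
    then show "\<eta> \<omega> * (LINT u|lborel. h u * (W u \<omega> - W p \<omega>))
      = \<eta> \<omega> * (LINT u|lborel. h u * W u \<omega>) - (LINT u|lborel. h u) * (\<eta> \<omega> * W p \<omega>)"
      by (simp only: right_diff_distrib mult.left_commute)
  qed
  also have "\<dots> = (LINT u|lborel. h u * expectation (\<lambda>\<omega>. \<eta> \<omega> * W u \<omega>))
      - (LINT u|lborel. h u) * expectation (\<lambda>\<omega>. \<eta> \<omega> * W p \<omega>)"
    using E i by simp
  also have "\<dots> = 0" unfolding zero by simp
  finally show ?thesis .
qed

end

section \<open>The Ito integral of a smooth deterministic function\<close>

lemma integral_FTC_finite_exceptions:
  fixes G g :: "real \<Rightarrow> real"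
  assumes "a \<le> b" "finite S" "continuous_on {a..b} G"
    and "\<And>x. x \<in> {a<..<b} - S \<Longrightarrow> (G has_real_derivative g x) (at x)"
    and "set_integrable lborel {a..b} g"
  shows "(LINT x:{a..b}|lborel. g x) = G b - G a"
proof -
  have "(g has_integral (G b - G a)) {a..b}"
  proof (rule fundamental_theorem_of_calculus_interior_strong)
    show "(G has_vector_derivative g x) (at x)" if "x \<in> {a<..<b} - S" for x
      using assms(4)[OF that] by (simp add: has_real_derivative_iff_has_vector_derivative)
  qed (use assms in auto)
  then show ?thesis
    using set_borel_integral_eq_integral(2)[OF assms(5)] integral_unique by metis
qed

lemma indefinite_integral:
  fixes g :: "real \<Rightarrow> real"
  assumes g: "continuous_on {c..} g"
  shows indefinite_integral_continuous: "continuous_on {c..t} (\<lambda>u. LINT s:{c..u}|lborel. g s)"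
    and indefinite_integral_deriv:
      "c < t \<Longrightarrow> ((\<lambda>u. LINT s:{c..u}|lborel. g s) has_real_derivative g t) (at t)"
proof -
  have cg: "continuous_on {c..u} g" for u using g by (rule continuous_on_subset) auto
  have "(LINT s:{c..u}|lborel. g s) = integral {c..u} g" for u
    by (intro set_borel_integral_eq_integral borel_integrable_atLeastAtMost' cg)
  then have eq: "(\<lambda>u. LINT s:{c..u}|lborel. g s) = (\<lambda>u. integral {c..u} g)" by auto
  show "continuous_on {c..t} (\<lambda>u. LINT s:{c..u}|lborel. g s)"
    unfolding eq by (intro indefinite_integral_continuous_1 integrable_continuous_real cg)
  show "((\<lambda>u. LINT s:{c..u}|lborel. g s) has_real_derivative g t) (at t)" if "c < t"
    using integral_has_real_derivative[OF cg, of t "t + 1"] that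
    unfolding eq by (simp add: at_within_Icc_at)
qed

lemma kernel_indicator:
  fixes g :: "real \<Rightarrow> real"
  assumes "continuous_on {a..b} g"
  shows "kernel (\<lambda>u. indicator {a..b} u * g u)"
  using borel_integrable_atLeastAtMost'[of a b "\<lambda>u. g u * (1 + \<bar>u\<bar>)\<^sup>2"] assms
  by (simp add: kernel_def set_integrable_def mult.assoc continuous_intros)

lemma square_sum_orthogonal:
  fixes f :: "nat \<Rightarrow> 'b \<Rightarrow> real"
  assumes "\<And>i j. i < n \<Longrightarrow> j < n \<Longrightarrow> integrable N (\<lambda>x. f i x * f j x)"
    and "\<And>i j. i < j \<Longrightarrow> j < n \<Longrightarrow> (LINT x|N. f i x * f j x) = 0"
  shows "integrable N (\<lambda>x. (\<Sum>i<n. f i x)\<^sup>2)"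
    and "(LINT x|N. (\<Sum>i<n. f i x)\<^sup>2) = (\<Sum>i<n. LINT x|N. (f i x)\<^sup>2)"
proof -
  have sq: "(\<Sum>i<n. f i x)\<^sup>2 = (\<Sum>i<n. \<Sum>j<n. f i x * f j x)" for x
    by (simp add: power2_eq_square sum_product)
  show "integrable N (\<lambda>x. (\<Sum>i<n. f i x)\<^sup>2)"
    unfolding sq by (intro Bochner_Integration.integrable_sum assms) auto
  have off: "(LINT x|N. f i x * f j x) = (if i = j then LINT x|N. (f i x)\<^sup>2 else 0)"
    if "i < n" "j < n" for i j
    using assms(2)[of i j] assms(2)[of j i] that
    by (cases i j rule: linorder_cases) (auto simp: mult.commute power2_eq_square)
  have "(LINT x|N. (\<Sum>i<n. f i x)\<^sup>2) = (\<Sum>i<n. \<Sum>j<n. LINT x|N. f i x * f j x)"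
    unfolding sq using assms(1)
    by (subst Bochner_Integration.integral_sum; auto intro!: sum.cong)
  also have "\<dots> = (\<Sum>i<n. \<Sum>j<n. if i = j then LINT x|N. (f i x)\<^sup>2 else 0)"
    by (intro sum.cong refl off) auto
  also have "\<dots> = (\<Sum>i<n. LINT x|N. (f i x)\<^sup>2)" by (simp add: sum.delta')
  finally show "(LINT x|N. (\<Sum>i<n. f i x)\<^sup>2) = (\<Sum>i<n. LINT x|N. (f i x)\<^sup>2)" .
qed

context brownian_motion
begin

text \<open>The integral \<open>\<integral> \<sigma> dB\<close> over \<open>[a, T]\<close> after integration by parts, for \<open>\<sigma>\<close> with derivative \<open>\<sigma>'\<close>. Unlike the
  Ito integral it is defined for each path separately.\<close>

definition wiener_integral :: "real \<Rightarrow> real \<Rightarrow> (real \<Rightarrow> real) \<Rightarrow> (real \<Rightarrow> real) \<Rightarrow> 'a \<Rightarrow> real" where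
  "wiener_integral a T \<sigma> \<sigma>' \<omega> =
     \<sigma> T * W T \<omega> - \<sigma> a * W a \<omega> - (LINT u|lborel. indicator {a..T} u * \<sigma>' u * W u \<omega>)"

text \<open>By the covariance formula for kernels the claim reduces to
  \<open>\<sigma> T (q - p) - \<integral> \<sigma>'(u) g(u) du = \<integral> \<sigma>(s) ds\<close>, the last integral over \<open>[p, q]\<close>, with \<open>g(u) = min q u - min p u\<close>.
  This is integration by parts, since \<open>g\<close> has derivative \<open>1\<close> on \<open>(p, q)\<close> and \<open>0\<close> elsewhere.\<close>

lemma wiener_integral_covariance:
  assumes a: "0 \<le> a" and \<sigma>: "\<And>x. (\<sigma> has_real_derivative \<sigma>' x) (at x)" and \<sigma>': "continuous_on UNIV \<sigma>'"
    and pq: "a \<le> p" "p \<le> q" "q \<le> T"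
    and \<eta>: "\<eta> \<in> borel_measurable (F p)" "\<And>\<omega>. \<omega> \<in> space M \<Longrightarrow> \<bar>\<eta> \<omega>\<bar> \<le> C"
  shows "integrable M (\<lambda>\<omega>. \<eta> \<omega> * (B q \<omega> - B p \<omega>) * wiener_integral a T \<sigma> \<sigma>' \<omega>)"
    and "expectation (\<lambda>\<omega>. \<eta> \<omega> * (B q \<omega> - B p \<omega>) * wiener_integral a T \<sigma> \<sigma>' \<omega>)
      = expectation \<eta> * (LINT s:{p..q}|lborel. \<sigma> s)"
proof -
  let ?Q = "\<lambda>\<omega>. \<eta> \<omega> * (B q \<omega> - B p \<omega>)"
  let ?h = "\<lambda>u. indicator {a..T} u * \<sigma>' u"
  let ?g = "\<lambda>u. min q u - min p u"
  have p: "0 \<le> p" "p \<le> q" "0 \<le> T" using a pq by auto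
  have c\<sigma>: "continuous_on A \<sigma>" for A
    using \<sigma> by (meson DERIV_isCont continuous_at_imp_continuous_on)
  have c\<sigma>': "continuous_on A \<sigma>'" for A using \<sigma>' continuous_on_subset by blast
  have h: "kernel ?h" by (rule kernel_indicator[OF c\<sigma>'])
  note Z = bounded_past_kernel_covariance[OF h _ p(1,2) \<eta>]
  note XT = bounded_past_covariance_W[OF p(1,2) p(3) \<eta>] and Xa = bounded_past_covariance_W[OF p(1,2) a \<eta>]
  have eq: "?Q \<omega> * wiener_integral a T \<sigma> \<sigma>' \<omega>
      = \<sigma> T * (?Q \<omega> * W T \<omega>) - \<sigma> a * (?Q \<omega> * W a \<omega>) - ?Q \<omega> * (LINT u|lborel. ?h u * W u \<omega>)" for \<omega>
    by (simp add: wiener_integral_def algebra_simps)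
  have zero: "?h u = 0" if "u < 0" for u using that a by auto
  show "integrable M (\<lambda>\<omega>. ?Q \<omega> * wiener_integral a T \<sigma> \<sigma>' \<omega>)"
    unfolding eq using XT(1) Xa(1) Z(1) zero by auto
  have i1: "set_integrable lborel {a..T} (\<lambda>u. \<sigma>' u * ?g u)"
    by (intro borel_integrable_atLeastAtMost' continuous_intros c\<sigma>')
  have "set_integrable lborel {p..q} \<sigma>"
    by (intro borel_integrable_atLeastAtMost' c\<sigma>)
  then have i2: "set_integrable lborel {a..T} (\<lambda>u. indicator {p..q} u * \<sigma> u)"
    unfolding set_integrable_def
    by (rule Bochner_Integration.integrable_cong[THEN iffD1, rotated -1])
      (use pq in \<open>auto simp: indicator_def\<close>)
  have "(LINT u:{a..T}|lborel. \<sigma>' u * ?g u + indicator {p..q} u * \<sigma> u) = \<sigma> T * ?g T - \<sigma> a * ?g a"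
  proof (rule integral_FTC_finite_exceptions[where S="{p, q}"])
    fix x assume x: "x \<in> {a<..<T} - {p, q}"
    have "(?g has_real_derivative indicator {p..q} x) (at x)"
    proof -
      consider "x < p" | "p < x" "x < q" | "q < x" using x by force
      then show ?thesis
      proof cases
        case 1
        have "((\<lambda>u. 0) has_real_derivative 0) (at x)" by simp
        then show ?thesis
          by (rule DERIV_cong_ev[THEN iffD1, rotated -1])
            (use 1 pq eventually_nhds_in_open[of "{..<p}" x] in \<open>auto elim!: eventually_mono\<close>)
      next
        case 2
        have "((\<lambda>u. u - p) has_real_derivative 1) (at x)" by (auto intro!: derivative_eq_intros)
        then show ?thesis
          by (rule DERIV_cong_ev[THEN iffD1, rotated -1])
            (use 2 pq eventually_nhds_in_open[of "{p<..<q}" x] in \<open>auto elim!: eventually_mono\<close>)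
      next
        case 3
        have "((\<lambda>u. q - p) has_real_derivative 0) (at x)" by simp
        then show ?thesis
          by (rule DERIV_cong_ev[THEN iffD1, rotated -1])
            (use 3 pq eventually_nhds_in_open[of "{q<..}" x] in \<open>auto elim!: eventually_mono\<close>)
      qed
    qed
    from DERIV_mult[OF \<sigma> this]
    show "((\<lambda>u. \<sigma> u * ?g u) has_real_derivative \<sigma>' x * ?g x + indicator {p..q} x * \<sigma> x) (at x)"
      by (simp add: mult.commute)
  qed (use pq i1 i2 in \<open>auto intro!: continuous_intros c\<sigma> simp: set_integral_add\<close>)
  then have "(LINT u:{a..T}|lborel. \<sigma>' u * ?g u) + (LINT u:{a..T}|lborel. indicator {p..q} u * \<sigma> u)
      = \<sigma> T * (q - p)"
    using i1 i2 pq by (simp add: set_integral_add)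
  moreover have "(LINT u:{a..T}|lborel. \<sigma>' u * ?g u) = (LINT u|lborel. ?h u * ?g u)"
    unfolding set_lebesgue_integral_def by (simp add: mult.assoc)
  moreover have "(LINT u:{a..T}|lborel. indicator {p..q} u * \<sigma> u) = (LINT u:{p..q}|lborel. \<sigma> u)"
    unfolding set_lebesgue_integral_def
    by (rule Bochner_Integration.integral_cong) (use pq in \<open>auto simp: indicator_def\<close>)
  ultimately have fin: "\<sigma> T * (q - p) - (LINT u|lborel. ?h u * ?g u) = (LINT u:{p..q}|lborel. \<sigma> u)"
    by simp
  have "expectation (\<lambda>\<omega>. ?Q \<omega> * wiener_integral a T \<sigma> \<sigma>' \<omega>)
      = \<sigma> T * (expectation \<eta> * (min q T - min p T)) - \<sigma> a * (expectation \<eta> * (min q a - min p a))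
        - expectation \<eta> * (LINT u|lborel. ?h u * ?g u)"
    unfolding eq using XT Xa Z zero by simp
  also have "\<dots> = expectation \<eta> * (\<sigma> T * (q - p) - (LINT u|lborel. ?h u * ?g u))"
    using pq by (simp add: algebra_simps)
  finally show "expectation (\<lambda>\<omega>. ?Q \<omega> * wiener_integral a T \<sigma> \<sigma>' \<omega>)
      = expectation \<eta> * (LINT s:{p..q}|lborel. \<sigma> s)" unfolding fin .
qed

lemma wiener_integral_measurable [measurable]:
  assumes "continuous_on UNIV \<sigma>'"
  shows "wiener_integral a T \<sigma> \<sigma>' \<in> borel_measurable M"
proof -
  have "continuous_on {a..T} \<sigma>'" using assms continuous_on_subset by blast
  from kernel_W(4)[OF kernel_indicator[OF this]]
  show ?thesis unfolding wiener_integral_def[abs_def] by measurable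
qed

text \<open>One factor of the square is expanded by its definition; the covariance of the other one with
  \<open>W u\<close> is \<open>\<integral> \<sigma>\<close> over \<open>[a, u]\<close> plus a constant that cancels. What remains is the integral of
  the derivative of \<open>\<sigma>(u) \<integral> \<sigma>\<close>.\<close>

lemma wiener_integral_second_moment:
  assumes a: "0 \<le> a" "a \<le> T" and \<sigma>: "\<And>x. (\<sigma> has_real_derivative \<sigma>' x) (at x)"
    and \<sigma>': "continuous_on UNIV \<sigma>'"
  shows "integrable M (\<lambda>\<omega>. (wiener_integral a T \<sigma> \<sigma>' \<omega>)\<^sup>2)"
    and "expectation (\<lambda>\<omega>. (wiener_integral a T \<sigma> \<sigma>' \<omega>)\<^sup>2) = (LINT s:{a..T}|lborel. (\<sigma> s)\<^sup>2)"
proof -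
  let ?R = "wiener_integral a T \<sigma> \<sigma>'"
  let ?h = "\<lambda>u. indicator {a..T} u * \<sigma>' u"
  define s where "s u = (LINT s:{a..u}|lborel. \<sigma> s)" for u
  have c\<sigma>: "continuous_on A \<sigma>" for A
    using \<sigma> by (meson DERIV_isCont continuous_at_imp_continuous_on)
  have c\<sigma>': "continuous_on A \<sigma>'" for A using \<sigma>' continuous_on_subset by blast
  have h: "kernel ?h" by (rule kernel_indicator[OF c\<sigma>'])
  have [measurable]: "?R \<in> borel_measurable M" using \<sigma>' by measurable
  have hW: "integrable lborel (\<lambda>u. ?h u * W u \<omega>)" for \<omega> by (rule kernel_W(1)[OF h])
  have Ih: "integrable lborel ?h" by (rule kernel_integrable[OF h])
  have "(LINT u:{a..T}|lborel. \<sigma>' u) = \<sigma> T - \<sigma> a"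
    by (rule integral_FTC_finite_exceptions[where S="{}"])
      (use a \<sigma> in \<open>auto intro!: c\<sigma> borel_integrable_atLeastAtMost' c\<sigma>'\<close>)
  then have ih: "(LINT u|lborel. ?h u) = \<sigma> T - \<sigma> a"
    by (simp add: set_lebesgue_integral_def)
  have R: "?R \<omega> = \<sigma> T * (W T \<omega> - W a \<omega>) - (LINT u|lborel. ?h u * (W u \<omega> - W a \<omega>))" for \<omega>
  proof -
    have "(LINT u|lborel. ?h u * (W u \<omega> - W a \<omega>)) = (LINT u|lborel. ?h u * W u \<omega>) - (\<sigma> T - \<sigma> a) * W a \<omega>"
      using hW Ih ih
      by (simp only: right_diff_distrib Bochner_Integration.integral_diff integrable_mult_left integral_mult_left_zero)
    then show ?thesis by (simp add: wiener_integral_def algebra_simps)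
  qed
  let ?V = "\<lambda>\<omega>. LINT u|lborel. ?h u * (W u \<omega> - W a \<omega>)"
  have [measurable]: "?V \<in> borel_measurable M"
  proof -
    have "?V = (\<lambda>\<omega>. \<sigma> T * (W T \<omega> - W a \<omega>) - ?R \<omega>)" using R by auto
    then show ?thesis by simp
  qed
  show R2: "integrable M (\<lambda>\<omega>. (?R \<omega>)\<^sup>2)"
  proof (rule Bochner_Integration.integrable_bound)
    show "integrable M (\<lambda>\<omega>. 2 * (\<sigma> T)\<^sup>2 * (W T \<omega> - W a \<omega>)\<^sup>2 + 2 * (?V \<omega>)\<^sup>2)"
      using W_increment_moments(1)[OF a(1), of T] kernel_W_second_moment(1)[OF h a(1)] by simp
    show "AE \<omega> in M. norm ((?R \<omega>)\<^sup>2) \<le> norm (2 * (\<sigma> T)\<^sup>2 * (W T \<omega> - W a \<omega>)\<^sup>2 + 2 * (?V \<omega>)\<^sup>2)"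
    proof (rule AE_I2)
      fix \<omega>
      have "(x - y)\<^sup>2 \<le> 2 * x\<^sup>2 + 2 * y\<^sup>2" for x y :: real
        using zero_le_power2[of "x + y"] unfolding power2_diff power2_sum by linarith
      from this[of "\<sigma> T * (W T \<omega> - W a \<omega>)" "?V \<omega>"]
      show "norm ((?R \<omega>)\<^sup>2) \<le> norm (2 * (\<sigma> T)\<^sup>2 * (W T \<omega> - W a \<omega>)\<^sup>2 + 2 * (?V \<omega>)\<^sup>2)"
        unfolding R by (simp add: power_mult_distrib)
    qed
  qed measurable
  have i: "integrable M (\<lambda>\<omega>. ?R \<omega> * W u \<omega>)" for u
    by (rule integrable_mult_of_squares[OF _ W_measurable R2 W_moments(1)]) measurable
  have cov: "expectation (\<lambda>\<omega>. ?R \<omega> * W u \<omega>) = s u + expectation (\<lambda>\<omega>. ?R \<omega> * W a \<omega>)"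
    if u: "a \<le> u" "u \<le> T" for u
  proof -
    have [measurable]: "B u \<in> borel_measurable M" "B a \<in> borel_measurable M" using u a by auto
    have "AE \<omega> in M. ?R \<omega> * W u \<omega> - ?R \<omega> * W a \<omega> = 1 * (B u \<omega> - B a \<omega>) * ?R \<omega>"
      using W_AE_eq_at[of u] W_AE_eq_at[of a] u a by (auto elim!: eventually_elim2 simp: algebra_simps)
    then have "expectation (\<lambda>\<omega>. ?R \<omega> * W u \<omega> - ?R \<omega> * W a \<omega>)
        = expectation (\<lambda>\<omega>. 1 * (B u \<omega> - B a \<omega>) * ?R \<omega>)"
      by (intro integral_cong_AE) measurable
    also have "\<dots> = s u"
      using wiener_integral_covariance(2)[OF a(1) \<sigma> \<sigma>' order_refl u, of "\<lambda>_. 1" 1]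
      by (simp add: s_def prob_space)
    finally show ?thesis using i by simp
  qed
  let ?c = "expectation (\<lambda>\<omega>. ?R \<omega> * W a \<omega>)"
  note K = expectation_kernel_W[OF h _ R2]
  have K1: "integrable M (\<lambda>\<omega>. ?R \<omega> * (LINT u|lborel. ?h u * W u \<omega>))"
    and K2: "expectation (\<lambda>\<omega>. ?R \<omega> * (LINT u|lborel. ?h u * W u \<omega>))
      = (LINT u|lborel. ?h u * expectation (\<lambda>\<omega>. ?R \<omega> * W u \<omega>))"
    using K by auto
  have s_eq: "s = (\<lambda>u. LINT s:{a..u}|lborel. \<sigma> s)" by (simp add: s_def fun_eq_iff)
  have s_deriv: "(s has_real_derivative \<sigma> x) (at x)" if "a < x" for x
    unfolding s_eq by (rule indefinite_integral_deriv[OF c\<sigma> that])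
  have s_cont: "continuous_on {a..T} s"
    unfolding s_eq by (rule indefinite_integral_continuous[OF c\<sigma>])
  have i1: "set_integrable lborel {a..T} (\<lambda>u. \<sigma>' u * s u)"
    by (intro borel_integrable_atLeastAtMost' continuous_intros c\<sigma>' s_cont)
  have i2: "set_integrable lborel {a..T} (\<lambda>u. (\<sigma> u)\<^sup>2)"
    by (intro borel_integrable_atLeastAtMost' continuous_intros c\<sigma>)
  have "(LINT u:{a..T}|lborel. \<sigma>' u * s u + (\<sigma> u)\<^sup>2) = \<sigma> T * s T - \<sigma> a * s a"
  proof (rule integral_FTC_finite_exceptions[where S="{}"])
    fix x assume "x \<in> {a<..<T} - {}"
    then have "a < x" by simp
    from DERIV_mult[OF \<sigma> s_deriv[OF this]]
    show "((\<lambda>u. \<sigma> u * s u) has_real_derivative \<sigma>' x * s x + (\<sigma> x)\<^sup>2) (at x)"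
      by (simp add: power2_eq_square)
  qed (use a i1 i2 in \<open>auto intro!: continuous_intros c\<sigma> s_cont set_integral_add\<close>)
  moreover have "s a = 0" using cov[of a] a by simp
  ultimately have parts: "\<sigma> T * s T - (LINT u:{a..T}|lborel. \<sigma>' u * s u) = (LINT u:{a..T}|lborel. (\<sigma> u)\<^sup>2)"
    using i1 i2 by (simp add: set_integral_add)
  have "?h u * expectation (\<lambda>\<omega>. ?R \<omega> * W u \<omega>) = indicator {a..T} u * (\<sigma>' u * s u) + ?c * ?h u" for u
    using cov[of u] by (auto simp: indicator_def algebra_simps)
  then have K3: "(LINT u|lborel. ?h u * expectation (\<lambda>\<omega>. ?R \<omega> * W u \<omega>))
      = (LINT u:{a..T}|lborel. \<sigma>' u * s u) + ?c * (\<sigma> T - \<sigma> a)"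
    using i1 Ih ih by (simp add: set_lebesgue_integral_def set_integrable_def)
  have "expectation (\<lambda>\<omega>. (?R \<omega>)\<^sup>2)
      = expectation (\<lambda>\<omega>. \<sigma> T * (?R \<omega> * W T \<omega>) - \<sigma> a * (?R \<omega> * W a \<omega>) - ?R \<omega> * (LINT u|lborel. ?h u * W u \<omega>))"
  proof (intro Bochner_Integration.integral_cong refl)
    fix \<omega>
    have "(?R \<omega>)\<^sup>2 = ?R \<omega> * (\<sigma> T * W T \<omega> - \<sigma> a * W a \<omega> - (LINT u|lborel. ?h u * W u \<omega>))"
      unfolding power2_eq_square by (subst (2) wiener_integral_def) (rule refl)
    then show "(?R \<omega>)\<^sup>2 = \<sigma> T * (?R \<omega> * W T \<omega>) - \<sigma> a * (?R \<omega> * W a \<omega>) - ?R \<omega> * (LINT u|lborel. ?h u * W u \<omega>)"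
      by (simp only: right_diff_distrib mult.left_commute)
  qed
  also have "\<dots> = \<sigma> T * (s T + ?c) - \<sigma> a * ?c - ((LINT u:{a..T}|lborel. \<sigma>' u * s u) + ?c * (\<sigma> T - \<sigma> a))"
    using i K1 K2 K3 cov[of T] a by simp
  also have "\<dots> = (LINT u:{a..T}|lborel. (\<sigma> u)\<^sup>2)"
    unfolding parts[symmetric] by (simp add: algebra_simps)
  finally show "expectation (\<lambda>\<omega>. (?R \<omega>)\<^sup>2) = (LINT u:{a..T}|lborel. (\<sigma> u)\<^sup>2)" .
qed

end

lemma AE_eq_of_common_L2_limit:
  fixes f g :: "'a \<Rightarrow> real"
  assumes m: "f \<in> borel_measurable M" "g \<in> borel_measurable M" "\<And>j. h j \<in> borel_measurable M"
    and f: "(\<lambda>j. \<integral>\<^sup>+\<omega>. ennreal ((f \<omega> - h j \<omega>)\<^sup>2) \<partial>M) \<longlonglongrightarrow> 0"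
    and g: "(\<lambda>j. \<integral>\<^sup>+\<omega>. ennreal ((h j \<omega> - g \<omega>)\<^sup>2) \<partial>M) \<longlonglongrightarrow> 0"
  shows "AE \<omega> in M. f \<omega> = g \<omega>"
proof -
  have [measurable]: "f \<in> borel_measurable M" "g \<in> borel_measurable M" "h j \<in> borel_measurable M" for j
    using m by auto
  let ?I = "\<integral>\<^sup>+\<omega>. ennreal ((f \<omega> - g \<omega>)\<^sup>2) \<partial>M"
  have "?I \<le> 2 * (\<integral>\<^sup>+\<omega>. ennreal ((f \<omega> - h j \<omega>)\<^sup>2) \<partial>M) + 2 * (\<integral>\<^sup>+\<omega>. ennreal ((h j \<omega> - g \<omega>)\<^sup>2) \<partial>M)" for j
  proof -
    have sq: "(x - y)\<^sup>2 \<le> 2 * (x - z)\<^sup>2 + 2 * (z - y)\<^sup>2" for x y z :: real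
      using zero_le_power2[of "(x - z) - (z - y)"] by (simp add: power2_eq_square algebra_simps)
    have "?I \<le> (\<integral>\<^sup>+\<omega>. 2 * ennreal ((f \<omega> - h j \<omega>)\<^sup>2) + 2 * ennreal ((h j \<omega> - g \<omega>)\<^sup>2) \<partial>M)"
    proof (rule nn_integral_mono)
      fix \<omega>
      have "ennreal ((f \<omega> - g \<omega>)\<^sup>2) \<le> ennreal (2 * (f \<omega> - h j \<omega>)\<^sup>2 + 2 * (h j \<omega> - g \<omega>)\<^sup>2)"
        by (rule ennreal_leI[OF sq])
      then show "ennreal ((f \<omega> - g \<omega>)\<^sup>2) \<le> 2 * ennreal ((f \<omega> - h j \<omega>)\<^sup>2) + 2 * ennreal ((h j \<omega> - g \<omega>)\<^sup>2)"
        by (simp add: ennreal_plus ennreal_mult')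
    qed
    then show ?thesis by (simp add: nn_integral_add nn_integral_cmult)
  qed
  moreover have "(\<lambda>j. 2 * (\<integral>\<^sup>+\<omega>. ennreal ((f \<omega> - h j \<omega>)\<^sup>2) \<partial>M) + 2 * (\<integral>\<^sup>+\<omega>. ennreal ((h j \<omega> - g \<omega>)\<^sup>2) \<partial>M))
      \<longlonglongrightarrow> 2 * 0 + 2 * 0"
    using f g by (intro tendsto_add ennreal_tendsto_cmult) auto
  ultimately have "?I \<le> 2 * 0 + 2 * 0" by (intro LIMSEQ_le_const) auto
  then have "?I = 0" by simp
  then have "AE \<omega> in M. ennreal ((f \<omega> - g \<omega>)\<^sup>2) = 0"
    by (subst (asm) nn_integral_0_iff_AE) auto
  then show ?thesis by eventually_elim (simp add: ennreal_eq_0_iff)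
qed

context brownian_motion
begin

lemma simple_process_times:
  assumes sp: "simple_process M F a T n \<tau> \<xi>" and ij: "i \<le> j" "j \<le> n"
  shows "a \<le> \<tau> i" "\<tau> i \<le> \<tau> j" "\<tau> j \<le> T"
proof -
  have lt: "\<tau> i < \<tau> (Suc i)" if "i < n" for i
    using sp that by (auto simp: simple_process_def)
  have mono: "\<tau> i \<le> \<tau> j" if "i \<le> j" "j \<le> n" for i j
    using that
  proof (induction j rule: dec_induct)
    case (step m)
    then show ?case using lt[of m] by simp
  qed simp
  have "\<tau> 0 = a" "\<tau> n = T" using sp by (auto simp: simple_process_def)
  then show "a \<le> \<tau> i" "\<tau> i \<le> \<tau> j" "\<tau> j \<le> T"
    using mono[of 0 i] mono[of i j] mono[of j n] ij by auto
qed

lemma simple_process_val_square: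
  assumes sp: "simple_process M F a T n \<tau> \<xi>"
  shows "(simple_process_val n \<tau> \<xi> s \<omega>)\<^sup>2 = (\<Sum>i<n. (\<xi> i \<omega>)\<^sup>2 * indicator {\<tau> i<..\<tau> (Suc i)} s)"
proof -
  let ?I = "\<lambda>i. indicator {\<tau> i<..\<tau> (Suc i)} s :: real"
  have cross0: "?I i * ?I j = 0" if "i < j" "j < n" for i j
    using simple_process_times(2)[OF sp, of "Suc i" j] that by (auto simp: indicator_def)
  have cross: "?I i * ?I j = (if i = j then ?I i else 0)" if "i < n" "j < n" for i j
    using cross0[of i j] cross0[of j i] that
    by (cases i j rule: linorder_cases) (auto simp: mult.commute indicator_def)
  have "(simple_process_val n \<tau> \<xi> s \<omega>)\<^sup>2 = (\<Sum>i<n. \<Sum>j<n. \<xi> i \<omega> * \<xi> j \<omega> * (?I i * ?I j))"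
    unfolding simple_process_val_def power2_eq_square sum_product
    by (intro sum.cong refl) (simp add: mult_ac)
  also have "\<dots> = (\<Sum>i<n. \<Sum>j<n. if i = j then (\<xi> i \<omega>)\<^sup>2 * ?I i else 0)"
    by (intro sum.cong refl) (simp add: cross power2_eq_square)
  also have "\<dots> = (\<Sum>i<n. (\<xi> i \<omega>)\<^sup>2 * ?I i)" by (simp add: sum.delta')
  finally show ?thesis .
qed

lemma simple_process_bound:
  assumes sp: "simple_process M F a T n \<tau> \<xi>"
  obtains C where "\<And>i \<omega>. i < n \<Longrightarrow> \<omega> \<in> space M \<Longrightarrow> \<bar>\<xi> i \<omega>\<bar> \<le> C"
  using sp that unfolding simple_process_def by blast

text \<open>The Ito isometry for simple processes: products of distinct summands have mean zero because
  the later increment is independent of all other factors.\<close>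

lemma simple_integral_second_moment:
  assumes sp: "simple_process M F a T n \<tau> \<xi>" and a: "0 \<le> a"
  shows "integrable M (\<lambda>\<omega>. (simple_integral_wrt B n \<tau> \<xi> \<omega>)\<^sup>2)"
    and "expectation (\<lambda>\<omega>. (simple_integral_wrt B n \<tau> \<xi> \<omega>)\<^sup>2)
      = (\<Sum>i<n. expectation (\<lambda>\<omega>. (\<xi> i \<omega>)\<^sup>2) * (\<tau> (Suc i) - \<tau> i))"
proof -
  obtain C where C: "\<And>i \<omega>. i < n \<Longrightarrow> \<omega> \<in> space M \<Longrightarrow> \<bar>\<xi> i \<omega>\<bar> \<le> C"
    using simple_process_bound[OF sp] by blast
  have \<xi>: "\<xi> i \<in> borel_measurable (F (\<tau> i))" if "i < n" for i
    using sp that by (auto simp: simple_process_def)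
  have \<tau>: "0 \<le> \<tau> i" "\<tau> i \<le> \<tau> (Suc i)" if "i < n" for i
    using simple_process_times[OF sp, of i "Suc i"] a that by auto
  let ?f = "\<lambda>i \<omega>. \<xi> i \<omega> * (B (\<tau> (Suc i)) \<omega> - B (\<tau> i) \<omega>)"
  have fm: "?f i \<in> borel_measurable M" if "i < n" for i
    using measurable_F_M[OF \<xi>[OF that]] B_measurable[of "\<tau> i"] B_measurable[of "\<tau> (Suc i)"] \<tau>[OF that]
    by simp
  have f2: "integrable M (\<lambda>\<omega>. (?f i \<omega>)\<^sup>2)" if "i < n" for i
    by (rule bounded_past_increment_square_integrable[OF \<tau>[OF that] \<xi>[OF that] C[OF that]])
  have prod: "integrable M (\<lambda>\<omega>. ?f i \<omega> * ?f j \<omega>)" if "i < n" "j < n" for i j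
    by (rule integrable_mult_of_squares[OF fm[OF that(1)] fm[OF that(2)] f2[OF that(1)] f2[OF that(2)]])
  have cross: "expectation (\<lambda>\<omega>. ?f i \<omega> * ?f j \<omega>) = 0" if ij: "i < j" "j < n" for i j
  proof -
    have i: "i < n" using ij by simp
    have le: "\<tau> i \<le> \<tau> j" "\<tau> (Suc i) \<le> \<tau> j" using simple_process_times(2)[OF sp] ij by auto
    have fF: "?f i \<in> borel_measurable (F (\<tau> j))"
      using measurable_F_mono[OF le(1) \<xi>[OF i]] B_measurable_F[of "\<tau> i" "\<tau> j"]
        B_measurable_F[of "\<tau> (Suc i)" "\<tau> j"] \<tau>[OF i] le by simp
    have pF: "(\<lambda>\<omega>. \<xi> j \<omega> * ?f i \<omega>) \<in> borel_measurable (F (\<tau> j))"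
      using fF \<xi>[OF ij(2)] by simp
    have fi: "integrable M (?f i)"
      using bounded_past_times_increment(1)[OF \<tau>[OF i] \<xi>[OF i] C[OF i]] .
    have pi: "integrable M (\<lambda>\<omega>. \<xi> j \<omega> * ?f i \<omega>)"
      by (rule bounded_times_integrable[OF measurable_F_M[OF \<xi>[OF ij(2)]] C[OF ij(2)] fi])
    have "expectation (\<lambda>\<omega>. (\<xi> j \<omega> * ?f i \<omega>) * (B (\<tau> (Suc j)) \<omega> - B (\<tau> j) \<omega>)) = 0"
      by (rule expectation_past_times_increment(2)[OF \<tau>[OF ij(2)] pF pi])
    then show ?thesis by (simp add: mult_ac)
  qed
  note sq = square_sum_orthogonal[where f="?f" and n=n and N=M, OF prod cross]
  show "integrable M (\<lambda>\<omega>. (simple_integral_wrt B n \<tau> \<xi> \<omega>)\<^sup>2)"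
    unfolding simple_integral_wrt_def by (rule sq(1))
  have "expectation (\<lambda>\<omega>. (simple_integral_wrt B n \<tau> \<xi> \<omega>)\<^sup>2) = (\<Sum>i<n. expectation (\<lambda>\<omega>. (?f i \<omega>)\<^sup>2))"
    unfolding simple_integral_wrt_def by (rule sq(2))
  also have "\<dots> = (\<Sum>i<n. expectation (\<lambda>\<omega>. (\<xi> i \<omega>)\<^sup>2) * (\<tau> (Suc i) - \<tau> i))"
  proof (rule sum.cong[OF refl])
    fix i assume "i \<in> {..<n}"
    then have i: "i < n" by simp
    have "(\<lambda>\<omega>. (\<xi> i \<omega>)\<^sup>2) \<in> borel_measurable (F (\<tau> i))" using \<xi>[OF i] by simp
    moreover have "integrable M (\<lambda>\<omega>. (\<xi> i \<omega>)\<^sup>2)"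
    proof (rule integrable_const_bound[where B="C\<^sup>2"])
      show "AE \<omega> in M. norm ((\<xi> i \<omega>)\<^sup>2) \<le> C\<^sup>2"
        using AE_space by eventually_elim (use power_mono[OF C[OF i], of _ 2] in simp)
    qed (use measurable_F_M[OF \<xi>[OF i]] in simp)
    ultimately show "expectation (\<lambda>\<omega>. (?f i \<omega>)\<^sup>2) = expectation (\<lambda>\<omega>. (\<xi> i \<omega>)\<^sup>2) * (\<tau> (Suc i) - \<tau> i)"
      unfolding power_mult_distrib by (rule expectation_past_times_increment_square(2)[OF \<tau>[OF i]])
  qed
  finally show "expectation (\<lambda>\<omega>. (simple_integral_wrt B n \<tau> \<xi> \<omega>)\<^sup>2)
      = (\<Sum>i<n. expectation (\<lambda>\<omega>. (\<xi> i \<omega>)\<^sup>2) * (\<tau> (Suc i) - \<tau> i))" .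
qed

text \<open>Expanding both squares gives three terms on either side. They agree by the isometry, by
  \<open>wiener_integral_covariance\<close> for the mixed term, and by \<open>wiener_integral_second_moment\<close>.\<close>

lemma simple_integral_distance:
  assumes sp: "simple_process M F a T n \<tau> \<xi>" and a: "0 \<le> a" "a \<le> T"
    and \<sigma>: "\<And>x. (\<sigma> has_real_derivative \<sigma>' x) (at x)" and \<sigma>': "continuous_on UNIV \<sigma>'"
  shows "(\<integral>\<^sup>+\<omega>. ennreal ((simple_integral_wrt B n \<tau> \<xi> \<omega> - wiener_integral a T \<sigma> \<sigma>' \<omega>)\<^sup>2) \<partial>M)
    = (\<integral>\<^sup>+\<omega>. (\<integral>\<^sup>+s\<in>{a..T}. ennreal ((\<sigma> s - simple_process_val n \<tau> \<xi> s \<omega>)\<^sup>2) \<partial>lborel) \<partial>M)"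
proof -
  let ?S = "simple_integral_wrt B n \<tau> \<xi>" and ?R = "wiener_integral a T \<sigma> \<sigma>'"
  have c\<sigma>: "continuous_on A \<sigma>" for A
    using \<sigma> by (meson DERIV_isCont continuous_at_imp_continuous_on)
  obtain C where C: "\<And>i \<omega>. i < n \<Longrightarrow> \<omega> \<in> space M \<Longrightarrow> \<bar>\<xi> i \<omega>\<bar> \<le> C"
    using simple_process_bound[OF sp] by blast
  have \<xi>: "\<xi> i \<in> borel_measurable (F (\<tau> i))" if "i < n" for i
    using sp that by (auto simp: simple_process_def)
  have \<xi>M: "\<xi> i \<in> borel_measurable M" if "i < n" for i
    using measurable_F_M[OF \<xi>[OF that]] .
  have \<tau>: "a \<le> \<tau> i" "0 \<le> \<tau> i" "\<tau> i \<le> \<tau> (Suc i)" "\<tau> (Suc i) \<le> T" "0 \<le> \<tau> (Suc i)" if "i < n" for i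
    using simple_process_times[OF sp, of i "Suc i"] a that by auto
  have \<xi>i: "integrable M (\<xi> i)" if "i < n" for i
    by (rule integrable_const_bound[where B=C])
      (use C[OF that] \<xi>M[OF that] in \<open>auto intro!: AE_I2\<close>)
  have \<xi>2: "integrable M (\<lambda>\<omega>. (\<xi> i \<omega>)\<^sup>2)" if "i < n" for i
  proof (rule integrable_const_bound[where B="C\<^sup>2"])
    show "AE \<omega> in M. norm ((\<xi> i \<omega>)\<^sup>2) \<le> C\<^sup>2"
      using AE_space by eventually_elim (use power_mono[OF C[OF that], of _ 2] in simp)
  qed (use \<xi>M[OF that] in simp)
  let ?s = "\<lambda>i. LINT s:{\<tau> i..\<tau> (Suc i)}|lborel. \<sigma> s"
  let ?K = "LINT s:{a..T}|lborel. (\<sigma> s)\<^sup>2"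
  let ?D = "\<lambda>\<omega>. ?K - 2 * (\<Sum>i<n. \<xi> i \<omega> * ?s i) + (\<Sum>i<n. (\<xi> i \<omega>)\<^sup>2 * (\<tau> (Suc i) - \<tau> i))"
  have Sm [measurable]: "?S \<in> borel_measurable M"
    unfolding simple_integral_wrt_def[abs_def]
    using \<xi>M \<tau> by (intro borel_measurable_sum borel_measurable_times borel_measurable_diff B_measurable)
      auto
  have Rm [measurable]: "?R \<in> borel_measurable M" using \<sigma>' by measurable
  note S2 = simple_integral_second_moment[OF sp a(1)] and R2 = wiener_integral_second_moment[OF a \<sigma> \<sigma>']
  have cov: "integrable M (\<lambda>\<omega>. \<xi> i \<omega> * (B (\<tau> (Suc i)) \<omega> - B (\<tau> i) \<omega>) * ?R \<omega>)"
      "expectation (\<lambda>\<omega>. \<xi> i \<omega> * (B (\<tau> (Suc i)) \<omega> - B (\<tau> i) \<omega>) * ?R \<omega>) = expectation (\<xi> i) * ?s i"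
    if "i < n" for i
    using wiener_integral_covariance[OF a(1) \<sigma> \<sigma>' \<tau>(1,3,4)[OF that] \<xi>[OF that] C[OF that]] by auto
  have SR: "integrable M (\<lambda>\<omega>. ?S \<omega> * ?R \<omega>)"
    "expectation (\<lambda>\<omega>. ?S \<omega> * ?R \<omega>) = (\<Sum>i<n. expectation (\<xi> i) * ?s i)"
    unfolding simple_integral_wrt_def sum_distrib_right using cov
    by (auto simp: Bochner_Integration.integral_sum intro!: Bochner_Integration.integrable_sum)
  have D: "integrable M ?D"
    using \<xi>i \<xi>2 by (intro Bochner_Integration.integrable_add Bochner_Integration.integrable_diff
        integrable_mult_right Bochner_Integration.integrable_sum integrable_mult_left) auto
  have ED: "expectation ?D = ?K - 2 * (\<Sum>i<n. expectation (\<xi> i) * ?s i)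
      + (\<Sum>i<n. expectation (\<lambda>\<omega>. (\<xi> i \<omega>)\<^sup>2) * (\<tau> (Suc i) - \<tau> i))"
  proof -
    have *: "integrable M (\<lambda>\<omega>. \<Sum>i<n. \<xi> i \<omega> * ?s i)"
      "integrable M (\<lambda>\<omega>. \<Sum>i<n. (\<xi> i \<omega>)\<^sup>2 * (\<tau> (Suc i) - \<tau> i))"
      using \<xi>i \<xi>2 by (auto intro!: Bochner_Integration.integrable_sum integrable_mult_left)
    have "expectation ?D = ?K - 2 * expectation (\<lambda>\<omega>. \<Sum>i<n. \<xi> i \<omega> * ?s i)
        + expectation (\<lambda>\<omega>. \<Sum>i<n. (\<xi> i \<omega>)\<^sup>2 * (\<tau> (Suc i) - \<tau> i))"
      using * by (simp add: prob_space)
    then show ?thesis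
      using \<xi>i \<xi>2 by (simp add: Bochner_Integration.integral_sum)
  qed
  have sq: "(?S \<omega> - ?R \<omega>)\<^sup>2 = (?S \<omega>)\<^sup>2 - 2 * (?S \<omega> * ?R \<omega>) + (?R \<omega>)\<^sup>2" for \<omega>
    by (simp add: power2_diff)
  have "integrable M (\<lambda>\<omega>. (?S \<omega> - ?R \<omega>)\<^sup>2)"
    unfolding sq using S2(1) R2(1) SR(1) by simp
  then have "(\<integral>\<^sup>+\<omega>. ennreal ((?S \<omega> - ?R \<omega>)\<^sup>2) \<partial>M) = ennreal (expectation (\<lambda>\<omega>. (?S \<omega> - ?R \<omega>)\<^sup>2))"
    by (rule nn_integral_eq_integral) simp
  also have "expectation (\<lambda>\<omega>. (?S \<omega> - ?R \<omega>)\<^sup>2) = expectation ?D"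
    unfolding sq ED using S2 R2 SR by simp
  also have "ennreal (expectation ?D) = (\<integral>\<^sup>+\<omega>. (\<integral>\<^sup>+s\<in>{a..T}. ennreal ((\<sigma> s - simple_process_val n \<tau> \<xi> s \<omega>)\<^sup>2) \<partial>lborel) \<partial>M)"
  proof -
    have inner: "0 \<le> ?D \<omega> \<and> (\<integral>\<^sup>+s\<in>{a..T}. ennreal ((\<sigma> s - simple_process_val n \<tau> \<xi> s \<omega>)\<^sup>2) \<partial>lborel) = ennreal (?D \<omega>)" for \<omega>
    proof -
      let ?J = "\<lambda>i. indicator {\<tau> i<..\<tau> (Suc i)} :: real \<Rightarrow> real"
      let ?g = "\<lambda>s. indicator {a..T} s * (\<sigma> s)\<^sup>2 - 2 * (\<Sum>i<n. \<xi> i \<omega> * (?J i s * \<sigma> s))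
        + (\<Sum>i<n. (\<xi> i \<omega>)\<^sup>2 * ?J i s)"
      have g: "indicator {a..T} s * (\<sigma> s - simple_process_val n \<tau> \<xi> s \<omega>)\<^sup>2 = ?g s" for s
      proof -
        have J: "indicator {a..T} s * ?J i s = ?J i s" if "i < n" for i
          using \<tau>[OF that] by (auto simp: indicator_def)
        let ?v = "simple_process_val n \<tau> \<xi> s \<omega>"
        have 1: "indicator {a..T} s * ?v = ?v"
          unfolding simple_process_val_def sum_distrib_left
          by (rule sum.cong[OF refl]) (metis J lessThan_iff mult.left_commute)
        have "indicator {a..T} s * (\<sigma> s - ?v)\<^sup>2
          = indicator {a..T} s * (\<sigma> s)\<^sup>2 - 2 * ((indicator {a..T} s * ?v) * \<sigma> s) + (indicator {a..T} s * ?v) * ?v"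
          by (simp only: power2_eq_square) (simp only: algebra_simps)
        also have "\<dots> = indicator {a..T} s * (\<sigma> s)\<^sup>2 - 2 * (?v * \<sigma> s) + ?v\<^sup>2"
          unfolding 1 power2_eq_square ..
        also have "?v\<^sup>2 = (\<Sum>i<n. (\<xi> i \<omega>)\<^sup>2 * ?J i s)" by (rule simple_process_val_square[OF sp])
        also have "?v * \<sigma> s = (\<Sum>i<n. \<xi> i \<omega> * (?J i s * \<sigma> s))"
          unfolding simple_process_val_def sum_distrib_right by (simp only: mult.assoc)
        finally show ?thesis .
      qed
      have gi1: "integrable lborel (\<lambda>s. indicator {a..T} s * (\<sigma> s)\<^sup>2)"
        using borel_integrable_atLeastAtMost'[of a T "\<lambda>s. (\<sigma> s)\<^sup>2"] c\<sigma>
        by (simp add: set_integrable_def continuous_intros)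
      have ae: "AE s in lborel. ?J i s * \<sigma> s = indicator {\<tau> i..\<tau> (Suc i)} s * \<sigma> s" for i
        using AE_lborel_singleton[of "\<tau> i"] by eventually_elim (auto simp: indicator_def)
      have "integrable lborel (\<lambda>s. indicator {\<tau> i..\<tau> (Suc i)} s * \<sigma> s)" for i
        using borel_integrable_atLeastAtMost'[OF c\<sigma>, of "\<tau> i" "\<tau> (Suc i)"] by (simp add: set_integrable_def)
      moreover have "(\<lambda>s. ?J i s * \<sigma> s) \<in> borel_measurable lborel" for i
        using borel_measurable_continuous_onI[OF c\<sigma>] by measurable
      ultimately have gi2: "integrable lborel (\<lambda>s. ?J i s * \<sigma> s)"
        and ge2: "(LINT s|lborel. ?J i s * \<sigma> s) = ?s i" for i
        using integrable_cong_AE[OF _ _ ae[of i]] integral_cong_AE[OF _ _ ae[of i]]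
        by (auto simp: set_lebesgue_integral_def)
      have gi3: "integrable lborel (?J i)" and ge3: "integral\<^sup>L lborel (?J i) = \<tau> (Suc i) - \<tau> i" if "i < n" for i
        using \<tau>[OF that] by auto
      have gi: "integrable lborel ?g"
        using gi1 gi2 gi3 by (intro Bochner_Integration.integrable_add Bochner_Integration.integrable_diff
          integrable_mult_right Bochner_Integration.integrable_sum) auto
      have "integral\<^sup>L lborel ?g = ?K - 2 * (\<Sum>i<n. \<xi> i \<omega> * (LINT s|lborel. ?J i s * \<sigma> s))
          + (\<Sum>i<n. (\<xi> i \<omega>)\<^sup>2 * integral\<^sup>L lborel (?J i))"
      proof -
        have lin: "(LINT s|lborel. f s - 2 * g s + h s)
            = integral\<^sup>L lborel f - 2 * integral\<^sup>L lborel g + integral\<^sup>L lborel h"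
          if "integrable lborel f" "integrable lborel g" "integrable lborel h" for f g h :: "real \<Rightarrow> real"
          using that by simp
        have a1: "integrable lborel (\<lambda>s. \<Sum>i<n. \<xi> i \<omega> * (?J i s * \<sigma> s))"
          by (intro Bochner_Integration.integrable_sum integrable_mult_right gi2)
        have a2: "integrable lborel (\<lambda>s. \<Sum>i<n. (\<xi> i \<omega>)\<^sup>2 * ?J i s)"
          by (intro Bochner_Integration.integrable_sum integrable_mult_right gi3) simp
        have "integral\<^sup>L lborel ?g = ?K - 2 * (LINT s|lborel. (\<Sum>i<n. \<xi> i \<omega> * (?J i s * \<sigma> s)))
            + (LINT s|lborel. (\<Sum>i<n. (\<xi> i \<omega>)\<^sup>2 * ?J i s))"
          unfolding lin[OF gi1 a1 a2] by (simp add: set_lebesgue_integral_def)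
        moreover have "(LINT s|lborel. (\<Sum>i<n. \<xi> i \<omega> * (?J i s * \<sigma> s))) = (\<Sum>i<n. \<xi> i \<omega> * (LINT s|lborel. ?J i s * \<sigma> s))"
          by (subst Bochner_Integration.integral_sum) (simp_all add: gi2)
        moreover have "(LINT s|lborel. (\<Sum>i<n. (\<xi> i \<omega>)\<^sup>2 * ?J i s)) = (\<Sum>i<n. (\<xi> i \<omega>)\<^sup>2 * integral\<^sup>L lborel (?J i))"
          by (subst Bochner_Integration.integral_sum, intro integrable_mult_right gi3, simp)
            (intro sum.cong refl integral_mult_right_zero)
        ultimately show ?thesis by simp
      qed
      then have ig: "integral\<^sup>L lborel ?g = ?D \<omega>" using ge2 ge3 by simp
      have pos: "0 \<le> ?g s" for s unfolding g[symmetric] by simp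
      have "(\<integral>\<^sup>+s\<in>{a..T}. ennreal ((\<sigma> s - simple_process_val n \<tau> \<xi> s \<omega>)\<^sup>2) \<partial>lborel) = (\<integral>\<^sup>+s. ennreal (?g s) \<partial>lborel)"
        unfolding g[symmetric] by (intro nn_integral_cong) (auto simp: indicator_def)
      also have "\<dots> = ennreal (?D \<omega>)" unfolding ig[symmetric]
        using gi pos by (intro nn_integral_eq_integral) auto
      finally have "(\<integral>\<^sup>+s\<in>{a..T}. ennreal ((\<sigma> s - simple_process_val n \<tau> \<xi> s \<omega>)\<^sup>2) \<partial>lborel) = ennreal (?D \<omega>)" .
      moreover have "0 \<le> ?D \<omega>" unfolding ig[symmetric] by (intro integral_nonneg_AE AE_I2 pos)
      ultimately show ?thesis by blast
    qed
    show ?thesis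
      using nn_integral_eq_integral[OF D] inner by simp
  qed
  finally show ?thesis .
qed

lemma ito_integral_eq_wiener_integral:
  assumes J: "is_ito_integral M F B a T (\<lambda>s \<omega>. \<sigma> s) J" and a: "0 \<le> a" "a \<le> T"
    and \<sigma>: "\<And>x. (\<sigma> has_real_derivative \<sigma>' x) (at x)" and \<sigma>': "continuous_on UNIV \<sigma>'"
  shows "AE \<omega> in M. J \<omega> = wiener_integral a T \<sigma> \<sigma>' \<omega>"
proof -
  obtain n \<tau> \<xi> where sp: "\<And>m. simple_process M F a T (n m) (\<tau> m) (\<xi> m)"
    and val: "(\<lambda>m. \<integral>\<^sup>+\<omega>. (\<integral>\<^sup>+s\<in>{a..T}.
             ennreal ((\<sigma> s - simple_process_val (n m) (\<tau> m) (\<xi> m) s \<omega>)\<^sup>2) \<partial>lborel) \<partial>M) \<longlonglongrightarrow> 0"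
    and int: "(\<lambda>m. \<integral>\<^sup>+\<omega>. ennreal ((J \<omega> - simple_integral_wrt B (n m) (\<tau> m) (\<xi> m) \<omega>)\<^sup>2) \<partial>M) \<longlonglongrightarrow> 0"
    and Jm: "J \<in> borel_measurable M"
    using J unfolding is_ito_integral_def by auto
  show ?thesis
  proof (rule AE_eq_of_common_L2_limit[OF Jm _ _ int])
    show "wiener_integral a T \<sigma> \<sigma>' \<in> borel_measurable M" using \<sigma>' by measurable
    show "simple_integral_wrt B (n m) (\<tau> m) (\<xi> m) \<in> borel_measurable M" for m
    proof -
      have "0 \<le> \<tau> m i \<and> 0 \<le> \<tau> m (Suc i) \<and> \<xi> m i \<in> borel_measurable M" if "i < n m" for i
      proof -
        have "\<xi> m i \<in> borel_measurable (F (\<tau> m i))" using sp[of m] that by (auto simp: simple_process_def)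
        then show ?thesis
          using simple_process_times[OF sp[of m], of i "Suc i"] that a measurable_F_M by auto
      qed
      then show ?thesis
        unfolding simple_integral_wrt_def[abs_def]
        by (intro borel_measurable_sum borel_measurable_times borel_measurable_diff B_measurable) auto
    qed
    show "(\<lambda>m. \<integral>\<^sup>+\<omega>. ennreal ((simple_integral_wrt B (n m) (\<tau> m) (\<xi> m) \<omega> - wiener_integral a T \<sigma> \<sigma>' \<omega>)\<^sup>2) \<partial>M) \<longlonglongrightarrow> 0"
      unfolding simple_integral_distance[OF sp a \<sigma> \<sigma>'] by (rule val)
  qed
qed

end

section \<open>Pathwise comparison\<close>

text \<open>The total mass of an exponential distribution that starts at \<open>t\<close>.\<close>

lemma has_bochner_integral_exp_tail:
  fixes c t :: real
  assumes "0 < c"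
  shows "has_bochner_integral lborel (\<lambda>u. indicator {t..} u * (c * exp (- c * (u - t)))) 1"
proof -
  have lim: "((\<lambda>u. - exp (- c * (u - t))) \<longlongrightarrow> 0) at_top"
    using assms by real_asymp
  have "(\<integral>\<^sup>+u. ennreal (c * exp (- c * (u - t))) * indicator {t..} u \<partial>lborel)
      = ennreal (0 - (- exp (- c * (t - t))))"
    by (rule nn_integral_FTC_atLeast[OF _ _ _ lim])
      (use assms in \<open>auto intro!: derivative_eq_intros\<close>)
  moreover have "(\<integral>\<^sup>+u. ennreal (c * exp (- c * (u - t))) * indicator {t..} u \<partial>lborel)
      = (\<integral>\<^sup>+u. ennreal (indicator {t..} u * (c * exp (- c * (u - t)))) \<partial>lborel)"
    by (intro nn_integral_cong) (auto simp: indicator_def)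
  ultimately show ?thesis
    using assms by (intro has_bochner_integral_nn_integral) auto
qed

lemma integrable_exp_abs:
  fixes c :: real
  assumes "0 < c"
  shows "integrable lborel (\<lambda>x. exp (- c * \<bar>x\<bar>) * (1 + \<bar>x\<bar>)\<^sup>2)"
proof (rule Bochner_Integration.integrable_bound)
  let ?d = "c / 4"
  (* K absorbs the polynomial factor: 1 + x <= K exp (c x / 4) leaves half of the decay rate *)
  define K where "K = max 1 (1 / ?d)"
  have d: "0 < c / 2" using assms by simp
  have "(\<lambda>x. indicator {0..} x *\<^sub>R exp (- (c / 2) * \<bar>x\<bar>))
      = (\<lambda>x. 2 / c * (indicator {0..} x * (c / 2 * exp (- (c / 2) * (x - 0)))))"
    using assms by (auto simp: fun_eq_iff indicator_def)
  then have "has_bochner_integral lborel (\<lambda>x. indicator {0..} x *\<^sub>R exp (- (c / 2) * \<bar>x\<bar>)) (2 / c * 1)"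
    using has_bochner_integral_mult_right[OF has_bochner_integral_exp_tail[OF d, of 0], of "2 / c"] by metis
  from has_bochner_integral_even_function[OF this]
  have "integrable lborel (\<lambda>x. exp (- (c / 2) * \<bar>x\<bar>))" by (auto intro: integrable.intros)
  then show "integrable lborel (\<lambda>x. K\<^sup>2 * exp (- (c / 2) * \<bar>x\<bar>))" by simp
  show "AE x in lborel. norm (exp (- c * \<bar>x\<bar>) * (1 + \<bar>x\<bar>)\<^sup>2) \<le> norm (K\<^sup>2 * exp (- (c / 2) * \<bar>x\<bar>))"
  proof (rule AE_I2)
    fix x :: real
    have K: "1 \<le> K" "1 \<le> K * ?d" using assms by (auto simp: K_def field_simps max_def)
    have "1 + \<bar>x\<bar> \<le> K * 1 + (K * ?d) * \<bar>x\<bar>"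
      using K mult_right_mono[OF K(2) abs_ge_zero[of x]] by simp
    also have "\<dots> = K * (1 + ?d * \<bar>x\<bar>)" by (simp add: algebra_simps)
    also have "\<dots> \<le> K * exp (?d * \<bar>x\<bar>)"
      using K by (intro mult_left_mono exp_ge_add_one_self) auto
    finally have "(1 + \<bar>x\<bar>)\<^sup>2 \<le> (K * exp (?d * \<bar>x\<bar>))\<^sup>2" by (intro power_mono) auto
    also have "\<dots> = K\<^sup>2 * exp ((c / 2) * \<bar>x\<bar>)"
      by (simp add: power_mult_distrib exp_double[symmetric])
    finally have "exp (- c * \<bar>x\<bar>) * (1 + \<bar>x\<bar>)\<^sup>2 \<le> exp (- c * \<bar>x\<bar>) * (K\<^sup>2 * exp ((c / 2) * \<bar>x\<bar>))"
      by (rule mult_left_mono) simp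
    also have "\<dots> = K\<^sup>2 * exp (- (c / 2) * \<bar>x\<bar>)"
      by (simp add: exp_add[symmetric] mult.left_commute[of "exp _"]) 
    finally show "norm (exp (- c * \<bar>x\<bar>) * (1 + \<bar>x\<bar>)\<^sup>2) \<le> norm (K\<^sup>2 * exp (- (c / 2) * \<bar>x\<bar>))" by simp
  qed
qed simp

lemma kernel_exp_bound:
  fixes c :: real
  assumes "0 < c" and [measurable]: "h \<in> borel_measurable borel"
    and "\<And>u. \<bar>h u\<bar> \<le> A * exp (- c * \<bar>u - t\<bar>)"
  shows "kernel h"
  unfolding kernel_def
proof (rule Bochner_Integration.integrable_bound)
  have "integrable lborel (\<lambda>u. exp (- c * \<bar>u - t\<bar>) * (1 + \<bar>u - t\<bar>)\<^sup>2)"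
    using lborel_integrable_real_affine[OF integrable_exp_abs[OF assms(1)], of 1 "- t"] by simp
  then show "integrable lborel (\<lambda>u. A * (1 + \<bar>t\<bar>)\<^sup>2 * (exp (- c * \<bar>u - t\<bar>) * (1 + \<bar>u - t\<bar>)\<^sup>2))"
    by simp
  show "AE u in lborel. norm (h u * (1 + \<bar>u\<bar>)\<^sup>2)
      \<le> norm (A * (1 + \<bar>t\<bar>)\<^sup>2 * (exp (- c * \<bar>u - t\<bar>) * (1 + \<bar>u - t\<bar>)\<^sup>2))"
  proof (rule AE_I2)
    fix u
    have "\<bar>u\<bar> \<le> \<bar>t\<bar> + \<bar>u - t\<bar>" by linarith
    moreover have "0 \<le> \<bar>t\<bar> * \<bar>u - t\<bar>" by simp
    ultimately have "1 + \<bar>u\<bar> \<le> (1 + \<bar>t\<bar>) * (1 + \<bar>u - t\<bar>)"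
      unfolding distrib_left distrib_right by linarith
    then have "(1 + \<bar>u\<bar>)\<^sup>2 \<le> ((1 + \<bar>t\<bar>) * (1 + \<bar>u - t\<bar>))\<^sup>2" by (intro power_mono) auto
    then have "\<bar>h u\<bar> * (1 + \<bar>u\<bar>)\<^sup>2 \<le> (A * exp (- c * \<bar>u - t\<bar>)) * ((1 + \<bar>t\<bar>) * (1 + \<bar>u - t\<bar>))\<^sup>2"
      using assms(3)[of u] order_trans[OF abs_ge_zero assms(3)] by (intro mult_mono) auto
    also have "\<dots> = A * (1 + \<bar>t\<bar>)\<^sup>2 * (exp (- c * \<bar>u - t\<bar>) * (1 + \<bar>u - t\<bar>)\<^sup>2)"
      by (simp add: power_mult_distrib)
    also have "\<dots> \<le> norm \<dots>" by simp
    finally show "norm (h u * (1 + \<bar>u\<bar>)\<^sup>2)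
      \<le> norm (A * (1 + \<bar>t\<bar>)\<^sup>2 * (exp (- c * \<bar>u - t\<bar>) * (1 + \<bar>u - t\<bar>)\<^sup>2))"
      by (simp add: abs_mult)
  qed
qed measurable

text \<open>In the following comparison \<open>X - exp (- t / 2) w\<close> is the differentiable part of a solution that is driven by
  the path \<open>w\<close>: by parts, \<open>\<integral> exp (- s / 2) dw = exp (- t / 2) w + \<integral> exp (- s / 2) w / 2 ds\<close> up to a constant.\<close>

context
  fixes X w :: "real \<Rightarrow> real" and k m :: real
  assumes k: "0 \<le> k"
    and cont_X: "continuous_on {m..} X" and cont_w: "continuous_on {m..} w"
    and deriv: "\<And>t. m < t \<Longrightarrow>
      ((\<lambda>t. X t - exp (- t / 2) * w t) has_real_derivative (k * \<bar>X t\<bar> + exp (- t / 2) / 2 * w t)) (at t)"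
begin

text \<open>The derivative of \<open>exp (k t) (X - exp (- t / 2) w)\<close> is the derivative of the integral term plus
  \<open>exp (k t) k (\<bar>X\<bar> + X)\<close>, which is nonnegative.\<close>

lemma comparison_expanding:
  assumes "m \<le> t"
  shows "exp (k * m) * (X m - exp (- m / 2) * w m)
      - (k - 1 / 2) * (LINT u:{m..t}|lborel. exp ((k - 1 / 2) * u) * w u)
    \<le> exp (k * t) * (X t - exp (- t / 2) * w t)"
proof -
  let ?V = "\<lambda>t. X t - exp (- t / 2) * w t"
  let ?d = "\<lambda>u. exp (k * u) * (k * ?V u + (k * \<bar>X u\<bar> + exp (- u / 2) / 2 * w u))"
  have cX: "continuous_on {m..t} X" and cw: "continuous_on {m..t} w"
    using cont_X cont_w by (auto intro: continuous_on_subset)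
  have i: "set_integrable lborel {m..t} ?d"
    by (intro borel_integrable_atLeastAtMost' continuous_intros cX cw) auto
  have j: "set_integrable lborel {m..t} (\<lambda>u. - (k - 1 / 2) * (exp ((k - 1 / 2) * u) * w u))"
    by (intro borel_integrable_atLeastAtMost' continuous_intros cX cw) auto
  have "(LINT u:{m..t}|lborel. ?d u) = exp (k * t) * ?V t - exp (k * m) * ?V m"
  proof (rule integral_FTC_finite_exceptions[where S="{}", OF assms])
    fix x assume "x \<in> {m<..<t} - {}"
    then have x: "m < x" by simp
    have "((\<lambda>u. exp (k * u)) has_real_derivative k * exp (k * x)) (at x)"
      by (auto intro!: derivative_eq_intros)
    from DERIV_mult[OF this deriv[OF x]]
    show "((\<lambda>u. exp (k * u) * ?V u) has_real_derivative ?d x) (at x)"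
      by (rule DERIV_cong) (simp add: algebra_simps)
  qed (use i in \<open>auto intro!: continuous_intros cX cw\<close>)
  moreover have "(LINT u:{m..t}|lborel. - (k - 1 / 2) * (exp ((k - 1 / 2) * u) * w u)) \<le> (LINT u:{m..t}|lborel. ?d u)"
  proof (rule set_integral_mono[OF j i])
    fix u
    have e: "exp ((k - 1 / 2) * u) = exp (k * u) * exp (- u / 2)"
      by (simp add: exp_add[symmetric] algebra_simps)
    have "0 \<le> exp (k * u) * (k * (\<bar>X u\<bar> + X u))" using k by simp
    then show "- (k - 1 / 2) * (exp ((k - 1 / 2) * u) * w u) \<le> ?d u"
      unfolding e by (simp add: algebra_simps)
  qed
  moreover have "(LINT u:{m..t}|lborel. - (k - 1 / 2) * (exp ((k - 1 / 2) * u) * w u))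
      = - ((k - 1 / 2) * (LINT u:{m..t}|lborel. exp ((k - 1 / 2) * u) * w u))"
    by (simp only: set_integral_mult_right minus_mult_left)
  ultimately show ?thesis by linarith
qed

text \<open>The derivative of \<open>exp (- k t) (X - exp (- t / 2) w)\<close> is the derivative of the integral term plus
  \<open>exp (- k t) k (\<bar>X\<bar> - X)\<close>, which is nonnegative.\<close>

lemma comparison_contracting:
  assumes "m \<le> t" "t \<le> T"
  shows "(k + 1 / 2) * (LINT u:{t..T}|lborel. exp (- (k + 1 / 2) * u) * w u)
    \<le> exp (- k * T) * (X T - exp (- T / 2) * w T) - exp (- k * t) * (X t - exp (- t / 2) * w t)"
proof -
  let ?V = "\<lambda>t. X t - exp (- t / 2) * w t"
  let ?d = "\<lambda>u. exp (- k * u) * (- k * ?V u + (k * \<bar>X u\<bar> + exp (- u / 2) / 2 * w u))"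
  have cX: "continuous_on {t..T} X" and cw: "continuous_on {t..T} w"
    using cont_X cont_w assms by (auto intro: continuous_on_subset)
  have i: "set_integrable lborel {t..T} ?d"
    by (intro borel_integrable_atLeastAtMost' continuous_intros cX cw) auto
  have j: "set_integrable lborel {t..T} (\<lambda>u. (k + 1 / 2) * (exp (- (k + 1 / 2) * u) * w u))"
    by (intro borel_integrable_atLeastAtMost' continuous_intros cX cw) auto
  have "(LINT u:{t..T}|lborel. ?d u) = exp (- k * T) * ?V T - exp (- k * t) * ?V t"
  proof (rule integral_FTC_finite_exceptions[where S="{}", OF assms(2)])
    fix x assume "x \<in> {t<..<T} - {}"
    then have x: "m < x" using assms by simp
    have "((\<lambda>u. exp (- k * u)) has_real_derivative - k * exp (- k * x)) (at x)"
      by (auto intro!: derivative_eq_intros)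
    from DERIV_mult[OF this deriv[OF x]]
    show "((\<lambda>u. exp (- k * u) * ?V u) has_real_derivative ?d x) (at x)"
      by (rule DERIV_cong) (simp add: algebra_simps)
  qed (use i in \<open>auto intro!: continuous_intros cX cw\<close>)
  moreover have "(LINT u:{t..T}|lborel. (k + 1 / 2) * (exp (- (k + 1 / 2) * u) * w u)) \<le> (LINT u:{t..T}|lborel. ?d u)"
  proof (rule set_integral_mono[OF j i])
    fix u
    have e: "exp (- (k + 1 / 2) * u) = exp (- k * u) * exp (- u / 2)"
      by (simp add: exp_add[symmetric] algebra_simps)
    have "0 \<le> exp (- k * u) * (k * (\<bar>X u\<bar> - X u))" using k by simp
    then show "(k + 1 / 2) * (exp (- (k + 1 / 2) * u) * w u) \<le> ?d u"
      unfolding e by (simp add: algebra_simps)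
  qed
  ultimately show ?thesis by (simp add: set_integral_mult_right)
qed

end

text \<open>The weight of the path in the combined bound: an exponential average over the
  future of \<open>t\<close> minus an exponential average over the past back to \<open>m\<close>. Integrated by parts, it weighs
  the increments of the path positively on both sides of \<open>t\<close>.\<close>

definition escape_kernel :: "real \<Rightarrow> real \<Rightarrow> real \<Rightarrow> real \<Rightarrow> real" where
  "escape_kernel k m t u =
     indicator {t..} u * ((k + 1 / 2) * exp (- (k + 1 / 2) * (u - t)))
     - indicator {m..t} u * ((k - 1 / 2) * exp (- (k - 1 / 2) * (t - u)))"

lemma escape_kernel_measurable [measurable]: "escape_kernel k m t \<in> borel_measurable borel"
  unfolding escape_kernel_def[abs_def] by measurable

lemma escape_kernel_bound:
  assumes k: "1 / 2 < k"
  shows "\<bar>escape_kernel k m t u\<bar> \<le> (2 * k) * exp (- (k - 1 / 2) * \<bar>u - t\<bar>)"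
proof -
  have 1: "\<bar>indicator {t..} u * ((k + 1 / 2) * exp (- (k + 1 / 2) * (u - t)))\<bar>
      \<le> (k + 1 / 2) * exp (- (k - 1 / 2) * \<bar>u - t\<bar>)"
  proof (cases "t \<le> u")
    case True
    have "- (k + 1 / 2) * (u - t) \<le> - (k - 1 / 2) * (u - t)" using True by (intro mult_right_mono) auto
    then show ?thesis using k True by (simp add: abs_mult)
  qed (use k in simp)
  have 2: "\<bar>indicator {m..t} u * ((k - 1 / 2) * exp (- (k - 1 / 2) * (t - u)))\<bar>
      \<le> (k - 1 / 2) * exp (- (k - 1 / 2) * \<bar>u - t\<bar>)"
    using k by (auto simp: indicator_def abs_mult)
  have "\<bar>escape_kernel k m t u\<bar> \<le> (k + 1 / 2) * exp (- (k - 1 / 2) * \<bar>u - t\<bar>)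
      + (k - 1 / 2) * exp (- (k - 1 / 2) * \<bar>u - t\<bar>)"
    unfolding escape_kernel_def using 1 2 by linarith
  also have "\<dots> = (2 * k) * exp (- (k - 1 / 2) * \<bar>u - t\<bar>)"
    unfolding distrib_right[symmetric] by simp
  finally show ?thesis .
qed

lemma kernel_escape_kernel: "1 / 2 < k \<Longrightarrow> kernel (escape_kernel k m t)"
  by (rule kernel_exp_bound[OF _ escape_kernel_measurable escape_kernel_bound]) simp_all

lemma escape_kernel_vanishes: "m \<le> t \<Longrightarrow> u < m \<Longrightarrow> escape_kernel k m t u = 0"
  by (simp add: escape_kernel_def)

text \<open>The future part has mass \<open>1\<close> and the truncated past part falls short of mass \<open>1\<close> by the stated amount.\<close>

lemma escape_kernel_integral:
  assumes k: "1 / 2 < k" and mt: "m \<le> t"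
  shows "(LINT u|lborel. escape_kernel k m t u) = exp (- (k - 1 / 2) * (t - m))"
proof -
  let ?b = "k - 1 / 2" and ?a = "k + 1 / 2"
  have A: "has_bochner_integral lborel (\<lambda>u. indicator {t..} u * (?a * exp (- ?a * (u - t)))) 1"
    using k by (intro has_bochner_integral_exp_tail) simp
  have Bi: "set_integrable lborel {m..t} (\<lambda>u. ?b * exp (- ?b * (t - u)))"
    by (intro borel_integrable_atLeastAtMost' continuous_intros)
  have "(LINT u:{m..t}|lborel. ?b * exp (- ?b * (t - u))) = exp (- ?b * (t - t)) - exp (- ?b * (t - m))"
    by (rule integral_FTC_finite_exceptions[where S="{}", OF mt])
      (use Bi in \<open>auto intro!: continuous_intros derivative_eq_intros\<close>)
  then have "has_bochner_integral lborel (\<lambda>u. indicator {m..t} u * (?b * exp (- ?b * (t - u))))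
      (1 - exp (- ?b * (t - m)))"
    using Bi unfolding has_bochner_integral_iff set_integrable_def set_lebesgue_integral_def
    by (simp only: real_scaleR_def diff_self mult_zero_right exp_zero)
  from has_bochner_integral_integral_eq[OF has_bochner_integral_diff[OF A this]]
  show ?thesis unfolding escape_kernel_def by simp
qed

text \<open>The integral is the covariance of the escape functional with the increment over
  \<open>[t, t + 1]\<close>. The increment sees only the future part, which has mass \<open>exp (- (k + 1 / 2))\<close> after \<open>t + 1\<close>.\<close>

lemma escape_kernel_increment:
  assumes k: "1 / 2 < k" and mt: "m \<le> t"
  shows "exp (- (k + 1 / 2)) \<le> (LINT u|lborel. escape_kernel k m t u * (min (t + 1) u - min t u))"
proof -
  let ?a = "k + 1 / 2"
  have A: "has_bochner_integral lborel (\<lambda>u. exp (- ?a) * (indicator {t + 1..} u * (?a * exp (- ?a * (u - (t + 1)))))) (exp (- ?a) * 1)"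
    using k by (intro has_bochner_integral_mult_right has_bochner_integral_exp_tail) simp
  have "exp (- ?a) = (LINT u|lborel. exp (- ?a) * (indicator {t + 1..} u * (?a * exp (- ?a * (u - (t + 1))))))"
    using has_bochner_integral_integral_eq[OF A] by simp
  also have "\<dots> \<le> (LINT u|lborel. escape_kernel k m t u * (min (t + 1) u - min t u))"
  proof (rule integral_mono)
    show "integrable lborel (\<lambda>u. exp (- ?a) * (indicator {t + 1..} u * (?a * exp (- ?a * (u - (t + 1))))))"
      using A by (rule integrable.intros)
    show "integrable lborel (\<lambda>u. escape_kernel k m t u * (min (t + 1) u - min t u))"
    proof (rule kernel_dominated[OF kernel_escape_kernel[OF k], of _ 1])
      have "\<bar>min (t + 1) u - min t u\<bar> \<le> 1" for u by (auto simp: min_def)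
      then show "\<bar>min (t + 1) u - min t u\<bar> \<le> 1 * (1 + \<bar>u\<bar>)\<^sup>2" for u
        using order_trans[OF _ one_le_square_weight(1)[of u]] by simp
    qed measurable
    fix u
    have e: "exp (- c) * exp (- c * (u - (t + 1))) = exp (- c * (u - t))" for c :: real
      by (simp add: exp_add[symmetric] algebra_simps)
    consider "u \<le> t" | "t < u" "u < t + 1" | "t + 1 \<le> u" by linarith
    then show "exp (- ?a) * (indicator {t + 1..} u * (?a * exp (- ?a * (u - (t + 1)))))
        \<le> escape_kernel k m t u * (min (t + 1) u - min t u)"
    proof cases
      case 3
      then have "exp (- ?a) * (indicator {t + 1..} u * (?a * exp (- ?a * (u - (t + 1)))))
          = ?a * (exp (- ?a) * exp (- ?a * (u - (t + 1))))" by simp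
      also have "\<dots> = escape_kernel k m t u"
        unfolding e using 3 by (simp add: escape_kernel_def)
      finally show ?thesis using 3 by simp
    qed (use k in \<open>auto simp: escape_kernel_def\<close>)
  qed
  finally show ?thesis .
qed

text \<open>The contracting comparison on \<open>[t, T]\<close>, with \<open>T\<close> tending to infinity, bounds the future part by
  \<open>- exp (t / 2) (X t - exp (- t / 2) w t)\<close>; the expanding one on \<open>[m, t]\<close> bounds the past part by the same quantity with the
  opposite sign, up to the contribution of the initial value.\<close>

lemma escape_kernel_le:
  assumes k: "1 / 2 < k" and mt: "m \<le> t"
    and cont_X: "continuous_on {m..} X" and cont_w: "continuous_on UNIV w"
    and deriv: "\<And>t. m < t \<Longrightarrow>
      ((\<lambda>t. X t - exp (- t / 2) * w t) has_real_derivative (k * \<bar>X t\<bar> + exp (- t / 2) / 2 * w t)) (at t)"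
    and growth: "\<And>u. \<bar>w u\<bar> \<le> C * (1 + \<bar>u\<bar>)" and X0: "(X \<longlongrightarrow> 0) at_top"
  shows "(LINT u|lborel. escape_kernel k m t u * w u)
    \<le> - (exp (k * m) * (X m - exp (- m / 2) * w m)) * exp (- (k - 1 / 2) * t)"
proof -
  let ?V = "\<lambda>t. X t - exp (- t / 2) * w t" and ?a = "k + 1 / 2" and ?b = "k - 1 / 2"
  have k0: "0 \<le> k" using k by simp
  have cont_w': "continuous_on {m..} w" using cont_w continuous_on_subset by blast
  note cmp = k0 cont_X cont_w' deriv
  have wm [measurable]: "w \<in> borel_measurable borel" using cont_w by (rule borel_measurable_continuous_onI)
  have wb: "\<bar>w u\<bar> \<le> C * (1 + \<bar>u\<bar>)\<^sup>2" for u
  proof -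
    have "0 \<le> C" using order_trans[OF abs_ge_zero growth[of 0]] by simp
    moreover have "(1 + \<bar>u\<bar>) \<le> (1 + \<bar>u\<bar>)\<^sup>2" by (simp add: power2_eq_square algebra_simps)
    ultimately show ?thesis using order_trans[OF growth[of u] mult_left_mono] by blast
  qed
  have kf: "kernel (\<lambda>u. indicator {t..} u * exp (- ?a * u))"
  proof (rule kernel_exp_bound[where c="?a" and A="exp (- ?a * t)" and t=t])
    show "\<bar>indicator {t..} u * exp (- ?a * u)\<bar> \<le> exp (- ?a * t) * exp (- ?a * \<bar>u - t\<bar>)" for u
    proof -
      have "exp (- c * u) = exp (- c * t) * exp (- c * (u - t))" for c :: real
        by (simp add: exp_add[symmetric] algebra_simps)
      from this[of ?a] show ?thesis by (auto simp: indicator_def)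
    qed
  qed (use k in auto)
  have int_f: "set_integrable lborel {t..} (\<lambda>u. exp (- ?a * u) * w u)"
    using kernel_dominated[OF kf wm wb] by (simp add: set_integrable_def mult.assoc)
  have "?a * (LINT u:{t..}|lborel. exp (- ?a * u) * w u) \<le> 0 - exp (- k * t) * ?V t"
  proof (rule tendsto_le[OF trivial_limit_at_top_linorder])
    show "((\<lambda>T. ?a * (LINT u:{t..T}|lborel. exp (- ?a * u) * w u))
        \<longlongrightarrow> ?a * (LINT u:{t..}|lborel. exp (- ?a * u) * w u)) at_top"
      by (intro tendsto_mult_left tendsto_set_lebesgue_integral_at_top int_f) simp
    have e0: "((\<lambda>T. exp (- k * T)) \<longlongrightarrow> 0) at_top" using k by real_asymp
    have w0: "((\<lambda>T. exp (- T / 2) * w T) \<longlongrightarrow> 0) at_top"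
    proof (rule Lim_null_comparison)
      show "\<forall>\<^sub>F T in at_top. norm (exp (- T / 2) * w T) \<le> exp (- T / 2) * (C * (1 + \<bar>T\<bar>))"
        using growth by (intro always_eventually) (auto simp: abs_mult)
      show "((\<lambda>T. exp (- T / 2) * (C * (1 + \<bar>T\<bar>))) \<longlongrightarrow> 0) at_top" by real_asymp
    qed
    have "((\<lambda>T. exp (- k * T) * ?V T) \<longlongrightarrow> 0 * (0 - 0)) at_top"
      by (intro tendsto_mult e0 tendsto_diff X0 w0)
    then show "((\<lambda>T. exp (- k * T) * ?V T - exp (- k * t) * ?V t) \<longlongrightarrow> 0 - exp (- k * t) * ?V t) at_top"
      by (intro tendsto_diff tendsto_const) simp
    show "\<forall>\<^sub>F T in at_top. ?a * (LINT u:{t..T}|lborel. exp (- ?a * u) * w u)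
        \<le> exp (- k * T) * ?V T - exp (- k * t) * ?V t"
      using eventually_ge_at_top[of t]
      by eventually_elim (rule comparison_contracting[OF cmp mt])
  qed
  then have future: "exp (?a * t) * (?a * (LINT u:{t..}|lborel. exp (- ?a * u) * w u))
      \<le> exp (?a * t) * (- (exp (- k * t) * ?V t))"
    by (intro mult_left_mono) auto
  have past: "exp (- ?b * t) * (exp (k * m) * ?V m - ?b * (LINT u:{m..t}|lborel. exp (?b * u) * w u))
      \<le> exp (- ?b * t) * (exp (k * t) * ?V t)"
    using comparison_expanding[OF cmp mt] by (intro mult_left_mono) auto
  have e1: "exp (?a * t) * exp (- k * t) = exp (- ?b * t) * exp (k * t)"
    by (simp add: exp_add[symmetric] algebra_simps)
  have int_p: "set_integrable lborel {m..t} (\<lambda>u. exp (?b * u) * w u)"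
    by (intro borel_integrable_atLeastAtMost' continuous_intros continuous_on_subset[OF cont_w]) auto
  have "escape_kernel k m t u * w u
      = exp (?a * t) * ?a * (indicator {t..} u *\<^sub>R (exp (- ?a * u) * w u))
        - exp (- ?b * t) * ?b * (indicator {m..t} u *\<^sub>R (exp (?b * u) * w u))" for u
  proof -
    have 1: "exp (- c * (u - t)) = exp (c * t) * exp (- c * u)"
      and 2: "exp (- c * (t - u)) = exp (- c * t) * exp (c * u)" for c :: real
      by (simp_all add: exp_add[symmetric] algebra_simps)
    show ?thesis unfolding escape_kernel_def 1[of ?a] 2[of ?b]
      by (simp only: real_scaleR_def left_diff_distrib[of _ _ "w u"]) (simp only: mult_ac)
  qed
  then have "(LINT u|lborel. escape_kernel k m t u * w u)
      = exp (?a * t) * ?a * (LINT u:{t..}|lborel. exp (- ?a * u) * w u)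
        - exp (- ?b * t) * ?b * (LINT u:{m..t}|lborel. exp (?b * u) * w u)"
    using int_f int_p unfolding set_integrable_def set_lebesgue_integral_def by simp
  also have "\<dots> \<le> - (exp (- ?b * t) * (exp (k * t) * ?V t))
      - exp (- ?b * t) * ?b * (LINT u:{m..t}|lborel. exp (?b * u) * w u)"
  proof -
    have "exp (?a * t) * (- (exp (- k * t) * ?V t)) = - (exp (- ?b * t) * (exp (k * t) * ?V t))"
      using e1 by (metis mult.assoc mult_minus_right)
    with future have "exp (?a * t) * ?a * (LINT u:{t..}|lborel. exp (- ?a * u) * w u)
        \<le> - (exp (- ?b * t) * (exp (k * t) * ?V t))"
      by (simp only: mult.assoc)
    then show ?thesis by (rule diff_right_mono)
  qed
  also have "\<dots> \<le> - (exp (k * m) * ?V m) * exp (- ?b * t)"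
    using past by (simp add: algebra_simps)
  finally show ?thesis .
qed

lemma mono_at_top_dichotomy:
  fixes f :: "real \<Rightarrow> real"
  assumes mono: "\<And>s t. c \<le> s \<Longrightarrow> s \<le> t \<Longrightarrow> f s \<le> f t"
  shows "filterlim f at_top at_top \<or> (\<exists>L. (f \<longlongrightarrow> L) at_top)"
proof (cases "bdd_above (f ` {c..})")
  case True
  have "(f \<longlongrightarrow> (SUP t\<in>{c..}. f t)) at_top"
  proof (rule order_tendstoI)
    fix y assume "y < (SUP t\<in>{c..}. f t)"
    then obtain s where s: "c \<le> s" "y < f s"
      using less_cSUP_iff[OF _ True, of y] by auto
    show "\<forall>\<^sub>F t in at_top. y < f t"
      using eventually_ge_at_top[of s] by eventually_elim (use mono[OF s(1)] s(2) in fastforce)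
  next
    fix y assume y: "(SUP t\<in>{c..}. f t) < y"
    show "\<forall>\<^sub>F t in at_top. f t < y"
      using eventually_ge_at_top[of c]
      by eventually_elim (use cSUP_upper[OF _ True] y in fastforce)
  qed
  then show ?thesis by blast
next
  case False
  have "filterlim f at_top at_top"
    unfolding filterlim_at_top
  proof
    fix Z
    from False obtain s where s: "c \<le> s" "Z < f s"
      unfolding bdd_above_def by (auto simp: not_le)
    show "\<forall>\<^sub>F t in at_top. Z \<le> f t"
      using eventually_ge_at_top[of s] by eventually_elim (use mono[OF s(1)] s(2) in fastforce)
  qed
  then show ?thesis by blast
qed

text \<open>The integral of \<open>\<bar>X\<bar>\<close> is monotone. If it is unbounded then \<open>X\<close> tends to infinity, otherwise \<open>X\<close>
  converges, and only the limit \<open>0\<close> is compatible with a bounded integral.\<close>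

lemma tendsto_infinity_or_zero:
  fixes X R :: "real \<Rightarrow> real"
  assumes k: "0 < k" and cont: "continuous_on {c..} X"
    and eq: "\<And>t. c \<le> t \<Longrightarrow> X t = x0 + k * (LINT s:{c..t}|lborel. \<bar>X s\<bar>) + R t"
    and R: "(R \<longlongrightarrow> r) at_top"
  shows "filterlim X at_top at_top \<or> (X \<longlongrightarrow> 0) at_top"
proof -
  let ?I = "\<lambda>t. LINT s:{c..t}|lborel. \<bar>X s\<bar>"
  have i: "set_integrable lborel {s..t} (\<lambda>s. \<bar>X s\<bar>)" if "c \<le> s" for s t
    by (intro borel_integrable_atLeastAtMost' continuous_intros continuous_on_subset[OF cont])
      (use that in auto)
  have split: "?I t = ?I s + (LINT u:{s..t}|lborel. \<bar>X u\<bar>)" if "c \<le> s" "s \<le> t" for s t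
  proof -
    have "?I t = (LINT u:{c..s} \<union> {s..t}|lborel. \<bar>X u\<bar>)"
      using that by (simp add: ivl_disj_un_two_touch)
    also have "\<dots> = ?I s + (LINT u:{s..t}|lborel. \<bar>X u\<bar>)"
    proof (rule set_integral_Un_AE)
      show "AE x in lborel. \<not> (x \<in> {c..s} \<and> x \<in> {s..t})"
        using AE_lborel_singleton[of s] by eventually_elim auto
    qed (use i that in auto)
    finally show ?thesis .
  qed
  have mono: "?I s \<le> ?I t" if "c \<le> s" "s \<le> t" for s t
    using split[OF that] by (simp add: set_lebesgue_integral_def integral_nonneg_AE)
  have ev: "\<forall>\<^sub>F t in at_top. (x0 + R t) + k * ?I t = X t"
    using eventually_ge_at_top[of c] by eventually_elim (use eq in auto)
  have R': "((\<lambda>t. x0 + R t) \<longlongrightarrow> x0 + r) at_top" by (intro tendsto_intros R)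
  from mono_at_top_dichotomy[of c ?I, OF mono] show ?thesis
  proof
    assume "filterlim ?I at_top at_top"
    then have "filterlim (\<lambda>t. k * ?I t) at_top at_top"
      using k by (intro filterlim_tendsto_pos_mult_at_top[OF tendsto_const])
    from filterlim_tendsto_add_at_top[OF R' this]
    have "filterlim X at_top at_top"
      using ev by (rule filterlim_cong[THEN iffD1, rotated -2, OF _ _ refl refl, rotated])
    then show ?thesis ..
  next
    assume "\<exists>L. (?I \<longlongrightarrow> L) at_top"
    then obtain L where L: "(?I \<longlongrightarrow> L) at_top" by blast
    define l where "l = (x0 + r) + k * L"
    have "((\<lambda>t. (x0 + R t) + k * ?I t) \<longlongrightarrow> l) at_top"
      unfolding l_def by (intro tendsto_intros R' L)
    then have Xl: "(X \<longlongrightarrow> l) at_top" using ev by (rule Lim_transform_eventually)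
    have "l = 0"
    proof (rule ccontr)
      assume "l \<noteq> 0"
      then have "\<forall>\<^sub>F t in at_top. \<bar>l\<bar> / 2 < \<bar>X t\<bar>"
        using order_tendstoD(1)[OF tendsto_rabs[OF Xl], of "\<bar>l\<bar> / 2"] by simp
      then obtain s where s: "\<And>t. s \<le> t \<Longrightarrow> \<bar>l\<bar> / 2 < \<bar>X t\<bar>"
        by (auto simp: eventually_at_top_linorder)
      define s' where "s' = max s c"
      have "\<forall>\<^sub>F t in at_top. ?I s' + (\<bar>l\<bar> / 2) * (t - s') \<le> ?I t"
        using eventually_ge_at_top[of s']
      proof eventually_elim
        case (elim t)
        have "(\<bar>l\<bar> / 2) * (t - s') = (LINT u:{s'..t}|lborel. \<bar>l\<bar> / 2)" using elim by (simp add: set_lebesgue_integral_def)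
        also have "\<dots> \<le> (LINT u:{s'..t}|lborel. \<bar>X u\<bar>)"
        proof (rule set_integral_mono)
          show "\<bar>l\<bar> / 2 \<le> \<bar>X u\<bar>" if "u \<in> {s'..t}" for u
            using s[of u] that by (simp add: s'_def)
        qed (use i[of s' t] in \<open>auto simp: s'_def intro!: borel_integrable_atLeastAtMost'\<close>)
        finally show ?case using split[of s' t] elim by (simp add: s'_def)
      qed
      moreover have "filterlim (\<lambda>t. ?I s' + (\<bar>l\<bar> / 2) * (t - s')) at_top at_top"
      proof -
        have "filterlim (\<lambda>t. A + b * (t - s')) at_top at_top" if "0 < b" for A b :: real
          using that by real_asymp
        note lin = this
        show ?thesis by (rule lin) (use \<open>l \<noteq> 0\<close> in simp)
      qed
      ultimately have "filterlim ?I at_top at_top"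
        by (rule filterlim_at_top_mono[rotated])
      with L show False
        using not_tendsto_and_filterlim_at_infinity[OF trivial_limit_at_top_linorder L]
          filterlim_at_top_imp_at_infinity by blast
    qed
    with Xl show ?thesis by simp
  qed
qed

section \<open>No confinement near the unstable point\<close>

context brownian_motion
begin

definition escape_functional :: "real \<Rightarrow> real \<Rightarrow> real \<Rightarrow> 'a \<Rightarrow> real" where
  "escape_functional k m t \<omega> = (LINT u|lborel. escape_kernel k m t u * (W u \<omega> - W m \<omega>))"

lemma escape_functional_eq:
  assumes "1 / 2 < k" "m \<le> t"
  shows "escape_functional k m t \<omega>
    = (LINT u|lborel. escape_kernel k m t u * W u \<omega>) - exp (- (k - 1 / 2) * (t - m)) * W m \<omega>"
proof -
  note h = kernel_escape_kernel[OF assms(1), of m t]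
  show ?thesis
    unfolding escape_functional_def escape_kernel_integral[OF assms, symmetric]
    using kernel_W(1)[OF h] kernel_integrable[OF h]
    by (simp only: right_diff_distrib Bochner_Integration.integral_diff integrable_mult_left integral_mult_left_zero)
qed

lemma escape_functional_measurable [measurable]: "escape_functional k m t \<in> borel_measurable M"
  unfolding escape_functional_def[abs_def] by measurable

text \<open>The reference time is moved from \<open>m\<close> to \<open>t\<close>, where the kernel is concentrated. This
  costs \<open>exp (- b (t - m)) (W t - W m)\<close> with \<open>b = k - 1/2\<close>, whose variance is bounded because \<open>b > 0\<close>.\<close>

lemma escape_functional_second_moment:
  assumes k: "1 / 2 < k"
  obtains C where "\<And>m t. 0 \<le> m \<Longrightarrow> m \<le> t \<Longrightarrow> integrable M (\<lambda>\<omega>. (escape_functional k m t \<omega>)\<^sup>2)"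
    and "\<And>m t. 0 \<le> m \<Longrightarrow> m \<le> t \<Longrightarrow> expectation (\<lambda>\<omega>. (escape_functional k m t \<omega>)\<^sup>2) \<le> C"
proof -
  let ?b = "k - 1 / 2"
  let ?g = "\<lambda>x::real. 2 * k * (exp (- ?b * \<bar>x\<bar>) * (1 + \<bar>x\<bar>)\<^sup>2)"
  have b: "0 < ?b" using k by simp
  have gi: "integrable lborel ?g" using integrable_exp_abs[OF b] by simp
  define C where "C = integral\<^sup>L lborel ?g"
  have C0: "0 \<le> C" unfolding C_def using k by (intro integral_nonneg_AE AE_I2) simp
  have shift: "integrable lborel (\<lambda>u. ?g (u - t))" "(LINT u|lborel. ?g (u - t)) = C" for t
  proof -
    show "integrable lborel (\<lambda>u. ?g (u - t))"
      using lborel_integrable_real_affine[OF gi, of 1 "- t"] by simp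
    show "(LINT u|lborel. ?g (u - t)) = C"
      unfolding C_def by (subst lborel_integral_real_affine[of 1 ?g "- t"]) simp_all
  qed
  have *: "integrable M (\<lambda>\<omega>. (escape_functional k m t \<omega>)\<^sup>2) \<and>
      expectation (\<lambda>\<omega>. (escape_functional k m t \<omega>)\<^sup>2) \<le> 2 * (C * C) + 2 * (1 / (2 * ?b))"
    if m: "0 \<le> m" "m \<le> t" for m t
  proof -
    let ?h = "escape_kernel k m t" and ?c = "exp (- ?b * (t - m))"
    have t: "0 \<le> t" using m by simp
    note h = kernel_escape_kernel[OF k, of m t]
    let ?Z = "\<lambda>\<omega>. LINT u|lborel. ?h u * (W u \<omega> - W t \<omega>)"
    have eq: "escape_functional k m t \<omega> = ?Z \<omega> + ?c * (W t \<omega> - W m \<omega>)" for \<omega>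
    proof -
      have "?Z \<omega> = (LINT u|lborel. ?h u * W u \<omega>) - ?c * W t \<omega>"
        unfolding escape_kernel_integral[OF k m(2), symmetric]
        using kernel_W(1)[OF h] kernel_integrable[OF h]
        by (simp only: right_diff_distrib Bochner_Integration.integral_diff integrable_mult_left integral_mult_left_zero)
      then show ?thesis by (simp add: escape_functional_eq[OF k m(2)] algebra_simps)
    qed
    have hb: "\<bar>?h u\<bar> \<le> ?g (u - t)" "\<bar>?h u\<bar> * \<bar>u - t\<bar> \<le> ?g (u - t)" for u
    proof -
      let ?e = "2 * k * exp (- ?b * \<bar>u - t\<bar>)"
      have "\<bar>?h u\<bar> * 1 \<le> ?e * (1 + \<bar>u - t\<bar>)\<^sup>2"
        using escape_kernel_bound[OF k, of m t u] one_le_square_weight(1)[of "u - t"] k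
        by (intro mult_mono) auto
      then show "\<bar>?h u\<bar> \<le> ?g (u - t)" by (simp add: mult_ac)
      have "\<bar>?h u\<bar> * \<bar>u - t\<bar> \<le> ?e * (1 + \<bar>u - t\<bar>)\<^sup>2"
        using escape_kernel_bound[OF k, of m t u] one_le_square_weight(2)[of "u - t"] k
        by (intro mult_mono) auto
      then show "\<bar>?h u\<bar> * \<bar>u - t\<bar> \<le> ?g (u - t)" by (simp add: mult_ac)
    qed
    have H: "(LINT u|lborel. \<bar>?h u\<bar>) \<le> C"
      using kernel_integrable[OF h] unfolding shift(2)[of t, symmetric]
      by (intro integral_mono shift(1) hb) simp
    have "integrable lborel (\<lambda>u. \<bar>?h u\<bar> * \<bar>u - t\<bar>)"
    proof (rule Bochner_Integration.integrable_bound[OF shift(1)[of t]])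
      show "AE u in lborel. norm (\<bar>?h u\<bar> * \<bar>u - t\<bar>) \<le> norm (?g (u - t))"
        using hb(2) k by (intro AE_I2) (simp add: abs_mult)
    qed measurable
    then have H': "(LINT u|lborel. \<bar>?h u\<bar> * \<bar>u - t\<bar>) \<le> C"
      unfolding shift(2)[of t, symmetric] by (intro integral_mono shift(1) hb)
    have "expectation (\<lambda>\<omega>. (?Z \<omega>)\<^sup>2) \<le> (LINT u|lborel. \<bar>?h u\<bar>) * (LINT u|lborel. \<bar>?h u\<bar> * \<bar>u - t\<bar>)"
      by (rule kernel_W_second_moment(2)[OF h t])
    also have "\<dots> \<le> C * C"
      by (intro mult_mono H H' C0 integral_nonneg_AE AE_I2) auto
    finally have Z: "expectation (\<lambda>\<omega>. (?Z \<omega>)\<^sup>2) \<le> C * C" .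
    note Zi = kernel_W_second_moment(1)[OF h t]
    note Wi = W_increment_moments[OF m(1), of t]
    have Zm [measurable]: "?Z \<in> borel_measurable M" by measurable
    have sq: "(x + y)\<^sup>2 \<le> 2 * x\<^sup>2 + 2 * y\<^sup>2" for x y :: real
      using zero_le_power2[of "x - y"] by (simp add: power2_eq_square algebra_simps)
    have bi: "integrable M (\<lambda>\<omega>. 2 * (?Z \<omega>)\<^sup>2 + 2 * (?c * (W t \<omega> - W m \<omega>))\<^sup>2)"
      using Zi Wi(1) by (simp add: power_mult_distrib)
    have int: "integrable M (\<lambda>\<omega>. (escape_functional k m t \<omega>)\<^sup>2)"
    proof (rule Bochner_Integration.integrable_bound[OF bi])
      show "AE \<omega> in M. norm ((escape_functional k m t \<omega>)\<^sup>2) \<le> norm (2 * (?Z \<omega>)\<^sup>2 + 2 * (?c * (W t \<omega> - W m \<omega>))\<^sup>2)"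
        unfolding eq using order_trans[OF sq abs_ge_self] by (intro AE_I2) simp
    qed measurable
    have "expectation (\<lambda>\<omega>. (escape_functional k m t \<omega>)\<^sup>2)
        \<le> expectation (\<lambda>\<omega>. 2 * (?Z \<omega>)\<^sup>2 + 2 * (?c * (W t \<omega> - W m \<omega>))\<^sup>2)"
      using int bi by (rule integral_mono) (simp only: eq sq)
    also have "\<dots> = 2 * expectation (\<lambda>\<omega>. (?Z \<omega>)\<^sup>2) + 2 * (?c\<^sup>2 * expectation (\<lambda>\<omega>. (W t \<omega> - W m \<omega>)\<^sup>2))"
      using Zi Wi(1) by (simp add: power_mult_distrib)
    also have "\<dots> \<le> 2 * (C * C) + 2 * (?c\<^sup>2 * (t - m))"
      using Z Wi(2) m by (intro add_mono mult_left_mono) auto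
    also have "?c\<^sup>2 * (t - m) \<le> 1 / (2 * ?b)"
    proof -
      have "(exp (- c * x))\<^sup>2 = exp (- (2 * c * x))" for c x :: real
        by (simp add: exp_double[symmetric])
      from this[of ?b "t - m"] have c2: "?c\<^sup>2 = exp (- (2 * ?b * (t - m)))" .
      have "2 * ?b * (t - m) \<le> exp (2 * ?b * (t - m))"
        using exp_ge_add_one_self[of "2 * ?b * (t - m)"] by linarith
      then have "?c\<^sup>2 * (2 * ?b * (t - m)) \<le> ?c\<^sup>2 * exp (2 * ?b * (t - m))"
        by (intro mult_left_mono) auto
      also have "\<dots> = 1" unfolding c2 by (simp only: exp_add[symmetric] add.left_inverse exp_zero)
      finally have "(?c\<^sup>2 * (t - m)) * (2 * ?b) \<le> 1" by (simp only: mult_ac)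
      then show ?thesis using b by (subst pos_le_divide_eq) auto
    qed
    finally have "expectation (\<lambda>\<omega>. (escape_functional k m t \<omega>)\<^sup>2) \<le> 2 * (C * C) + 2 * (1 / (2 * ?b))"
      by simp
    with int show ?thesis by (rule conjI)
  qed
  then show thesis by (intro that[of "2 * (C * C) + 2 * (1 / (2 * ?b))"]) auto
qed

text \<open>Let \<open>G\<close> be the escape functional and \<open>D = B (t + 1) - B t\<close>. The covariance bound gives
  \<open>exp (- (k + 1 / 2)) P(E) \<le> E (\<bar>G\<bar> \<bar>D\<bar>; E)\<close>. Here \<open>\<bar>D\<bar> \<le> L + D\<^sup>2 / L\<close> truncates the increment, at the cost of
  \<open>E (\<bar>G\<bar> D\<^sup>2) / L\<close>, which second and fourth moments control. Since \<open>G\<close> has mean zero on \<open>E\<close>, the mean of \<open>\<bar>G\<bar>\<close>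
  is twice that of the positive part.\<close>

lemma escape_functional_lower_bound:
  assumes k: "1 / 2 < k" and m: "0 \<le> m" "m \<le> t" and E: "E \<in> sets (F m)" and L: "0 < L"
    and G2: "integrable M (\<lambda>\<omega>. (escape_functional k m t \<omega>)\<^sup>2)"
      "expectation (\<lambda>\<omega>. (escape_functional k m t \<omega>)\<^sup>2) \<le> C"
  shows "exp (- (k + 1 / 2)) * prob E
    \<le> 2 * L * expectation (\<lambda>\<omega>. indicator E \<omega> * max 0 (escape_functional k m t \<omega>)) + (C + 3) / (2 * L)"
proof -
  let ?G = "escape_functional k m t" and ?h = "escape_kernel k m t" and ?c = "exp (- (k - 1 / 2) * (t - m))"
  let ?\<eta> = "indicator E :: 'a \<Rightarrow> real"
  let ?D = "\<lambda>\<omega>. B (t + 1) \<omega> - B t \<omega>"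
  have t: "0 \<le> t" "t \<le> t + 1" using m by auto
  have EM [measurable]: "E \<in> events" using E subalgebra_F[of m] by (auto simp: subalgebra_def)
  have [measurable]: "B t \<in> borel_measurable M" "B (t + 1) \<in> borel_measurable M" using t by auto
  have \<eta>: "?\<eta> \<in> borel_measurable (F m)" "?\<eta> \<in> borel_measurable (F t)"
    using E measurable_F_mono[OF m(2), of ?\<eta>] by auto
  have \<eta>1: "\<bar>?\<eta> \<omega>\<bar> \<le> 1" for \<omega> by (simp add: indicator_def)
  have E\<eta>: "expectation ?\<eta> = prob E" by simp
  note h = kernel_escape_kernel[OF k, of m t]
  have h0: "?h u = 0" if "u < 0" for u using that m by (intro escape_kernel_vanishes) auto
  note cov = bounded_past_kernel_covariance[OF h h0 t \<eta>(2) \<eta>1]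
  note covm = bounded_past_covariance_W[OF t m(1) \<eta>(2) \<eta>1]
  have GD: "integrable M (\<lambda>\<omega>. ?\<eta> \<omega> * ?D \<omega> * ?G \<omega>)"
    and EGD: "expectation (\<lambda>\<omega>. ?\<eta> \<omega> * ?D \<omega> * ?G \<omega>)
      = prob E * (LINT u|lborel. ?h u * (min (t + 1) u - min t u))"
  proof -
    have eq: "?\<eta> \<omega> * ?D \<omega> * ?G \<omega> = ?\<eta> \<omega> * ?D \<omega> * (LINT u|lborel. ?h u * W u \<omega>)
        - ?c * (?\<eta> \<omega> * ?D \<omega> * W m \<omega>)" for \<omega>
      unfolding escape_functional_eq[OF k m(2)] by (simp only: right_diff_distrib mult.left_commute)
    show "integrable M (\<lambda>\<omega>. ?\<eta> \<omega> * ?D \<omega> * ?G \<omega>)"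
      unfolding eq using cov(1) covm(1) by (intro Bochner_Integration.integrable_diff integrable_mult_right)
    have zero: "expectation (\<lambda>\<omega>. ?\<eta> \<omega> * ?D \<omega> * W m \<omega>) = 0"
      using covm(2) m by simp
    have "expectation (\<lambda>\<omega>. ?\<eta> \<omega> * ?D \<omega> * ?G \<omega>)
      = expectation (\<lambda>\<omega>. ?\<eta> \<omega> * ?D \<omega> * (LINT u|lborel. ?h u * W u \<omega>))
        - expectation (\<lambda>\<omega>. ?c * (?\<eta> \<omega> * ?D \<omega> * W m \<omega>))"
      unfolding eq by (rule Bochner_Integration.integral_diff[OF cov(1) integrable_mult_right[OF covm(1)]])
    then show "expectation (\<lambda>\<omega>. ?\<eta> \<omega> * ?D \<omega> * ?G \<omega>)
      = prob E * (LINT u|lborel. ?h u * (min (t + 1) u - min t u))"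
      using zero cov(2) E\<eta> by simp
  qed
  have mean: "expectation (\<lambda>\<omega>. ?\<eta> \<omega> * ?G \<omega>) = 0"
    unfolding escape_functional_def
    by (rule bounded_past_kernel_mean[OF h _ m(1) \<eta>(1) \<eta>1]) (rule escape_kernel_vanishes[OF m(2)])
  have Gi: "integrable M ?G"
    using integrable_mult_of_squares[where M=M and f="?G" and g="\<lambda>_. 1"] G2(1) by simp
  have \<eta>Gi: "integrable M (\<lambda>\<omega>. ?\<eta> \<omega> * ?G \<omega>)" "integrable M (\<lambda>\<omega>. ?\<eta> \<omega> * max 0 (?G \<omega>))"
    "integrable M (\<lambda>\<omega>. ?\<eta> \<omega> * \<bar>?G \<omega>\<bar>)"
    using Gi by (auto intro!: bounded_times_integrable[where C=1] \<eta>1)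
  have abs: "expectation (\<lambda>\<omega>. ?\<eta> \<omega> * \<bar>?G \<omega>\<bar>) = 2 * expectation (\<lambda>\<omega>. ?\<eta> \<omega> * max 0 (?G \<omega>))"
  proof -
    have "expectation (\<lambda>\<omega>. ?\<eta> \<omega> * \<bar>?G \<omega>\<bar>) = expectation (\<lambda>\<omega>. 2 * (?\<eta> \<omega> * max 0 (?G \<omega>)) - ?\<eta> \<omega> * ?G \<omega>)"
      by (intro Bochner_Integration.integral_cong) (auto simp: max_def abs_if)
    also have "\<dots> = 2 * expectation (\<lambda>\<omega>. ?\<eta> \<omega> * max 0 (?G \<omega>))"
      using \<eta>Gi mean by (subst Bochner_Integration.integral_diff) auto
    finally show ?thesis .
  qed
  have D4: "integrable M (\<lambda>\<omega>. (?D \<omega>) ^ 4)" "expectation (\<lambda>\<omega>. (?D \<omega>) ^ 4) = 3"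
    using increment_moments(1)[OF t, of 4] increment_moments(4)[OF t] by auto
  have pt: "?\<eta> \<omega> * ?D \<omega> * ?G \<omega> \<le> L * (?\<eta> \<omega> * \<bar>?G \<omega>\<bar>) + ((?G \<omega>)\<^sup>2 + (?D \<omega>) ^ 4) / (2 * L)" for \<omega>
  proof -
    let ?g = "\<bar>?G \<omega>\<bar>" and ?d = "\<bar>?D \<omega>\<bar>"
    have "0 \<le> (?d - L)\<^sup>2" by simp
    then have "?d * L \<le> L\<^sup>2 + ?d\<^sup>2" using L mult_nonneg_nonneg[of ?d L] unfolding power2_diff by linarith
    then have d: "?d \<le> L + ?d\<^sup>2 / L" using L by (simp add: field_simps power2_eq_square)
    have g: "?g * ?d\<^sup>2 \<le> ((?G \<omega>)\<^sup>2 + (?D \<omega>) ^ 4) / 2"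
    proof -
      have "x * y\<^sup>2 \<le> (x\<^sup>2 + y ^ 4) / 2" for x y :: real
        using zero_le_power2[of "x - y\<^sup>2"] by (simp add: power2_diff power_mult[symmetric])
      from this[of ?g ?d] show ?thesis by simp
    qed
    have "?\<eta> \<omega> * ?D \<omega> * ?G \<omega> \<le> ?\<eta> \<omega> * (?g * ?d)"
      using abs_ge_self[of "?D \<omega> * ?G \<omega>"] by (auto simp: indicator_def abs_mult mult.commute)
    also have "\<dots> \<le> ?\<eta> \<omega> * (?g * (L + ?d\<^sup>2 / L))"
      using d by (intro mult_left_mono) auto
    also have "\<dots> = L * (?\<eta> \<omega> * ?g) + ?\<eta> \<omega> * (?g * ?d\<^sup>2) / L" by (simp add: algebra_simps)
    also have "\<dots> \<le> L * (?\<eta> \<omega> * ?g) + (((?G \<omega>)\<^sup>2 + (?D \<omega>) ^ 4) / 2) / L"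
    proof (intro add_left_mono divide_right_mono)
      show "?\<eta> \<omega> * (?g * ?d\<^sup>2) \<le> ((?G \<omega>)\<^sup>2 + (?D \<omega>) ^ 4) / 2"
        using g order_trans[OF _ g, of 0] by (auto simp: indicator_def)
    qed (use L in simp)
    finally show ?thesis by simp
  qed
  have "exp (- (k + 1 / 2)) * prob E \<le> prob E * (LINT u|lborel. ?h u * (min (t + 1) u - min t u))"
    using escape_kernel_increment[OF k m(2)] by (simp add: mult.commute[of _ "prob E"] mult_left_mono)
  also have "\<dots> = expectation (\<lambda>\<omega>. ?\<eta> \<omega> * ?D \<omega> * ?G \<omega>)" using EGD by simp
  also have "\<dots> \<le> expectation (\<lambda>\<omega>. L * (?\<eta> \<omega> * \<bar>?G \<omega>\<bar>) + ((?G \<omega>)\<^sup>2 + (?D \<omega>) ^ 4) / (2 * L))"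
    using GD \<eta>Gi D4(1) G2(1) by (intro integral_mono pt) auto
  also have "\<dots> = L * expectation (\<lambda>\<omega>. ?\<eta> \<omega> * \<bar>?G \<omega>\<bar>) + (expectation (\<lambda>\<omega>. (?G \<omega>)\<^sup>2) + 3) / (2 * L)"
    using \<eta>Gi D4 G2(1) by simp
  also have "\<dots> \<le> 2 * L * expectation (\<lambda>\<omega>. ?\<eta> \<omega> * max 0 (?G \<omega>)) + (C + 3) / (2 * L)"
    unfolding abs using G2(2) L by (intro add_mono divide_right_mono) auto
  finally show ?thesis .
qed

text \<open>On \<open>A m\<close> the mean of the positive part of \<open>G m n\<close> is split into its part on \<open>A'\<close> below a level
  \<open>K\<close>, which tends to \<open>0\<close> with \<open>n\<close> by dominated convergence, the part on \<open>A m - A'\<close> below \<open>K\<close>, which is small for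
  large \<open>m\<close>, and the part above \<open>K\<close>, which is \<open>O(1 / K)\<close> by the uniform second moment. The limits are
  taken in the order \<open>n\<close>, \<open>m\<close>, and then \<open>K = L\<^sup>2\<close> with \<open>L\<close> tending to infinity.\<close>

lemma prob_confinement_eq_0:
  assumes k: "1 / 2 < k"
    and A: "\<And>m. 1 \<le> m \<Longrightarrow> A m \<in> sets (F (real m))" and A': "A' \<in> events"
    and lim: "AE \<omega> in M. \<forall>\<^sub>F m in sequentially. \<omega> \<in> A m \<longleftrightarrow> \<omega> \<in> A'"
    and G: "\<And>m. 1 \<le> m \<Longrightarrow> AE \<omega> in M. \<omega> \<in> A' \<longrightarrow>
      (\<lambda>n. max 0 (escape_functional k (real m) (real n) \<omega>)) \<longlonglongrightarrow> 0"
  shows "prob A' = 0"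
proof -
  obtain C where C: "\<And>m t. 0 \<le> m \<Longrightarrow> m \<le> t \<Longrightarrow> integrable M (\<lambda>\<omega>. (escape_functional k m t \<omega>)\<^sup>2)"
    "\<And>m t. 0 \<le> m \<Longrightarrow> m \<le> t \<Longrightarrow> expectation (\<lambda>\<omega>. (escape_functional k m t \<omega>)\<^sup>2) \<le> C"
    using escape_functional_second_moment[OF k] by blast
  have [measurable]: "A m \<in> events" if "1 \<le> m" for m
    using A[OF that] subalgebra_F[of "real m"] by (auto simp: subalgebra_def)
  note [measurable] = A'
  let ?c = "exp (- (k + 1 / 2))"
  have step: "?c * prob (A m) \<le> 2 * L * (K * prob (A m - A') + C / K) + (C + 3) / (2 * L)"
    if m: "1 \<le> m" and K: "0 < K" and L: "0 < L" for m :: nat and K L :: real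
  proof -
    let ?G = "\<lambda>n. escape_functional k (real m) (real n)"
    let ?T = "\<lambda>n \<omega>. indicator A' \<omega> * min K (max 0 (?G n \<omega>)) :: real"
    have Am [measurable]: "A m \<in> events" using m by measurable
    have "(\<lambda>n. expectation (?T n)) \<longlonglongrightarrow> expectation (\<lambda>\<omega>. 0)"
    proof (rule integral_dominated_convergence[where w="\<lambda>_. K"])
      show "AE \<omega> in M. (\<lambda>n. ?T n \<omega>) \<longlonglongrightarrow> 0"
        using G[OF m]
      proof eventually_elim
        case (elim \<omega>)
        show ?case
        proof (cases "\<omega> \<in> A'")
          case True
          with elim have "(\<lambda>n. min K (max 0 (?G n \<omega>))) \<longlonglongrightarrow> min K 0"
            by (intro tendsto_min tendsto_const) auto
          then show ?thesis using True K by simp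
        qed simp
      qed
      show "AE \<omega> in M. norm (?T n \<omega>) \<le> K" for n
        using K by (intro AE_I2) (auto simp: indicator_def)
    qed measurable
    then have T0: "(\<lambda>n. expectation (?T n)) \<longlonglongrightarrow> 0" by simp
    have "?c * prob (A m) \<le> 2 * L * (expectation (?T n) + K * prob (A m - A') + C / K) + (C + 3) / (2 * L)"
      if n: "m \<le> n" for n
    proof -
      have mn: "0 \<le> real m" "real m \<le> real n" using n by auto
      note Cn = C[OF mn]
      have Gi: "integrable M (?G n)"
        using integrable_mult_of_squares[where M=M and f="?G n" and g="\<lambda>_. 1"] Cn(1) by simp
      have Ti: "integrable M (?T n)"
        by (rule integrable_const_bound[where B=K]) (use K in \<open>auto simp: indicator_def\<close>)
      have "expectation (\<lambda>\<omega>. indicator (A m) \<omega> * max 0 (?G n \<omega>))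
          \<le> expectation (\<lambda>\<omega>. ?T n \<omega> + K * indicator (A m - A') \<omega> + (?G n \<omega>)\<^sup>2 / K)"
      proof (rule integral_mono)
        show "integrable M (\<lambda>\<omega>. indicator (A m) \<omega> * max 0 (?G n \<omega>))"
          using Gi by (intro bounded_times_integrable[where C=1]) (auto simp: indicator_def)
        show "integrable M (\<lambda>\<omega>. ?T n \<omega> + K * indicator (A m - A') \<omega> + (?G n \<omega>)\<^sup>2 / K)"
          using Ti Cn(1)
          by (intro Bochner_Integration.integrable_add integrable_mult_right integrable_real_indicator
              integrable_divide) (auto simp: emeasure_eq_measure)
        fix \<omega>
        define g where "g = max 0 (?G n \<omega>)"
        have g: "0 \<le> g" "g\<^sup>2 \<le> (?G n \<omega>)\<^sup>2" by (auto simp: g_def max_def)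
        have "g \<le> min K g + g\<^sup>2 / K"
        proof (cases "g \<le> K")
          case False
          then have "g * K \<le> g * g" using g by (intro mult_left_mono) auto
          then have "g \<le> g\<^sup>2 / K" using K by (simp add: field_simps power2_eq_square)
          then show ?thesis using K g by simp
        qed (use K in simp)
        also have "\<dots> \<le> min K g + (?G n \<omega>)\<^sup>2 / K" using g K by (simp add: divide_right_mono)
        finally have *: "g \<le> min K g + (?G n \<omega>)\<^sup>2 / K" .
        define q where "q = (?G n \<omega>)\<^sup>2 / K"
        have q: "0 \<le> q" using K by (simp add: q_def)
        have "g \<le> K + q" "0 \<le> min K g + q" using * g K q unfolding q_def[symmetric] by auto
        with * show "indicator (A m) \<omega> * max 0 (?G n \<omega>)
            \<le> ?T n \<omega> + K * indicator (A m - A') \<omega> + (?G n \<omega>)\<^sup>2 / K"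
          unfolding g_def[symmetric] q_def[symmetric] using q by (simp add: indicator_def)
      qed
      also have "\<dots> = expectation (?T n) + K * prob (A m - A') + expectation (\<lambda>\<omega>. (?G n \<omega>)\<^sup>2) / K"
      proof -
        have "integrable M (\<lambda>\<omega>. K * indicator (A m - A') \<omega> :: real)"
          by (intro integrable_mult_right integrable_real_indicator) (auto simp: emeasure_eq_measure)
        then show ?thesis using Ti Cn(1) by simp
      qed
      also have "\<dots> \<le> expectation (?T n) + K * prob (A m - A') + C / K"
        using Cn(2) K by (intro add_left_mono divide_right_mono) auto
      finally have "2 * L * expectation (\<lambda>\<omega>. indicator (A m) \<omega> * max 0 (?G n \<omega>))
          \<le> 2 * L * (expectation (?T n) + K * prob (A m - A') + C / K)"
        using L by (intro mult_left_mono) auto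
      with escape_functional_lower_bound[OF k mn A[OF m] L Cn] show ?thesis by linarith
    qed
    moreover have "(\<lambda>n. 2 * L * (expectation (?T n) + K * prob (A m - A') + C / K) + (C + 3) / (2 * L))
        \<longlonglongrightarrow> 2 * L * (0 + K * prob (A m - A') + C / K) + (C + 3) / (2 * L)"
      by (intro tendsto_intros T0)
    ultimately show ?thesis by (intro LIMSEQ_le_const) auto
  qed
  have A1: "(\<lambda>m. prob (A (Suc m))) \<longlonglongrightarrow> prob A'" and A2: "(\<lambda>m. prob (A (Suc m) - A')) \<longlonglongrightarrow> 0"
  proof -
    have lim': "AE \<omega> in M. \<forall>\<^sub>F m in sequentially. \<omega> \<in> A (Suc m) \<longleftrightarrow> \<omega> \<in> A'"
      using lim by eventually_elim (simp add: eventually_sequentially_Suc[symmetric, of "\<lambda>m. _ \<in> A m \<longleftrightarrow> _"])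
    have [measurable]: "A (Suc m) \<in> events" for m by measurable
    have "(\<lambda>m. expectation (indicator (A (Suc m)) :: 'a \<Rightarrow> real)) \<longlonglongrightarrow> expectation (indicator A')"
    proof (rule integral_dominated_convergence[where w="\<lambda>_. 1"])
      show "AE \<omega> in M. (\<lambda>m. indicator (A (Suc m)) \<omega> :: real) \<longlonglongrightarrow> indicator A' \<omega>"
        using lim' by eventually_elim (intro tendsto_eventually, erule eventually_mono, simp add: indicator_def)
    qed (auto simp: indicator_def)
    then show "(\<lambda>m. prob (A (Suc m))) \<longlonglongrightarrow> prob A'" by simp
    have "(\<lambda>m. expectation (indicator (A (Suc m) - A') :: 'a \<Rightarrow> real)) \<longlonglongrightarrow> expectation (\<lambda>_. 0)"
    proof (rule integral_dominated_convergence[where w="\<lambda>_. 1"])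
      show "AE \<omega> in M. (\<lambda>m. indicator (A (Suc m) - A') \<omega> :: real) \<longlonglongrightarrow> 0"
        using lim' by eventually_elim (intro tendsto_eventually, erule eventually_mono, simp add: indicator_def)
    qed (auto simp: indicator_def)
    then show "(\<lambda>m. prob (A (Suc m) - A')) \<longlonglongrightarrow> 0" by simp
  qed
  have bound: "?c * prob A' \<le> (2 * C + (C + 3) / 2) / L" if L: "0 < L" for L
  proof -
    (* the level K = L^2 makes 2 L C / K vanish as L grows *)
    have "?c * prob A' \<le> 2 * L * (L\<^sup>2 * 0 + C / L\<^sup>2) + (C + 3) / (2 * L)"
    proof (rule LIMSEQ_le)
      show "(\<lambda>m. ?c * prob (A (Suc m))) \<longlonglongrightarrow> ?c * prob A'" by (intro tendsto_intros A1)
      show "(\<lambda>m. 2 * L * (L\<^sup>2 * prob (A (Suc m) - A') + C / L\<^sup>2) + (C + 3) / (2 * L))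
          \<longlonglongrightarrow> 2 * L * (L\<^sup>2 * 0 + C / L\<^sup>2) + (C + 3) / (2 * L)"
        by (intro tendsto_intros A2)
      show "\<exists>N. \<forall>m\<ge>N. ?c * prob (A (Suc m))
          \<le> 2 * L * (L\<^sup>2 * prob (A (Suc m) - A') + C / L\<^sup>2) + (C + 3) / (2 * L)"
        using step[of "Suc _" "L\<^sup>2" L] L by simp
    qed
    also have "\<dots> = (2 * C + (C + 3) / 2) / L" using L by (simp add: field_simps power2_eq_square)
    finally show ?thesis .
  qed
  have "(\<lambda>n. (2 * C + (C + 3) / 2) / real (Suc n)) \<longlonglongrightarrow> 0"
    by (rule LIMSEQ_Suc[OF lim_const_over_n])
  then have "?c * prob A' \<le> 0"
    using bound[OF of_nat_0_less_iff[THEN iffD2, OF zero_less_Suc]] by (intro LIMSEQ_le_const) auto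
  then show ?thesis
    using measure_nonneg[of M A'] by (simp add: mult_le_0_iff)
qed

end

section \<open>Solutions of the equation\<close>

context brownian_motion
begin

abbreviation noise :: "real \<Rightarrow> 'a \<Rightarrow> real" where
  "noise t \<equiv> wiener_integral 1 t (\<lambda>s. exp (- s / 2)) (\<lambda>s. - exp (- s / 2) / 2)"

lemma noise_eq:
  "noise t \<omega> = exp (- t / 2) * W t \<omega> - exp (- 1 / 2) * W 1 \<omega> + (LINT u:{1..t}|lborel. exp (- u / 2) / 2 * W u \<omega>)"
proof -
  have "(LINT u|lborel. indicator {1..t} u * (- exp (- u / 2) / 2) * W u \<omega>)
      = - (LINT u:{1..t}|lborel. exp (- u / 2) / 2 * W u \<omega>)"
    unfolding set_lebesgue_integral_def Bochner_Integration.integral_minus[symmetric]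
    by (intro Bochner_Integration.integral_cong) auto
  then show ?thesis unfolding wiener_integral_def by simp
qed

lemma noise_continuous: "continuous_on {1..t} (\<lambda>t. noise t \<omega>)"
  unfolding noise_eq
  by (intro continuous_intros W_continuous indefinite_integral_continuous) auto

lemma noise_convergent: "\<exists>r. ((\<lambda>t. noise t \<omega>) \<longlongrightarrow> r) at_top"
proof -
  obtain C where C: "0 \<le> C" "\<And>u. \<bar>W u \<omega>\<bar> \<le> C * (1 + \<bar>u\<bar>)" using W_growth by blast
  have "((\<lambda>t. exp (- t / 2) * W t \<omega>) \<longlongrightarrow> 0) at_top"
  proof (rule Lim_null_comparison)
    show "\<forall>\<^sub>F t in at_top. norm (exp (- t / 2) * W t \<omega>) \<le> exp (- t / 2) * (C * (1 + \<bar>t\<bar>))"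
      using C(2) by (intro always_eventually) (auto simp: abs_mult)
    show "((\<lambda>t. exp (- t / 2) * (C * (1 + \<bar>t\<bar>))) \<longlongrightarrow> 0) at_top" by real_asymp
  qed
  moreover have "set_integrable lborel {1..} (\<lambda>u. exp (- u / 2) / 2 * W u \<omega>)"
  proof -
    have "kernel (\<lambda>u. indicator {1..} u * (exp (- u / 2) / 2))"
    proof (rule kernel_exp_bound[where c="1 / 2" and A="1 / 2" and t=0])
      show "\<bar>indicator {1..} u * (exp (- u / 2) / 2)\<bar> \<le> 1 / 2 * exp (- (1 / 2) * \<bar>u - 0\<bar>)" for u :: real
        by (auto simp: indicator_def)
    qed auto
    from kernel_W(1)[OF this, of \<omega>] show ?thesis by (simp add: set_integrable_def mult.assoc)
  qed
  then have "((\<lambda>t. LINT u:{1..t}|lborel. exp (- u / 2) / 2 * W u \<omega>)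
      \<longlongrightarrow> (LINT u:{1..}|lborel. exp (- u / 2) / 2 * W u \<omega>)) at_top"
    by (intro tendsto_set_lebesgue_integral_at_top) auto
  ultimately have "((\<lambda>t. noise t \<omega>) \<longlongrightarrow>
      0 - exp (- 1 / 2) * W 1 \<omega> + (LINT u:{1..}|lborel. exp (- u / 2) / 2 * W u \<omega>)) at_top"
    unfolding noise_eq by (intro tendsto_intros)
  then show ?thesis by blast
qed

text \<open>In the second case \<open>escape_kernel_le\<close> is applied to the path restarted at \<open>m\<close>, that is, to \<open>w = W - W m\<close>.\<close>

lemma driven_path_alternative:
  assumes k: "1 / 2 < k" and cont: "continuous_on {1..} x"
    and eq: "\<And>t. 1 \<le> t \<Longrightarrow> x t = x 1 + k * (LINT s:{1..t}|lborel. \<bar>x s\<bar>) + noise t \<omega>"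
  shows "filterlim x at_top at_top \<or> ((x \<longlongrightarrow> 0) at_top \<and>
    (\<forall>m\<ge>1. (\<lambda>n. max 0 (escape_functional k m (real n) \<omega>)) \<longlonglongrightarrow> 0))"
proof -
  obtain r where r: "((\<lambda>t. noise t \<omega>) \<longlongrightarrow> r) at_top" using noise_convergent by blast
  have k0: "0 < k" using k by simp
  from tendsto_infinity_or_zero[OF k0 cont eq r]
  have "filterlim x at_top at_top \<or> (x \<longlongrightarrow> 0) at_top" by blast
  moreover have "(\<lambda>n. max 0 (escape_functional k m (real n) \<omega>)) \<longlonglongrightarrow> 0"
    if x0: "(x \<longlongrightarrow> 0) at_top" and m: "1 \<le> m" for m
  proof -
    let ?w = "\<lambda>u. W u \<omega> - W m \<omega>"
    obtain C where C: "0 \<le> C" "\<And>u. \<bar>W u \<omega>\<bar> \<le> C * (1 + \<bar>u\<bar>)" using W_growth by blast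
    have growth: "\<bar>?w u\<bar> \<le> (C + \<bar>W m \<omega>\<bar>) * (1 + \<bar>u\<bar>)" for u
    proof -
      have "\<bar>?w u\<bar> \<le> C * (1 + \<bar>u\<bar>) + \<bar>W m \<omega>\<bar> * 1" using C(2)[of u] by simp
      also have "\<dots> \<le> C * (1 + \<bar>u\<bar>) + \<bar>W m \<omega>\<bar> * (1 + \<bar>u\<bar>)"
        by (intro add_left_mono mult_left_mono) auto
      finally show ?thesis by (simp add: algebra_simps)
    qed
    have deriv: "((\<lambda>t. x t - exp (- t / 2) * ?w t) has_real_derivative
        (k * \<bar>x t\<bar> + exp (- t / 2) / 2 * ?w t)) (at t)" if t: "m < t" for t
    proof -
      let ?I = "\<lambda>t. LINT s:{1..t}|lborel. \<bar>x s\<bar>" and ?J = "\<lambda>t. LINT u:{1..t}|lborel. exp (- u / 2) / 2 * W u \<omega>"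
      have t1: "1 < t" using t m by simp
      have I: "(?I has_real_derivative \<bar>x t\<bar>) (at t)"
        by (rule indefinite_integral_deriv[OF _ t1]) (intro continuous_intros cont)
      have J: "(?J has_real_derivative exp (- t / 2) / 2 * W t \<omega>) (at t)"
        by (rule indefinite_integral_deriv[OF _ t1]) (auto intro!: continuous_intros W_continuous)
      have e: "((\<lambda>t. exp (- t / 2) * W m \<omega>) has_real_derivative - (exp (- t / 2) / 2 * W m \<omega>)) (at t)"
        by (auto intro!: derivative_eq_intros)
      have "((\<lambda>t. x 1 - exp (- 1 / 2) * W 1 \<omega> + k * ?I t + ?J t + exp (- t / 2) * W m \<omega>)
          has_real_derivative 0 + k * \<bar>x t\<bar> + exp (- t / 2) / 2 * W t \<omega> + - (exp (- t / 2) / 2 * W m \<omega>)) (at t)"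
        by (intro DERIV_add DERIV_const DERIV_cmult I J e)
      then show ?thesis
      proof (rule DERIV_cong_ev[THEN iffD1, rotated -1])
        have "\<forall>\<^sub>F u in nhds t. 1 < u" using eventually_nhds_in_open[of "{1<..}" t] t1 by simp
        then show "\<forall>\<^sub>F u in nhds t. x 1 - exp (- 1 / 2) * W 1 \<omega> + k * ?I u + ?J u + exp (- u / 2) * W m \<omega>
            = x u - exp (- u / 2) * ?w u"
        proof eventually_elim
          case (elim u)
          then show ?case using eq[of u] unfolding noise_eq right_diff_distrib by linarith
        qed
      qed (simp_all add: field_simps)
    qed
    define K where "K = - (exp (k * m) * (x m - exp (- m / 2) * ?w m))"
    have le: "escape_functional k m t \<omega> \<le> K * exp (- (k - 1 / 2) * t)" if "m \<le> t" for t
      unfolding escape_functional_def K_def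
    proof (rule escape_kernel_le[OF k that _ _ deriv growth x0])
      show "continuous_on {m..} x" using cont m by (auto intro: continuous_on_subset)
      show "continuous_on UNIV ?w" by (intro continuous_intros W_continuous)
    qed
    have e0: "(\<lambda>n. exp (- (k - 1 / 2) * real n)) \<longlonglongrightarrow> 0" using k by real_asymp
    have up: "(\<lambda>n. \<bar>K\<bar> * exp (- (k - 1 / 2) * real n)) \<longlonglongrightarrow> 0"
      using tendsto_mult_right_zero[OF e0] .
    have ev: "\<forall>\<^sub>F n in sequentially. max 0 (escape_functional k m (real n) \<omega>) \<le> \<bar>K\<bar> * exp (- (k - 1 / 2) * real n)"
      using eventually_ge_at_top[of "nat \<lceil>m\<rceil>"]
    proof eventually_elim
      case (elim n)
      then have "m \<le> real n" by linarith
      note le[OF this]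
      also have "K * exp (- (k - 1 / 2) * real n) \<le> \<bar>K\<bar> * exp (- (k - 1 / 2) * real n)"
        by (rule mult_right_mono) auto
      finally show ?case by simp
    qed
    show ?thesis
      by (rule tendsto_sandwich[OF _ ev tendsto_const up]) auto
  qed
  ultimately show ?thesis by blast
qed

text \<open>For each fixed time the Ito integral is almost surely the pathwise one. Since the other
  terms of the equation are continuous in time, agreement at dyadic times implies agreement
  at all times outside a single null set.\<close>

lemma sde_solution_path:
  assumes sol: "sde_solution M F B (\<lambda>t x. k * \<bar>x\<bar>) (\<lambda>t. exp (- t / 2)) 1 X"
  shows "AE \<omega> in M. continuous_on {1..} (\<lambda>t. X t \<omega>) \<and>
    (\<forall>t\<ge>1. X t \<omega> = X 1 \<omega> + k * (LINT s:{1..t}|lborel. \<bar>X s \<omega>\<bar>) + noise t \<omega>)"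
proof -
  obtain Y where ito: "\<And>t. 1 \<le> t \<Longrightarrow> is_ito_integral M F B 1 t (\<lambda>s \<omega>. exp (- s / 2)) (Y t)"
    and eq: "AE \<omega> in M. \<forall>t\<ge>1. X t \<omega> = X 1 \<omega> + (LINT s:{1..t}|lborel. k * \<bar>X s \<omega>\<bar>) + Y t \<omega>"
    and cont: "AE \<omega> in M. continuous_on {1..} (\<lambda>t. X t \<omega>)"
    using sol unfolding sde_solution_def by auto
  have Y: "AE \<omega> in M. Y t \<omega> = noise t \<omega>" if "1 \<le> t" for t
  proof (rule ito_integral_eq_wiener_integral[OF ito[OF that] _ that])
    show "((\<lambda>s. exp (- s / 2)) has_real_derivative - exp (- s / 2) / 2) (at s)" for s :: real
      by (auto intro!: derivative_eq_intros)
  qed (auto intro!: continuous_intros)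
  define D where "D = {t::real. 1 \<le> t \<and> (\<exists>(i::int) (j::nat). t = of_int i / 2 ^ j)}"
  have "countable D"
  proof (rule countable_subset)
    show "D \<subseteq> range (\<lambda>(i::int, j::nat). of_int i / 2 ^ j)" by (auto simp: D_def)
  qed simp
  then have "AE \<omega> in M. \<forall>t\<in>D. Y t \<omega> = noise t \<omega>"
    by (rule AE_ball_countable[THEN iffD2]) (use Y in \<open>simp only: D_def Ball_def mem_Collect_eq, blast\<close>)
  with eq cont show ?thesis
  proof eventually_elim
    case (elim \<omega>)
    let ?I = "\<lambda>t. LINT s:{1..t}|lborel. \<bar>X s \<omega>\<bar>"
    have I: "(LINT s:{1..t}|lborel. k * \<bar>X s \<omega>\<bar>) = k * ?I t" for t by simp
    have "X t \<omega> = X 1 \<omega> + k * ?I t + noise t \<omega>" if t: "1 \<le> t" for t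
    proof -
      let ?s = "\<lambda>j. of_int \<lfloor>t * 2 ^ j\<rfloor> / 2 ^ j :: real"
      have s1: "1 \<le> ?s j" for j
      proof -
        have "(2::real) ^ j \<le> t * 2 ^ j" using t by simp
        then have "(2::int) ^ j \<le> \<lfloor>t * 2 ^ j\<rfloor>" by (simp add: le_floor_iff)
        then have "(2::real) ^ j \<le> of_int \<lfloor>t * 2 ^ j\<rfloor>" by (metis of_int_le_iff of_int_numeral of_int_power)
        then show ?thesis by simp
      qed
      have st: "?s j \<le> t" for j by (simp add: divide_le_eq)
      have sD: "?s j \<in> D" for j using s1 unfolding D_def by blast
      have lim: "(\<lambda>j. f (?s j)) \<longlonglongrightarrow> f t" if "continuous_on {1..t} f" for f :: "real \<Rightarrow> real"
        using s1 st t by (intro continuous_on_tendsto_compose[OF that dyadic_floor_tendsto]) auto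
      have cX: "continuous_on {1..t} (\<lambda>t. X t \<omega>)" using elim(2) by (rule continuous_on_subset) auto
      have cI: "continuous_on {1..t} ?I"
        by (rule indefinite_integral_continuous) (intro continuous_intros elim(2))
      have "(\<lambda>j. X (?s j) \<omega>) \<longlonglongrightarrow> X t \<omega>" by (rule lim[OF cX])
      moreover have "(\<lambda>j. X (?s j) \<omega>) \<longlonglongrightarrow> X 1 \<omega> + k * ?I t + noise t \<omega>"
      proof -
        have "X (?s j) \<omega> = X 1 \<omega> + k * ?I (?s j) + noise (?s j) \<omega>" for j
          using elim(1)[rule_format, OF s1[of j]] elim(3)[rule_format, OF sD[of j]] I by simp
        moreover have "(\<lambda>j. X 1 \<omega> + k * ?I (?s j) + noise (?s j) \<omega>) \<longlonglongrightarrow> X 1 \<omega> + k * ?I t + noise t \<omega>"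
          by (rule lim) (intro continuous_intros cI noise_continuous)
        ultimately show ?thesis by simp
      qed
      ultimately show ?thesis by (rule LIMSEQ_unique)
    qed
    with elim(2) show ?case by blast
  qed
qed

end

text \<open>The events \<open>A n\<close> of being close to \<open>0\<close> at time \<open>n\<close> converge to the event of converging to \<open>0\<close>,
  because tending to infinity is the only alternative.\<close>

theorem theorem3p2:
  fixes M :: "'a measure" and F :: "real \<Rightarrow> 'a measure"
    and B X :: "real \<Rightarrow> 'a \<Rightarrow> real" and k :: real
  assumes "filtered_prob_space M F"
    and "standard_brownian_motion M F B"
    and "k > 1 / 2"
    and "sde_solution M F B (\<lambda>t x. k * \<bar>x\<bar>) (\<lambda>t. exp (- t / 2)) 1 X"
  shows "AE \<omega> in M. filterlim (\<lambda>t. X t \<omega>) at_top at_top"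
proof -
  interpret prob_space M using assms(1) by (simp add: filtered_prob_space_def)
  interpret brownian_motion M F B by (unfold_locales) (fact assms)+
  define A where "A n = {\<omega>\<in>space M. \<bar>X (real n) \<omega>\<bar> < 1}" for n :: nat
  define A' where "A' = (\<Union>N. \<Inter>n\<in>{N..}. A (Suc n))"
  have XF: "X (real n) \<in> borel_measurable (F (real n))" if "1 \<le> n" for n
    using assms(4) that by (simp add: sde_solution_def adapted_from_def)
  have AF: "A n \<in> sets (F (real n))" if "1 \<le> n" for n
  proof -
    have "{\<omega>\<in>space (F (real n)). \<bar>X (real n) \<omega>\<bar> < 1} \<in> sets (F (real n))"
      using XF[OF that] by (intro borel_measurable_less) auto
    then show ?thesis using subalgebra_F[of "real n"] by (simp add: A_def subalgebra_def)
  qed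
  have AM: "A (Suc n) \<in> events" for n
    using AF[of "Suc n"] subalgebra_F[of "real (Suc n)"] by (auto simp: subalgebra_def)
  have A'M: "A' \<in> events" unfolding A'_def using AM by (intro sets.countable_UN sets.countable_INT) auto
  have A'_iff: "\<omega> \<in> A' \<longleftrightarrow> (\<forall>\<^sub>F n in sequentially. \<omega> \<in> A n)" for \<omega>
    unfolding A'_def by (subst eventually_sequentially_Suc[symmetric]) (auto simp: eventually_sequentially)
  have alt: "AE \<omega> in M. filterlim (\<lambda>t. X t \<omega>) at_top at_top \<or> (((\<lambda>t. X t \<omega>) \<longlongrightarrow> 0) at_top \<and>
    (\<forall>m\<ge>1. (\<lambda>n. max 0 (escape_functional k m (real n) \<omega>)) \<longlonglongrightarrow> 0))"
    using sde_solution_path[OF assms(4)]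
    by eventually_elim (rule driven_path_alternative[OF assms(3)], blast+)
  have out: "\<forall>\<^sub>F n in sequentially. \<omega> \<notin> A n" if "filterlim (\<lambda>t. X t \<omega>) at_top at_top" for \<omega>
  proof -
    have "\<forall>\<^sub>F n in sequentially. 1 \<le> X (real n) \<omega>"
      using filterlim_compose[OF that filterlim_real_sequentially] by (simp add: filterlim_at_top)
    then show ?thesis by eventually_elim (auto simp: A_def)
  qed
  have inA: "\<forall>\<^sub>F n in sequentially. \<omega> \<in> A n" if "((\<lambda>t. X t \<omega>) \<longlongrightarrow> 0) at_top" "\<omega> \<in> space M" for \<omega>
  proof -
    have "(\<lambda>n. \<bar>X (real n) \<omega>\<bar>) \<longlonglongrightarrow> \<bar>0\<bar>"
      by (intro tendsto_rabs filterlim_compose[OF that(1) filterlim_real_sequentially])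
    then have "\<forall>\<^sub>F n in sequentially. \<bar>X (real n) \<omega>\<bar> < 1" by (rule order_tendstoD) simp
    then show ?thesis by eventually_elim (use that in \<open>auto simp: A_def\<close>)
  qed
  have notA': "\<omega> \<notin> A'" if "filterlim (\<lambda>t. X t \<omega>) at_top at_top" for \<omega>
  proof
    assume "\<omega> \<in> A'"
    then have "\<forall>\<^sub>F n in sequentially. \<omega> \<in> A n" by (simp add: A'_iff)
    with out[OF that] have "\<forall>\<^sub>F n::nat in sequentially. False" by eventually_elim simp
    then show False by simp
  qed
  have "prob A' = 0"
  proof (rule prob_confinement_eq_0[OF assms(3) AF A'M])
    show "AE \<omega> in M. \<forall>\<^sub>F m in sequentially. \<omega> \<in> A m \<longleftrightarrow> \<omega> \<in> A'"
      using alt AE_space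
    proof eventually_elim
      case (elim \<omega>)
      from elim(1) show ?case
      proof
        assume "filterlim (\<lambda>t. X t \<omega>) at_top at_top"
        then show ?thesis using out[of \<omega>] notA'[of \<omega>] by simp
      next
        assume "((\<lambda>t. X t \<omega>) \<longlongrightarrow> 0) at_top \<and>
          (\<forall>m\<ge>1. (\<lambda>n. max 0 (escape_functional k m (real n) \<omega>)) \<longlonglongrightarrow> 0)"
        then have "\<forall>\<^sub>F n in sequentially. \<omega> \<in> A n" using inA elim(2) by blast
        moreover from this have "\<omega> \<in> A'" by (simp add: A'_iff)
        ultimately show ?thesis by simp
      qed
    qed
    show "AE \<omega> in M. \<omega> \<in> A' \<longrightarrow> (\<lambda>n. max 0 (escape_functional k (real m) (real n) \<omega>)) \<longlonglongrightarrow> 0"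
      if "1 \<le> m" for m :: nat
      using alt by eventually_elim (use that notA' in auto)
  qed
  then have "AE \<omega> in M. \<omega> \<notin> A'"
    using A'M by (intro AE_not_in) (simp add: null_sets_def emeasure_eq_measure)
  with alt AE_space show ?thesis
    by eventually_elim (use inA A'_iff in blast)
qed

end
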